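(* Let $(K,v)$ be any valued field and $x$ transcendental over $\tilde{K}$. Then all extensions of $v$ to the rational function field $\tilde{K}(x)$ are of the form $\bullet$ $\tilde{v}_{a,\gamma}$, where $a\in\tilde{K}$ and $\gamma$ is an element of some ordered abelian group extension of $\tilde{v}\tilde{K}$, or $\bullet$ $\tilde{v}_{\mathbf{A}}$, where $\mathbf{A}$ is a pseudo Cauchy sequence in $(\tilde{K},\tilde{v})$ of transcendental type, where $\tilde{v}$ runs through all extensions of $v$ to $\tilde{K}$. The extension is of the form $\tilde{v}_{a,\gamma}$ with $\gamma\notin\tilde{v}\tilde{K}$ if and only if it is value-transcendental, and with $\gamma\in\tilde{v}\tilde{K}$ if and only if it is residue-transcendental. The extension is of the form $\tilde{v}_{\mathbf{A}}$ if and only if it is valuation-algebraic. All extensions of $v$ to $K(x)$ are obtained by restricting to $K(x)$ the extensions $\tilde{v}_{a,\gamma}$ (with $a\in\tilde{K}$ and $\gamma$ an element of some ordered abelian group extension of $\tilde{v}\tilde{K}$) and $\tilde{v}_{\mathbf{A}}$ (with $\mathbf{A}$ a pseudo Cauchy sequence in $(\tilde{K},\tilde{v})$ of transcendental type) of $v$ to $\tilde{K}(x)$, already from just one fixed extension $\tilde{v}$ of $v$ to $\tilde{K}$.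
   Context: $\tilde{K}$ is the algebraic closure of $K$; $vL$ and $Lv$ denote value group and residue field of $(L,v)$. Valuations are considered up to equivalence. For a valued field $(L,w)$, $a\in L$ and $\gamma$ in some ordered abelian group extension of $wL$, the map $w_{a,\gamma}$ on $L(x)$ is defined on polynomials $g(x)=\sum_{i=0}^n c_i(x-a)^i\in L[x]$ by $w_{a,\gamma}\,g=\min_{0\le i\le n}(wc_i+i\gamma)$, and by $w_{a,\gamma}(g/h)=w_{a,\gamma}g-w_{a,\gamma}h$; it is a valuation extending $w$. A pseudo Cauchy sequence in $(L,w)$ is a sequence $\mathbf{A}=(a_\nu)_{\nu<\lambda}$ ($\lambda$ a limit ordinal) of elements of $L$ with $w(a_\tau-a_\sigma)>w(a_\sigma-a_\rho)$ for all $\rho<\sigma<\tau<\lambda$. It is of transcendental type if for every $g\in L[x]$ the value $wg(a_\nu)$ is eventually constant, i.e., there is $\nu_0<\lambda$ with $wg(a_\nu)=wg(a_{\nu_0})$ for all $\nu_0\le\nu<\lambda$. In that case $w_{\mathbf{A}}$ is the valuation on $L(x)$ given by $w_{\mathbf{A}}\,g=wg(a_{\nu_0})$ (this eventual value) for $g\in L[x]$ and $w_{\mathbf{A}}(g/h)=w_{\mathbf{A}}g-w_{\mathbf{A}}h$. An extension $(F|K,v)$ with $F=K(x)$ or $F=\tilde{K}(x)$ is called valuation-algebraic if $vF/vK$ is a torsion group and $Fv|Kv$ is algebraic; value-transcendental if $vF/vK$ has rational rank $1$ and $Fv|Kv$ is algebraic; residue-transcendental if $Fv|Kv$ has transcendence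 degree $1$ and $vF/vK$ is a torsion group. *)

theory Defs
  imports
    "HOL-Algebra.Algebraic_Closure_Type"
    "HOL-Algebra.Finite_Extensions"
    "HOL-Algebra.Generated_Fields"
    "HOL-Algebra.Coset"
    "HOL-Library.Extended_Nat"
begin

section \<open>Ordered abelian groups with a largest element adjoined\<close>

datatype 'g with_inf = Fin 'g | Infty

instantiation with_inf :: (linordered_ab_group_add) "{linorder, comm_monoid_add, minus}"
begin

fun less_eq_with_inf :: "'a with_inf \<Rightarrow> 'a with_inf \<Rightarrow> bool" where
  "less_eq_with_inf (Fin a) (Fin b) \<longleftrightarrow> a \<le> b"
| "less_eq_with_inf _ Infty \<longleftrightarrow> True"
| "less_eq_with_inf Infty (Fin b) \<longleftrightarrow> False"

definition less_with_inf :: "'a with_inf \<Rightarrow> 'a with_inf \<Rightarrow> bool" where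
  "less_with_inf x y \<longleftrightarrow> x \<le> y \<and> \<not> y \<le> x"

definition zero_with_inf :: "'a with_inf" where
  "zero_with_inf = Fin 0"

fun plus_with_inf :: "'a with_inf \<Rightarrow> 'a with_inf \<Rightarrow> 'a with_inf" where
  "plus_with_inf (Fin a) (Fin b) = Fin (a + b)"
| "plus_with_inf _ _ = Infty"

text \<open>Only differences with a finite second argument are ever meaningful.\<close>

fun minus_with_inf :: "'a with_inf \<Rightarrow> 'a with_inf \<Rightarrow> 'a with_inf" where
  "minus_with_inf (Fin a) (Fin b) = Fin (a - b)"
| "minus_with_inf _ _ = Infty"

instance
proof
  fix x y z :: "'a with_inf"
  show "(x < y) = (x \<le> y \<and> \<not> y \<le> x)"
    by (fact less_with_inf_def)
  show "x \<le> x" by (cases x) auto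
  show "x \<le> y \<Longrightarrow> y \<le> z \<Longrightarrow> x \<le> z" by (cases x; cases y; cases z) auto
  show "x \<le> y \<Longrightarrow> y \<le> x \<Longrightarrow> x = y" by (cases x; cases y) auto
  show "x \<le> y \<or> y \<le> x" by (cases x; cases y) auto
  show "x + y + z = x + (y + z)" by (cases x; cases y; cases z) (auto simp: add.assoc)
  show "x + y = y + x" by (cases x; cases y) (auto simp: add.commute)
  show "0 + x = x" by (cases x) (auto simp: zero_with_inf_def)
qed

end

definition nsmul :: "nat \<Rightarrow> 'g::comm_monoid_add \<Rightarrow> 'g" where
  "nsmul n g = (\<Sum>i<n. g)"


section \<open>The divisible hull of an ordered abelian group\<close>

lemma nsmul_0 [simp]: "nsmul 0 g = 0"
  and nsmul_Suc [simp]: "nsmul (Suc n) g = g + nsmul n g"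
  by (simp_all add: nsmul_def add.commute)

lemma nsmul_add_right: "nsmul n (g + h) = nsmul n g + nsmul n h"
  by (induction n) (auto simp: ac_simps)

lemma nsmul_add_left: "nsmul (m + n) g = nsmul m g + nsmul n g"
  by (induction m) (auto simp: ac_simps)

lemma nsmul_mult: "nsmul (m * n) g = nsmul m (nsmul n g)"
  by (induction m) (auto simp: nsmul_add_left)

lemma nsmul_commute: "nsmul m (nsmul n g) = nsmul n (nsmul m g)"
  by (metis mult.commute nsmul_mult)

lemma nsmul_minus: "nsmul n (- g :: 'g :: ab_group_add) = - nsmul n g"
  by (induction n) auto

lemma nsmul_zero_right [simp]: "nsmul n 0 = 0"
  by (induction n) auto

lemma nsmul_mono: "g \<le> h \<Longrightarrow> nsmul n g \<le> nsmul n (h :: 'g :: linordered_ab_group_add)"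
  by (induction n) (auto intro: add_mono)

lemma nsmul_strict_mono:
  "g < h \<Longrightarrow> n > 0 \<Longrightarrow> nsmul n g < nsmul n (h :: 'g :: linordered_ab_group_add)"
proof (induction n)
  case (Suc n)
  then show ?case by (cases n) (auto intro: add_strict_mono)
qed auto

lemma nsmul_le_iff:
  "n > 0 \<Longrightarrow> nsmul n g \<le> nsmul n (h :: 'g :: linordered_ab_group_add) \<longleftrightarrow> g \<le> h"
  by (metis leD leI nsmul_mono nsmul_strict_mono)

lemma nsmul_eq_iff:
  "n > 0 \<Longrightarrow> nsmul n g = nsmul n (h :: 'g :: linordered_ab_group_add) \<longleftrightarrow> g = h"
  by (metis order_antisym nsmul_le_iff order_refl)

text \<open>
  The divisible hull is needed as follows: a valuation on \<open>K(x)\<close> with values in \<open>'g\<close> extends to the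
  algebraic closure of \<open>K\<close> with \<open>x\<close> adjoined only after enlarging the group of values. The enlarged
  group is contained in the divisible hull, which thus serves as the ordered abelian group
  extension in which the values \<open>\<gamma>\<close> for such a valuation exist.

  The pair \<open>(g, n)\<close> with \<open>n > 0\<close> stands for \<open>g / n\<close>.\<close>

definition div_hull_rel :: "'g::linordered_ab_group_add \<times> nat \<Rightarrow> 'g \<times> nat \<Rightarrow> bool" where
  "div_hull_rel x y \<longleftrightarrow>
     snd x > 0 \<and> snd y > 0 \<and> nsmul (snd y) (fst x) = nsmul (snd x) (fst y)"

lemma part_equivp_div_hull_rel: "part_equivp div_hull_rel"
proof (rule part_equivpI)
  show "\<exists>x::'a \<times> nat. div_hull_rel x x"
    by (rule exI[of _ "(0, 1)"]) (simp add: div_hull_rel_def)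
  show "symp (div_hull_rel :: 'a \<times> nat \<Rightarrow> _)"
    by (auto simp: symp_def div_hull_rel_def)
  show "transp (div_hull_rel :: 'a \<times> nat \<Rightarrow> _)"
  proof (rule transpI)
    fix x y z :: "'a \<times> nat"
    assume xy: "div_hull_rel x y" and yz: "div_hull_rel y z"
    have "nsmul (snd y) (nsmul (snd z) (fst x)) = nsmul (snd z) (nsmul (snd x) (fst y))"
      using xy by (metis div_hull_rel_def nsmul_commute)
    also have "\<dots> = nsmul (snd y) (nsmul (snd x) (fst z))"
      using yz by (metis div_hull_rel_def nsmul_commute)
    finally show "div_hull_rel x z"
      using xy yz by (auto simp: div_hull_rel_def nsmul_eq_iff)
  qed
qed

quotient_type (overloaded) 'g div_hull = "'g::linordered_ab_group_add \<times> nat" / partial: div_hull_rel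
  by (rule part_equivp_div_hull_rel)

instantiation div_hull :: (linordered_ab_group_add) linordered_ab_group_add
begin

lift_definition zero_div_hull :: "'a div_hull" is "(0, 1)"
  by (simp add: div_hull_rel_def)

lift_definition plus_div_hull :: "'a div_hull \<Rightarrow> 'a div_hull \<Rightarrow> 'a div_hull" is
  "\<lambda>x y. (nsmul (snd y) (fst x) + nsmul (snd x) (fst y), snd x * snd y)"
  by (auto simp: div_hull_rel_def nsmul_add_right simp flip: nsmul_mult)
     (metis (no_types, opaque_lifting) mult.assoc mult.commute nsmul_mult)

lift_definition uminus_div_hull :: "'a div_hull \<Rightarrow> 'a div_hull" is
  "\<lambda>x. (- fst x, snd x)"
  by (auto simp: div_hull_rel_def nsmul_minus)

definition minus_div_hull :: "'a div_hull \<Rightarrow> 'a div_hull \<Rightarrow> 'a div_hull" where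
  "minus_div_hull x y = x + - y"

lift_definition less_eq_div_hull :: "'a div_hull \<Rightarrow> 'a div_hull \<Rightarrow> bool" is
  "\<lambda>x y. nsmul (snd y) (fst x) \<le> nsmul (snd x) (fst y)"
proof -
  fix x x' y y' :: "'a \<times> nat"
  assume A: "div_hull_rel x x'" "div_hull_rel y y'"
  have "nsmul (snd y) (fst x) \<le> nsmul (snd x) (fst y) \<longleftrightarrow>
        nsmul (snd x' * snd y') (nsmul (snd y) (fst x)) \<le>
        nsmul (snd x' * snd y') (nsmul (snd x) (fst y))"
    using A by (simp add: nsmul_le_iff div_hull_rel_def)
  also have "nsmul (snd x' * snd y') (nsmul (snd y) (fst x)) =
             nsmul (snd x * snd y) (nsmul (snd y') (fst x'))"
    using A(1) unfolding div_hull_rel_def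
    by (metis (no_types, opaque_lifting) mult.assoc mult.commute nsmul_mult)
  also have "nsmul (snd x' * snd y') (nsmul (snd x) (fst y)) =
             nsmul (snd x * snd y) (nsmul (snd x') (fst y'))"
    using A(2) unfolding div_hull_rel_def
    by (metis (no_types, opaque_lifting) mult.assoc mult.commute nsmul_mult)
  also have "nsmul (snd x * snd y) (nsmul (snd y') (fst x')) \<le>
             nsmul (snd x * snd y) (nsmul (snd x') (fst y')) \<longleftrightarrow>
             nsmul (snd y') (fst x') \<le> nsmul (snd x') (fst y')"
    using A by (simp add: nsmul_le_iff div_hull_rel_def)
  finally show "nsmul (snd y) (fst x) \<le> nsmul (snd x) (fst y) \<longleftrightarrow>
                nsmul (snd y') (fst x') \<le> nsmul (snd x') (fst y')" .
qed

definition less_div_hull :: "'a div_hull \<Rightarrow> 'a div_hull \<Rightarrow> bool" where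
  "less_div_hull x y \<longleftrightarrow> x \<le> y \<and> \<not> y \<le> x"

instance
proof
  fix x y z :: "'a div_hull"
  show "x + y + z = x + (y + z)"
    by transfer (auto simp: div_hull_rel_def nsmul_add_right ac_simps simp flip: nsmul_mult)
  show "x + y = y + x"
    by transfer (auto simp: div_hull_rel_def ac_simps)
  show "0 + x = x"
    by transfer (auto simp: div_hull_rel_def)
  show "- x + x = 0"
    by transfer (auto simp: div_hull_rel_def nsmul_minus)
  show "x - y = x + - y"
    by (fact minus_div_hull_def)
  show "(x < y) = (x \<le> y \<and> \<not> y \<le> x)"
    by (fact less_div_hull_def)
  show "x \<le> x" by transfer auto
  show "x \<le> y \<or> y \<le> x" by transfer auto
  show "x \<le> y \<Longrightarrow> y \<le> x \<Longrightarrow> x = y"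
    by transfer (auto simp: div_hull_rel_def)
  show "x \<le> z" if "x \<le> y" "y \<le> z"
    using that
  proof transfer
    fix x y z :: "'a \<times> nat"
    assume pos: "div_hull_rel x x" "div_hull_rel y y" "div_hull_rel z z"
      and xy: "nsmul (snd y) (fst x) \<le> nsmul (snd x) (fst y)"
      and yz: "nsmul (snd z) (fst y) \<le> nsmul (snd y) (fst z)"
    have "nsmul (snd y) (nsmul (snd z) (fst x)) \<le> nsmul (snd z) (nsmul (snd x) (fst y))"
      using nsmul_mono[OF xy, of "snd z"] by (simp add: nsmul_commute)
    also have "\<dots> \<le> nsmul (snd y) (nsmul (snd x) (fst z))"
      using nsmul_mono[OF yz, of "snd x"] by (simp add: nsmul_commute)
    finally show "nsmul (snd z) (fst x) \<le> nsmul (snd x) (fst z)"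
      using pos by (simp add: nsmul_le_iff div_hull_rel_def)
  qed
  show "z + x \<le> z + y" if "x \<le> y"
    using that
  proof transfer
    fix x y z :: "'a \<times> nat"
    assume pos: "div_hull_rel x x" "div_hull_rel y y" "div_hull_rel z z"
      and xy: "nsmul (snd y) (fst x) \<le> nsmul (snd x) (fst y)"
    have "nsmul (snd z * snd z) (nsmul (snd y) (fst x)) \<le>
          nsmul (snd z * snd z) (nsmul (snd x) (fst y))"
      by (rule nsmul_mono[OF xy])
    then show "nsmul (snd (nsmul (snd y) (fst z) + nsmul (snd z) (fst y), snd z * snd y))
            (fst (nsmul (snd x) (fst z) + nsmul (snd z) (fst x), snd z * snd x))
         \<le> nsmul (snd (nsmul (snd x) (fst z) + nsmul (snd z) (fst x), snd z * snd x))
            (fst (nsmul (snd y) (fst z) + nsmul (snd z) (fst y), snd z * snd y))"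
      by (simp add: nsmul_add_right ac_simps flip: nsmul_mult)
  qed
qed

end


section \<open>Valued fields and their extensions\<close>

definition valuation :: "('a::field \<Rightarrow> 'g::linordered_ab_group_add with_inf) \<Rightarrow> bool" where
  "valuation v \<longleftrightarrow>
     (\<forall>a. v a = Infty \<longleftrightarrow> a = 0) \<and>
     (\<forall>a b. v (a * b) = v a + v b) \<and>
     (\<forall>a b. min (v a) (v b) \<le> v (a + b))"

definition valuation_ring :: "('a::field \<Rightarrow> 'g::linordered_ab_group_add with_inf) \<Rightarrow> 'a set" where
  "valuation_ring v = {a. 0 \<le> v a}"

definition equivalent ::
  "('a::field \<Rightarrow> 'g::linordered_ab_group_add with_inf) \<Rightarrow>
   ('a \<Rightarrow> 'h::linordered_ab_group_add with_inf) \<Rightarrow> bool" where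
  "equivalent v w \<longleftrightarrow> valuation_ring v = valuation_ring w"

text \<open>
  A field extension \<open>L|K\<close> is given by its embedding \<open>\<iota> :: K \<Rightarrow> L\<close>. As valuations are considered up
  to equivalence, the restriction of an extension need only be equivalent to the given valuation;
  so the two may take their values in different groups.
\<close>

definition extends ::
  "('a::field \<Rightarrow> 'b::field) \<Rightarrow> ('a \<Rightarrow> 'g::linordered_ab_group_add with_inf) \<Rightarrow>
   ('b \<Rightarrow> 'h::linordered_ab_group_add with_inf) \<Rightarrow> bool" where
  "extends \<iota> v w \<longleftrightarrow> valuation w \<and> equivalent v (w \<circ> \<iota>)"

definition value_group ::
  "('a::field \<Rightarrow> 'g::linordered_ab_group_add with_inf) \<Rightarrow> 'g monoid" where
  "value_group v = \<lparr>carrier = {g. \<exists>a. v a = Fin g}, monoid.mult = (+), one = 0\<rparr>"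

definition residue_field ::
  "('a::field \<Rightarrow> 'g::linordered_ab_group_add with_inf) \<Rightarrow> 'a set ring" where
  "residue_field v = (ring_of_type_algebra\<lparr>carrier := valuation_ring v\<rparr>) Quot {a. 0 < v a}"

text \<open>
  For a valuation \<open>w\<close> on the upper field of an extension with embedding \<open>\<iota>\<close>, the lower field is
  considered with the valuation \<open>w \<circ> \<iota>\<close>. The next two definitions are the quotient of the value
  groups, and the residue field of the lower field as a subfield of that of the upper one.
\<close>

definition value_group_quotient ::
  "('a::field \<Rightarrow> 'b::field) \<Rightarrow> ('b \<Rightarrow> 'g::linordered_ab_group_add with_inf) \<Rightarrow> 'g set monoid" where
  "value_group_quotient \<iota> w = value_group w Mod carrier (value_group (w \<circ> \<iota>))"

definition residue_subfield ::
  "('a::field \<Rightarrow> 'b::field) \<Rightarrow> ('b \<Rightarrow> 'g::linordered_ab_group_add with_inf) \<Rightarrow> 'b set set" where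
  "residue_subfield \<iota> w =
     (\<lambda>c. {a. 0 < w a} +>\<^bsub>ring_of_type_algebra\<lparr>carrier := valuation_ring w\<rparr>\<^esub> \<iota> c)
       ` valuation_ring (w \<circ> \<iota>)"


section \<open>Torsion, rational rank and transcendence degree\<close>

definition torsion_group :: "('a, 'm) monoid_scheme \<Rightarrow> bool" where
  "torsion_group G \<longleftrightarrow> (\<forall>g\<in>carrier G. \<exists>n::nat. n > 0 \<and> g [^]\<^bsub>G\<^esub> n = \<one>\<^bsub>G\<^esub>)"

definition rationally_independent :: "('a, 'm) monoid_scheme \<Rightarrow> 'a set \<Rightarrow> bool" where
  "rationally_independent G B \<longleftrightarrow>
     (\<forall>c::'a \<Rightarrow> int. finprod G (\<lambda>b. b [^]\<^bsub>G\<^esub> c b) B = \<one>\<^bsub>G\<^esub> \<longrightarrow> (\<forall>b\<in>B. c b = 0))"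

definition rational_rank :: "('a, 'm) monoid_scheme \<Rightarrow> enat" where
  "rational_rank G =
     Sup {enat (card B) | B. finite B \<and> B \<subseteq> carrier G \<and> rationally_independent G B}"

definition algebraic_extension :: "('a, 'm) ring_scheme \<Rightarrow> 'a set \<Rightarrow> bool" where
  "algebraic_extension R k \<longleftrightarrow> (\<forall>z\<in>carrier R. ring.algebraic R k z)"

text \<open>
  Algebraic independence of \<open>S\<close> over \<open>k\<close> is expressed by every \<open>s \<in> S\<close> being transcendental over
  the field generated by \<open>k\<close> and the other elements of \<open>S\<close>.
\<close>

definition transcendence_basis :: "('a, 'm) ring_scheme \<Rightarrow> 'a set \<Rightarrow> 'a set \<Rightarrow> bool" where
  "transcendence_basis R k S \<longleftrightarrow>
     S \<subseteq> carrier R \<and>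
     (\<forall>s\<in>S. ring.transcendental R (generate_field R (k \<union> (S - {s}))) s) \<and>
     algebraic_extension R (generate_field R (k \<union> S))"

definition has_transcendence_degree :: "('a, 'm) ring_scheme \<Rightarrow> 'a set \<Rightarrow> nat \<Rightarrow> bool" where
  "has_transcendence_degree R k n \<longleftrightarrow> (\<exists>S. finite S \<and> card S = n \<and> transcendence_basis R k S)"


section \<open>The three kinds of extensions\<close>

definition valuation_algebraic ::
  "('a::field \<Rightarrow> 'b::field) \<Rightarrow> ('b \<Rightarrow> 'g::linordered_ab_group_add with_inf) \<Rightarrow> bool" where
  "valuation_algebraic \<iota> w \<longleftrightarrow>
     torsion_group (value_group_quotient \<iota> w) \<and>
     algebraic_extension (residue_field w) (residue_subfield \<iota> w)"

definition value_transcendental ::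
  "('a::field \<Rightarrow> 'b::field) \<Rightarrow> ('b \<Rightarrow> 'g::linordered_ab_group_add with_inf) \<Rightarrow> bool" where
  "value_transcendental \<iota> w \<longleftrightarrow>
     rational_rank (value_group_quotient \<iota> w) = 1 \<and>
     algebraic_extension (residue_field w) (residue_subfield \<iota> w)"

definition residue_transcendental ::
  "('a::field \<Rightarrow> 'b::field) \<Rightarrow> ('b \<Rightarrow> 'g::linordered_ab_group_add with_inf) \<Rightarrow> bool" where
  "residue_transcendental \<iota> w \<longleftrightarrow>
     has_transcendence_degree (residue_field w) (residue_subfield \<iota> w) 1 \<and>
     torsion_group (value_group_quotient \<iota> w)"


section \<open>Rational function fields\<close>

text \<open>The rational function field over \<open>'a\<close> is the type \<open>'a poly fract\<close>.\<close>

definition ratfun_const :: "'a::field \<Rightarrow> 'a poly fract" where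
  "ratfun_const c = to_fract [:c:]"

lemma map_poly_to_ac_mult: "map_poly to_ac (p * q) = map_poly to_ac p * map_poly to_ac q"
proof -
  have to_ac_sum: "to_ac (sum f A) = (\<Sum>i\<in>A. to_ac (f i))" for f :: "nat \<Rightarrow> 'a" and A
    by (induction A rule: infinite_finite_induct) auto
  show ?thesis
    by (rule poly_eqI) (simp add: coeff_map_poly coeff_mult to_ac_sum)
qed

lemma map_poly_to_ac_eq_0_iff: "map_poly to_ac p = 0 \<longleftrightarrow> p = 0"
  by (auto simp: poly_eq_iff coeff_map_poly)

lemma fract_eq_Fract_rep:
  "snd (rep_fract f) \<noteq> 0 \<and> f = Fract (fst (rep_fract f)) (snd (rep_fract f))"
proof -
  have "fractrel (rep_fract f) (rep_fract f)"
    using Quotient_fract by (rule Quotient_rep_reflp)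
  then have nz: "snd (rep_fract f) \<noteq> 0"
    by simp
  have "f = abs_fract (rep_fract f)"
    by (simp add: Quotient_abs_rep[OF Quotient_fract])
  with nz show ?thesis
    by (simp add: Fract.abs_eq)
qed

definition ratfun_to_ac :: "'a::field poly fract \<Rightarrow> 'a alg_closure poly fract" where
  "ratfun_to_ac f =
     (let (p, q) = rep_fract f in Fract (map_poly to_ac p) (map_poly to_ac q))"

lemma ratfun_to_ac_Fract:
  assumes "q \<noteq> 0"
  shows "ratfun_to_ac (Fract p q) = Fract (map_poly to_ac p) (map_poly to_ac q)"
proof -
  obtain p' q' where rep: "rep_fract (Fract p q) = (p', q')"
    by fastforce
  have "q' \<noteq> 0" "Fract p q = Fract p' q'"
    using fract_eq_Fract_rep[of "Fract p q"] rep by auto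
  then have "p * q' = p' * q"
    using assms by (simp add: eq_fract)
  then show ?thesis
    using assms \<open>q' \<noteq> 0\<close> rep
    by (simp add: ratfun_to_ac_def eq_fract map_poly_to_ac_eq_0_iff flip: map_poly_to_ac_mult)
qed

text \<open>
  \<open>ratfun_val u\<close> is \<open>g/h \<mapsto> u g - u h\<close>; the choice of the representing fraction is immaterial when
  \<open>u\<close> is multiplicative and \<open>u h\<close> is finite for \<open>h \<noteq> 0\<close>.
\<close>

definition ratfun_val ::
  "('a::field poly \<Rightarrow> 'g::linordered_ab_group_add with_inf) \<Rightarrow> 'a poly fract \<Rightarrow> 'g with_inf" where
  "ratfun_val u f = (let (g, h) = rep_fract f in u g - u h)"

text \<open>
  The coefficients \<open>c\<^sub>i\<close> in \<open>g(x) = \<Sum>i. c\<^sub>i (x - a)^i\<close> are those of the polynomial \<open>g(x + a)\<close>.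
\<close>

definition monomial_poly_val ::
  "('a::field \<Rightarrow> 'g::linordered_ab_group_add with_inf) \<Rightarrow> 'a \<Rightarrow> 'g \<Rightarrow> 'a poly \<Rightarrow> 'g with_inf" where
  "monomial_poly_val w a \<gamma> g =
     Min ((\<lambda>i. w (coeff (pcompose g [:a, 1:]) i) + Fin (nsmul i \<gamma>)) ` {0..degree g})"

definition monomial_val ::
  "('a::field \<Rightarrow> 'g::linordered_ab_group_add with_inf) \<Rightarrow> 'a \<Rightarrow> 'g \<Rightarrow> 'a poly fract \<Rightarrow> 'g with_inf" where
  "monomial_val w a \<gamma> = ratfun_val (monomial_poly_val w a \<gamma>)"


section \<open>Pseudo Cauchy sequences\<close>

text \<open>
  A sequence indexed by a limit ordinal is a function on the field of a nonempty well-order without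
  a last element. Since the members of a pseudo Cauchy sequence are pairwise distinct, the elements
  of the valued field themselves always suffice as indices.
\<close>

definition limit_order :: "'i rel \<Rightarrow> bool" where
  "limit_order r \<longleftrightarrow>
     Well_order r \<and> Field r \<noteq> {} \<and> (\<forall>i\<in>Field r. \<exists>j\<in>Field r. (i, j) \<in> r - Id)"

definition pseudo_cauchy ::
  "('a::field \<Rightarrow> 'g::linordered_ab_group_add with_inf) \<Rightarrow> 'i rel \<Rightarrow> ('i \<Rightarrow> 'a) \<Rightarrow> bool" where
  "pseudo_cauchy w r A \<longleftrightarrow>
     limit_order r \<and>
     (\<forall>\<rho> \<sigma> \<tau>. (\<rho>, \<sigma>) \<in> r - Id \<longrightarrow> (\<sigma>, \<tau>) \<in> r - Id \<longrightarrow>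
        w (A \<tau> - A \<sigma>) > w (A \<sigma> - A \<rho>))"

definition has_eventual_value ::
  "('a::field \<Rightarrow> 'g::linordered_ab_group_add with_inf) \<Rightarrow> 'i rel \<Rightarrow> ('i \<Rightarrow> 'a) \<Rightarrow>
   'a poly \<Rightarrow> 'g with_inf \<Rightarrow> bool" where
  "has_eventual_value w r A g y \<longleftrightarrow>
     (\<exists>\<nu>\<^sub>0\<in>Field r. \<forall>\<nu>. (\<nu>\<^sub>0, \<nu>) \<in> r \<longrightarrow> w (poly g (A \<nu>)) = y)"

definition transcendental_type ::
  "('a::field \<Rightarrow> 'g::linordered_ab_group_add with_inf) \<Rightarrow> 'i rel \<Rightarrow> ('i \<Rightarrow> 'a) \<Rightarrow> bool" where
  "transcendental_type w r A \<longleftrightarrow>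
     pseudo_cauchy w r A \<and> (\<forall>g. \<exists>y. has_eventual_value w r A g y)"

definition limit_val ::
  "('a::field \<Rightarrow> 'g::linordered_ab_group_add with_inf) \<Rightarrow> 'i rel \<Rightarrow> ('i \<Rightarrow> 'a) \<Rightarrow>
   'a poly fract \<Rightarrow> 'g with_inf" where
  "limit_val w r A = ratfun_val (\<lambda>g. THE y. has_eventual_value w r A g y)"

end

theory Submission
  imports Defs
begin

text \<open>
  Let \<open>L\<close> be algebraically closed. A valuation \<open>w\<close> of \<open>L(x)\<close> is determined by its restriction to \<open>L\<close>
  and the values \<open>w(x - b)\<close>, since polynomials split. If these values have a maximum, attained at \<open>a\<close>,
  the ultrametric inequality forces \<open>w(x - b) = min (w(a - b)) (w(x - a))\<close>, so \<open>w\<close> is monomial, and its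
  kind depends on whether \<open>w(x - a)\<close> is the value of a constant. If there is no maximum, a well-ordered
  cofinal family of elements \<open>b\<close> is a pseudo Cauchy sequence, and every element of \<open>L(x)\<close> agrees with a
  constant up to a factor congruent to \<open>1\<close>; so neither the value group nor the residue field grows from
  \<open>L\<close> to \<open>L(x)\<close>.

  For \<open>L\<close> the algebraic closure of \<open>K\<close>, valuations of \<open>L\<close> and \<open>K(x)\<close> that agree on \<open>K\<close> have a common
  extension to \<open>L(x)\<close>, without recourse to the conjugacy of extensions: by linear disjointness, the two
  maximal ideals generate a proper ideal in the compositum of the valuation rings, and Chevalley's
  theorem applies. As \<open>L(x)|K(x)\<close> is algebraic, the values lie in the divisible hull.
\<close>

section \<open>Values and valuation rings\<close>

text \<open>Chevalley's theorem yields only a ring, without a group of values. The values are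
  recovered from the valuation given on the smaller field: if a power \<open>z ^ n\<close> is a unit
  times an element of value \<open>g\<close>, then \<open>z\<close> must get the value
  \<open>g / n\<close>. This is why valuation rings are handled as bare sets, and why the divisible
  hull enters when passing from K(x) to L(x). For a valuation already given on L(x), its restriction
  to L and the element \<open>\<gamma>\<close> stay in the original group. Equivalent valuations may
  have different groups, so the dichotomy between a maximum and no maximum is stated by comparing
  values of the elements x - b under \<open>w\<close> alone. Both normal forms can then be
  recognised in every valuation equivalent to them. Only the direction from forms to kinds is proved
  directly. Torsion of the value group quotient and algebraicity of the residue extension tell the
  three kinds apart, so the converse follows because one of the forms always occurs.\<close>

lemma Infty_le_iff [simp]: "Infty \<le> (x :: 'g::linordered_ab_group_add with_inf) \<longleftrightarrow> x = Infty"
  by (cases x) auto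

lemma Fin_less_iff [simp]: "Fin a < Fin b \<longleftrightarrow> (a :: 'g::linordered_ab_group_add) < b"
  by (auto simp: less_with_inf_def)

lemma less_Infty_iff [simp]: "x < (Infty :: 'g::linordered_ab_group_add with_inf) \<longleftrightarrow> x \<noteq> Infty"
  by (cases x) (auto simp: less_with_inf_def)

lemma not_Infty_less [simp]: "\<not> (Infty :: 'g::linordered_ab_group_add with_inf) < x"
  by (simp add: less_with_inf_def)

lemma plus_eq_Infty_iff [simp]:
  "x + y = Infty \<longleftrightarrow> x = Infty \<or> y = (Infty :: 'g::linordered_ab_group_add with_inf)"
  by (cases x; cases y) auto

lemma Fin_0: "Fin 0 = 0"
  by (simp add: zero_with_inf_def)

lemma zero_neq_Infty [simp]:
  "0 \<noteq> (Infty :: 'g::linordered_ab_group_add with_inf)"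
  "Infty \<noteq> (0 :: 'g::linordered_ab_group_add with_inf)"
  by (simp_all add: zero_with_inf_def)

instance with_inf :: (linordered_ab_group_add) ordered_comm_monoid_add
proof
  fix a b c :: "'a with_inf"
  show "a \<le> b \<Longrightarrow> c + a \<le> c + b"
    by (cases a; cases b; cases c) auto
qed

lemma with_inf_add_le_cancel:
  "c \<noteq> Infty \<Longrightarrow> c + a \<le> c + b \<longleftrightarrow> a \<le> (b :: 'g::linordered_ab_group_add with_inf)"
  by (cases a; cases b; cases c) auto

lemma with_inf_add_less_cancel:
  "c \<noteq> Infty \<Longrightarrow> c + a < c + b \<longleftrightarrow> a < (b :: 'g::linordered_ab_group_add with_inf)"
  by (cases a; cases b; cases c) auto

lemma with_inf_add_eq_cancel:
  "c \<noteq> Infty \<Longrightarrow> c + a = c + b \<longleftrightarrow> a = (b :: 'g::linordered_ab_group_add with_inf)"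
  by (cases a; cases b; cases c) auto

lemma with_inf_add_less_le_mono:
  "a < b \<Longrightarrow> c \<le> d \<Longrightarrow> c \<noteq> Infty \<Longrightarrow> a + c < b + (d :: 'g::linordered_ab_group_add with_inf)"
  by (cases a; cases b; cases c; cases d) (auto intro: add_less_le_mono)

lemma with_inf_minus_eq_iff:
  "z \<noteq> Infty \<Longrightarrow> y - z = x \<longleftrightarrow> y = x + (z :: 'g::linordered_ab_group_add with_inf)"
  by (cases x; cases y; cases z) (auto simp: algebra_simps)

lemma with_inf_le_minus_iff:
  "z \<noteq> Infty \<Longrightarrow> x \<le> y - z \<longleftrightarrow> x + z \<le> (y :: 'g::linordered_ab_group_add with_inf)"
  by (cases x; cases y; cases z) (auto simp: algebra_simps)

lemma min_add_distrib:
  "min a b + c = min (a + c) (b + (c :: 'g::linordered_ab_group_add with_inf))"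
  by (cases a; cases b; cases c) (auto simp: min_def)

lemma nsmul_Fin: "nsmul n (Fin g) = Fin (nsmul n (g :: 'g::linordered_ab_group_add))"
  by (induction n) (auto simp: Fin_0)

lemma nsmul_Infty: "n > 0 \<Longrightarrow> nsmul n Infty = (Infty :: 'g::linordered_ab_group_add with_inf)"
  by (cases n) auto

locale valued =
  fixes w :: "'a::field \<Rightarrow> 'g::linordered_ab_group_add with_inf"
  assumes valuation: "valuation w"
begin

lemma eq_Infty_iff [simp]: "w a = Infty \<longleftrightarrow> a = 0"
  and mult: "w (a * b) = w a + w b"
  and add: "min (w a) (w b) \<le> w (a + b)"
  using valuation by (auto simp: valuation_def)

lemma zero [simp]: "w 0 = Infty"
  by simp

lemma nonzero_cases:
  assumes "a \<noteq> 0"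
  obtains g where "w a = Fin g"
  using assms by (cases "w a") auto

lemma one [simp]: "w 1 = 0"
  using mult[of 1 1] with_inf_add_eq_cancel[of "w 1" 0 "w 1"] by auto

lemma minus [simp]: "w (- a) = w a"
proof -
  obtain g where g: "w (- 1) = Fin g"
    using nonzero_cases[of "- 1"] by auto
  have "w (- 1) + w (- 1) = 0"
    using mult[of "- 1" "- 1"] by simp
  \<comment> \<open>In an ordered abelian group \<open>g + g = 0\<close> forces
    \<open>g = 0\<close>.\<close>
  then have "g = 0"
    by (simp add: g zero_with_inf_def)
  then show ?thesis
    using mult[of "- 1" a] g by (simp add: Fin_0)
qed

lemma diff: "min (w a) (w b) \<le> w (a - b)"
  using add[of a "- b"] by simp

lemma diff_commute: "w (a - b) = w (b - a)"
  using minus[of "a - b"] by simp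

lemma add_eq_left:
  assumes "w a < w b"
  shows "w (a + b) = w a"
proof (rule antisym)
  have "min (w (a + b)) (w b) \<le> w a"
    using diff[of "a + b" b] by simp
  then show "w (a + b) \<le> w a"
    using assms by (simp add: min_def not_le split: if_splits)
  show "w a \<le> w (a + b)"
    using add[of a b] assms by (simp add: min_def split: if_splits)
qed

lemma diff_eq_min:
  assumes "w a \<noteq> w b"
  shows "w (a - b) = min (w a) (w b)"
proof (cases "w a < w b")
  case True
  then show ?thesis
    using add_eq_left[of a "- b"] by (simp add: min_def less_imp_le)
next
  case False
  then show ?thesis
    using assms add_eq_left[of b "- a"] diff_commute[of a b] by (simp add: min_def not_less)
qed

lemma power: "w (a ^ n) = nsmul n (w a)"
  by (induction n) (auto simp: mult)

lemma inverse: "a \<noteq> 0 \<Longrightarrow> w a + w (inverse a) = 0"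
  by (simp flip: mult)

lemma divide: "b \<noteq> 0 \<Longrightarrow> w (a / b) + w b = w a"
  by (simp flip: mult)

lemma le_iff_divide: "a \<noteq> 0 \<Longrightarrow> w a \<le> w b \<longleftrightarrow> 0 \<le> w (b / a)"
  using with_inf_add_le_cancel[of "w a" 0 "w (b / a)"] divide[of a b] by (simp add: add.commute)

lemma less_iff_divide: "a \<noteq> 0 \<Longrightarrow> w a < w b \<longleftrightarrow> 0 < w (b / a)"
  using with_inf_add_less_cancel[of "w a" 0 "w (b / a)"] divide[of a b] by (simp add: add.commute)

lemma eq_iff_divide: "a \<noteq> 0 \<Longrightarrow> w b = w a \<longleftrightarrow> w (b / a) = 0"
  using with_inf_add_eq_cancel[of "w a" "w (b / a)" 0] divide[of a b] by (simp add: add.commute)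

lemma add_nonneg: "0 \<le> w a \<Longrightarrow> 0 \<le> w b \<Longrightarrow> 0 \<le> w (a + b)"
  using add[of a b] by (auto simp: min_def split: if_splits)

lemma add_pos: "0 < w a \<Longrightarrow> 0 < w b \<Longrightarrow> 0 < w (a + b)"
  using add[of a b] by (auto simp: min_def split: if_splits)

lemma diff_pos: "0 < w a \<Longrightarrow> 0 < w b \<Longrightarrow> 0 < w (a - b)"
  using diff[of a b] by (auto simp: min_def split: if_splits)

lemma mult_nonneg: "0 \<le> w a \<Longrightarrow> 0 \<le> w b \<Longrightarrow> 0 \<le> w (a * b)"
  by (simp add: mult)

lemma mult_pos: "0 < w a \<Longrightarrow> 0 \<le> w b \<Longrightarrow> 0 < w (a * b)"
  using with_inf_add_less_le_mono[of 0 "w a" 0 "w b"] by (simp add: mult)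

lemma sum_pos: "(\<And>i. i \<in> I \<Longrightarrow> 0 < w (f i)) \<Longrightarrow> 0 < w (\<Sum>i\<in>I. f i)"
  by (induction I rule: infinite_finite_induct) (auto intro: add_pos)

lemma unit_add_pos: "w a = 0 \<Longrightarrow> 0 < w b \<Longrightarrow> w (a + b) = 0"
  using add_eq_left[of a b] by simp

text \<open>Multiplication by \<open>n > 0\<close> is injective on an ordered abelian group. Hence a
  value that no constant attains has no multiple attained by the \<open>n\<close>-th power of a
  constant.\<close>

lemma root_value:
  assumes "n > 0" "nsmul n (w a) = nsmul n (w b)"
  shows "w a = w b"
proof (cases "a = 0 \<or> b = 0")
  case True
  then have "nsmul n (w a) = Infty"
    using assms(2) by (auto simp: nsmul_Infty[OF assms(1)])
  with assms show ?thesis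
    by (cases "w a"; cases "w b") (auto simp: nsmul_Fin nsmul_Infty)
next
  case False
  then obtain g h where "w a = Fin g" "w b = Fin h"
    using nonzero_cases by metis
  with assms show ?thesis
    by (simp add: nsmul_Fin nsmul_eq_iff)
qed

end

text \<open>Dividing by the summand of smaller value reduces the ultrametric inequality to sums with
  1. In this form it is immediate once the elements of nonnegative value are known to form a
  ring.\<close>

lemma valuationI:
  fixes w :: "'a::field \<Rightarrow> 'g::linordered_ab_group_add with_inf"
  assumes inf: "\<And>a. w a = Infty \<longleftrightarrow> a = 0"
    and mult: "\<And>a b. a \<noteq> 0 \<Longrightarrow> b \<noteq> 0 \<Longrightarrow> w (a * b) = w a + w b"
    and add: "\<And>a. 0 \<le> w a \<Longrightarrow> 0 \<le> w (1 + a)"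
  shows "valuation w"
proof -
  have mult': "w (a * b) = w a + w b" for a b
  proof (cases "a = 0 \<or> b = 0")
    case True
    then show ?thesis
      using inf[of 0] by auto
  next
    case False
    then show ?thesis
      by (simp add: mult)
  qed
  have *: "w a \<le> w (a + b)" if "w a \<le> w b" for a b
  proof (cases "a = 0")
    case True
    then show ?thesis
      using that inf[of 0] by simp
  next
    case False
    have eq: "w b = w a + w (b / a)" "w (a + b) = w a + w (1 + b / a)"
      using mult'[of a "b / a"] mult'[of a "1 + b / a"] False by (simp_all add: distrib_left)
    have nz: "w a \<noteq> Infty"
      using False inf by auto
    have "w a + 0 \<le> w a + w (b / a)"
      using that eq by simp
    then have "0 \<le> w (b / a)"
      unfolding with_inf_add_le_cancel[OF nz] .
    then have "w a + 0 \<le> w a + w (1 + b / a)"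
      unfolding with_inf_add_le_cancel[OF nz] by (rule add)
    then show ?thesis
      using eq by simp
  qed
  have "min (w a) (w b) \<le> w (a + b)" for a b
    using *[of a b] *[of b a] by (auto simp: min_def add.commute)
  then show ?thesis
    unfolding valuation_def using inf mult' by blast
qed

text \<open>The valuation ring decides whether \<open>b / a\<close> has nonnegative value, hence the
  whole order on the values. Conditions phrased by comparing values therefore pass between
  equivalent valuations, even with different groups.\<close>

lemma equivalent_le_iff:
  assumes "valuation v" "valuation w" "equivalent v w"
  shows "v a \<le> v b \<longleftrightarrow> w a \<le> w b"
proof -
  interpret v: valued v by (rule valued.intro, fact)
  interpret w: valued w by (rule valued.intro, fact)
  show ?thesis
  proof (cases "a = 0")
    case False
    then show ?thesis
      using assms(3) by (auto simp: v.le_iff_divide w.le_iff_divide equivalent_def valuation_ring_def)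
  qed auto
qed

lemma equivalent_eq_iff:
  assumes "valuation v" "valuation w" "equivalent v w"
  shows "v a = v b \<longleftrightarrow> w a = w b"
  using equivalent_le_iff[OF assms] by (metis order_antisym order_refl)

lemma equivalent_less_iff:
  assumes "valuation v" "valuation w" "equivalent v w"
  shows "v a < v b \<longleftrightarrow> w a < w b"
  using equivalent_le_iff[OF assms] by (metis not_le)

lemma equivalent_sym: "equivalent v w \<Longrightarrow> equivalent w v"
  by (simp add: equivalent_def)

lemma equivalent_trans: "equivalent u v \<Longrightarrow> equivalent v w \<Longrightarrow> equivalent u w"
  by (simp add: equivalent_def)

lemma equivalent_refl [simp]: "equivalent v v"
  by (simp add: equivalent_def)

lemma equivalent_comp: "equivalent v w \<Longrightarrow> equivalent (v \<circ> f) (w \<circ> f)"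
  by (auto simp: equivalent_def valuation_ring_def set_eq_iff)

section \<open>Valuation rings as subsets of a field\<close>

locale valring =
  fixes V :: "'a::field set"
  assumes one [simp]: "1 \<in> V"
    and add: "a \<in> V \<Longrightarrow> b \<in> V \<Longrightarrow> a + b \<in> V"
    and mult: "a \<in> V \<Longrightarrow> b \<in> V \<Longrightarrow> a * b \<in> V"
    and minus: "a \<in> V \<Longrightarrow> - a \<in> V"
    and total: "a \<in> V \<or> inverse a \<in> V"
begin

text \<open>The maximal ideal, consisting of the nonunits. Zero is listed separately because
  \<open>inverse 0 = 0\<close> lies in \<open>V\<close>.\<close>

definition \<mm> :: "'a set" where
  "\<mm> = {a. a = 0 \<or> inverse a \<notin> V}"

lemma zero [simp]: "0 \<in> V"
  using total[of 0] by simp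

lemma power: "a \<in> V \<Longrightarrow> a ^ n \<in> V"
  by (induction n) (auto intro: mult)

lemma \<mm>_subset: "a \<in> \<mm> \<Longrightarrow> a \<in> V"
  using total[of a] by (auto simp: \<mm>_def)

lemma one_not_in_\<mm> [simp]: "1 \<notin> \<mm>"
  by (simp add: \<mm>_def)

lemma \<mm>_mult:
  assumes "a \<in> \<mm>" "b \<in> V"
  shows "a * b \<in> \<mm>"
proof (rule ccontr)
  assume *: "a * b \<notin> \<mm>"
  then have "inverse (a * b) \<in> V" "a \<noteq> 0" "b \<noteq> 0"
    by (auto simp: \<mm>_def)
  then have "inverse a \<in> V"
    using mult[of "inverse (a * b)" b] assms(2) by (simp add: field_simps)
  with \<open>a \<noteq> 0\<close> assms show False
    by (simp add: \<mm>_def)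
qed

text \<open>Of two nonzero elements one divides the other in \<open>V\<close>, so their sum is a
  multiple of one of them.\<close>

lemma \<mm>_add:
  assumes "a \<in> \<mm>" "b \<in> \<mm>"
  shows "a + b \<in> \<mm>"
proof -
  have *: "a + b \<in> \<mm>" if "a \<in> \<mm>" "a \<noteq> 0" "b / a \<in> V" for a b
  proof -
    have "a * (1 + b / a) \<in> \<mm>"
      using that by (intro \<mm>_mult add) auto
    then show ?thesis
      using that by (simp add: distrib_left)
  qed
  show ?thesis
  proof (cases "a = 0 \<or> b = 0")
    case False
    then have "b / a \<in> V \<or> a / b \<in> V"
      using total[of "a / b"] by auto
    then show ?thesis
      using *[of a b] *[of b a] False assms by (auto simp: add.commute)
  qed (use assms in auto)
qed

lemma \<mm>_sum: "(\<And>i. i \<in> I \<Longrightarrow> f i \<in> \<mm>) \<Longrightarrow> (\<Sum>i\<in>I. f i) \<in> \<mm>"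
proof (induction I rule: infinite_finite_induct)
qed (auto intro: \<mm>_add simp: \<mm>_def[THEN eqset_imp_iff, of 0])

text \<open>Divisibility in \<open>V\<close> is a total preorder on the nonzero elements. The result
  serves to scale a relation until its coefficients lie in \<open>V\<close> and one of them equals
  1.\<close>

lemma exists_dividing:
  assumes "finite I" "i \<in> I" "f i \<noteq> 0"
  shows "\<exists>k\<in>I. f k \<noteq> 0 \<and> (\<forall>j\<in>I. f j / f k \<in> V)"
proof -
  define J where "J = {j\<in>I. f j \<noteq> 0}"
  have "finite J" "J \<noteq> {}"
    using assms by (auto simp: J_def)
  moreover have "\<forall>j\<in>J. f j \<noteq> 0"
    by (simp add: J_def)
  ultimately have "\<exists>k\<in>J. \<forall>j\<in>J. f j / f k \<in> V"
  proof (induction J rule: finite_ne_induct)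
    case (insert a J)
    then obtain k where k: "k \<in> J" "\<forall>j\<in>J. f j / f k \<in> V"
      by auto
    show ?case
    proof (cases "f a / f k \<in> V")
      case True
      then show ?thesis
        using k insert.prems by (intro bexI[of _ k]) auto
    next
      case False
      then have ka: "f k / f a \<in> V"
        using total[of "f a / f k"] by simp
      have "f j / f a \<in> V" if "j \<in> J" for j
      proof -
        have "f j / f a = f j / f k * (f k / f a)"
          using insert.prems k by simp
        also have "\<dots> \<in> V"
          using k that ka by (intro mult) auto
        finally show ?thesis .
      qed
      then show ?thesis
        using insert.prems by (intro bexI[of _ a]) auto
    qed
  qed auto
  then obtain k where k: "k \<in> J" "\<forall>j\<in>J. f j / f k \<in> V"
    by blast
  have "f j / f k \<in> V" if "j \<in> I" for j
    using k that by (cases "f j = 0") (auto simp: J_def)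
  then show ?thesis
    using k by (auto simp: J_def)
qed

text \<open>Divided by a term of least value, the remaining terms sum to \<open>- 1\<close>, a unit,
  so they cannot all lie in \<open>\<mm>\<close>. This is the familiar fact that the least value in
  a vanishing sum is attained twice.\<close>

lemma sum_eq_0_imp_associated:
  assumes "finite I" "(\<Sum>i\<in>I. f i) = 0" "i \<in> I" "f i \<noteq> 0"
  shows "\<exists>j\<in>I. \<exists>k\<in>I. j \<noteq> k \<and> f j \<noteq> 0 \<and> f k \<noteq> 0 \<and> f j / f k \<in> V \<and> f k / f j \<in> V"
proof -
  obtain k where k: "k \<in> I" "f k \<noteq> 0" "\<forall>j\<in>I. f j / f k \<in> V"
    using exists_dividing[of I i f] assms by blast
  have "(\<Sum>j\<in>I. f j / f k) = 0"
    using assms(2) by (simp flip: sum_divide_distrib)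
  then have "(\<Sum>j\<in>I - {k}. f j / f k) = - 1"
    using k assms(1) by (simp add: sum.remove[of I k] add_eq_0_iff)
  moreover have "- 1 \<notin> \<mm>"
    using minus[of 1] by (auto simp: \<mm>_def)
  ultimately obtain j where "j \<in> I - {k}" "f j / f k \<notin> \<mm>"
    using \<mm>_sum[of "I - {k}" "\<lambda>j. f j / f k"] by auto
  then show ?thesis
    using k by (intro bexI[of _ j] bexI[of _ k]) (auto simp: \<mm>_def)
qed

text \<open>Valuation rings are integrally closed. For roots this is direct:
  \<open>a \<notin> V\<close> would put \<open>inverse a\<close> into \<open>\<mm>\<close>, and 1
  would be a multiple of it.\<close>

lemma power_in_iff:
  assumes "n > 0"
  shows "a ^ n \<in> V \<longleftrightarrow> a \<in> V"
proof
  assume *: "a ^ n \<in> V"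
  show "a \<in> V"
  proof (rule ccontr)
    assume "a \<notin> V"
    then have "inverse a \<in> \<mm>" "a \<noteq> 0"
      by (auto simp: \<mm>_def)
    then have "inverse a * (inverse a ^ (n - 1) * a ^ n) \<in> \<mm>"
      by (intro \<mm>_mult mult power[of "inverse a"] \<mm>_subset *)
    moreover have "inverse a * (inverse a ^ (n - 1) * a ^ n) = 1"
      using \<open>a \<noteq> 0\<close> assms by (cases n) (auto simp: power_inverse field_simps)
    ultimately show False
      by simp
  qed
qed (rule power)

end

lemma (in valued) valring: "valring (valuation_ring w)"
proof
  fix a
  show "a \<in> valuation_ring w \<or> inverse a \<in> valuation_ring w"
  proof (cases "a = 0")
    case False
    then obtain g h where "w a = Fin g" "w (inverse a) = Fin h"
      using nonzero_cases by (metis inverse_nonzero_iff_nonzero)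
    then show ?thesis
      using inverse[OF False] by (auto simp: valuation_ring_def zero_with_inf_def add_eq_0_iff2)
  qed (simp add: valuation_ring_def)
qed (auto simp: valuation_ring_def intro: add_nonneg mult_nonneg)

section \<open>Chevalley's extension theorem\<close>

definition proper_ideal_of :: "'a::field set \<Rightarrow> 'a set \<Rightarrow> bool" where
  "proper_ideal_of A J \<longleftrightarrow>
     1 \<in> A \<and> (\<forall>a\<in>A. \<forall>b\<in>A. a + b \<in> A \<and> a * b \<in> A) \<and> (\<forall>a\<in>A. - a \<in> A) \<and>
     J \<subseteq> A \<and> 0 \<in> J \<and> (\<forall>a\<in>J. \<forall>b\<in>J. a + b \<in> J) \<and> (\<forall>a\<in>A. \<forall>b\<in>J. a * b \<in> J) \<and> 1 \<notin> J"

lemma proper_ideal_ofD: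
  assumes "proper_ideal_of A J"
  shows "1 \<in> A" "a \<in> A \<Longrightarrow> b \<in> A \<Longrightarrow> a + b \<in> A" "a \<in> A \<Longrightarrow> b \<in> A \<Longrightarrow> a * b \<in> A"
    "a \<in> A \<Longrightarrow> - a \<in> A" "a \<in> J \<Longrightarrow> a \<in> A" "0 \<in> J" "a \<in> J \<Longrightarrow> b \<in> J \<Longrightarrow> a + b \<in> J"
    "a \<in> A \<Longrightarrow> b \<in> J \<Longrightarrow> a * b \<in> J" "1 \<notin> J" "a \<in> J \<Longrightarrow> - a \<in> J"
proof -
  show "a \<in> J \<Longrightarrow> - a \<in> J"
    using assms unfolding proper_ideal_of_def by (metis mult_minus_left mult_1)
qed (use assms in \<open>auto simp: proper_ideal_of_def\<close>)

lemma proper_ideal_ofI: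
  assumes "1 \<in> A" "\<And>a b. a \<in> A \<Longrightarrow> b \<in> A \<Longrightarrow> a + b \<in> A" "\<And>a b. a \<in> A \<Longrightarrow> b \<in> A \<Longrightarrow> a * b \<in> A"
    "\<And>a. a \<in> A \<Longrightarrow> - a \<in> A" "J \<subseteq> A" "0 \<in> J" "\<And>a b. a \<in> J \<Longrightarrow> b \<in> J \<Longrightarrow> a + b \<in> J"
    "\<And>a b. a \<in> A \<Longrightarrow> b \<in> J \<Longrightarrow> a * b \<in> J" "1 \<notin> J"
  shows "proper_ideal_of A J"
  unfolding proper_ideal_of_def by (intro conjI ballI) (rule assms; assumption)+

lemma proper_ideal_of_sum:
  assumes "proper_ideal_of A J"
  shows "(\<And>i. i \<in> I \<Longrightarrow> f i \<in> A) \<Longrightarrow> (\<Sum>i\<in>I. f i) \<in> A"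
    and "(\<And>i. i \<in> I \<Longrightarrow> f i \<in> J) \<Longrightarrow> (\<Sum>i\<in>I. f i) \<in> J"
  using proper_ideal_ofD[OF assms] by (induction I rule: infinite_finite_induct) auto

lemma proper_ideal_of_power:
  assumes "proper_ideal_of A J"
  shows "a \<in> A \<Longrightarrow> a ^ n \<in> A"
  using proper_ideal_ofD[OF assms] by (induction n) auto

text \<open>Taken with an ideal \<open>J\<close> of a ring \<open>A\<close> in place of the ring,
  this is the ideal that \<open>J\<close> generates in \<open>A[x]\<close>.\<close>

definition adjoin :: "'a::field set \<Rightarrow> 'a \<Rightarrow> 'a set" where
  "adjoin A x = {poly p x | p. \<forall>i. coeff p i \<in> A}"

lemma adjoinI: "\<forall>i. coeff p i \<in> A \<Longrightarrow> poly p x = y \<Longrightarrow> y \<in> adjoin A x"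
  by (auto simp: adjoin_def)

lemma adjoinE:
  assumes "y \<in> adjoin A x"
  obtains p where "\<And>i. coeff p i \<in> A" "poly p x = y"
  using assms by (auto simp: adjoin_def)

lemma subset_adjoin: "0 \<in> A \<Longrightarrow> A \<subseteq> adjoin A x"
proof
  fix a assume "0 \<in> A" "a \<in> A"
  then show "a \<in> adjoin A x"
    by (intro adjoinI[of "[:a:]"]) (auto simp: coeff_pCons split: nat.splits)
qed

lemma self_in_adjoin: "0 \<in> A \<Longrightarrow> 1 \<in> A \<Longrightarrow> x \<in> adjoin A x"
  by (auto intro!: adjoinI[of "[:0, 1:]"] simp: coeff_pCons split: nat.splits)

lemma proper_ideal_of_adjoin:
  assumes "proper_ideal_of A J" "1 \<notin> adjoin J x"
  shows "proper_ideal_of (adjoin A x) (adjoin J x)"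
proof -
  note D = proper_ideal_ofD[OF assms(1)]
  have "J \<subseteq> A"
    using D(5) by blast
  have "0 \<in> A"
    by (rule D(5)[OF D(6)])
  have add: "a + b \<in> adjoin B x" if "\<And>a b. a \<in> B \<Longrightarrow> b \<in> B \<Longrightarrow> a + b \<in> B"
      and ab: "a \<in> adjoin B x" "b \<in> adjoin B x" for a b B
  proof -
    obtain p q where "\<And>i. coeff p i \<in> B" "poly p x = a" "\<And>i. coeff q i \<in> B" "poly q x = b"
      using ab by (auto elim!: adjoinE)
    then show ?thesis
      by (intro adjoinI[of "p + q"]) (simp_all add: that(1))
  qed
  \<comment> \<open>\<open>B\<close> will be \<open>A\<close> and \<open>J\<close>, which gives
    closure under products and the ideal property by one argument.\<close>
  have mult: "a * b \<in> adjoin B x" if "\<And>p q i. (\<And>i. coeff p i \<in> A) \<Longrightarrow>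
      (\<And>i. coeff q i \<in> B) \<Longrightarrow> coeff (p * q) i \<in> B"
      and ab: "a \<in> adjoin A x" "b \<in> adjoin B x" for a b B
  proof -
    obtain p q where "\<And>i. coeff p i \<in> A" "poly p x = a" "\<And>i. coeff q i \<in> B" "poly q x = b"
      using ab by (auto elim!: adjoinE)
    then show ?thesis
      by (intro adjoinI[of "p * q"]) (simp_all add: that(1))
  qed
  have minus: "- a \<in> adjoin A x" if a: "a \<in> adjoin A x" for a
  proof -
    obtain p where "\<And>i. coeff p i \<in> A" "poly p x = a"
      using adjoinE[OF a] by metis
    then show ?thesis
      by (intro adjoinI[of "- p"]) (auto intro: D(4))
  qed
  have "adjoin J x \<subseteq> adjoin A x"
    using \<open>J \<subseteq> A\<close> by (auto simp: adjoin_def)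
  moreover have "coeff (p * q) i \<in> A" if "\<And>i. coeff p i \<in> A" "\<And>i. coeff q i \<in> A" for p q i
    unfolding coeff_mult by (intro proper_ideal_of_sum(1)[OF assms(1)] D(3) that)
  moreover have "coeff (p * q) i \<in> J" if "\<And>i. coeff p i \<in> A" "\<And>i. coeff q i \<in> J" for p q i
    unfolding coeff_mult by (intro proper_ideal_of_sum(2)[OF assms(1)] D(8) that)
  moreover have "1 \<in> adjoin A x" "0 \<in> adjoin J x"
    using subset_adjoin[of A x] subset_adjoin[of J x] \<open>0 \<in> A\<close> D(1,6) by auto
  moreover have "a + b \<in> adjoin A x" if "a \<in> adjoin A x" "b \<in> adjoin A x" for a b
    by (rule add[OF D(2)]) (use that in auto)
  moreover have "a + b \<in> adjoin J x" if "a \<in> adjoin J x" "b \<in> adjoin J x" for a b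
    by (rule add[OF D(7)]) (use that in auto)
  ultimately show ?thesis
    unfolding proper_ideal_of_def using assms(2) minus by (simp add: mult)
qed

text \<open>
  With \<open>u = 1 / (1 - q\<^sub>0)\<close>, the equation \<open>q(1/x) = 1\<close> turns into
  \<open>x ^ n = (\<Sum>j=1..m. u * q\<^sub>j * x ^ (n - j))\<close>, which removes the leading term of \<open>p\<close>.
\<close>

lemma reduce_degree:
  assumes A: "proper_ideal_of A J"
    and inv: "\<And>b. b \<in> J \<Longrightarrow> inverse (1 - b) \<in> A"
    and p: "\<And>i. coeff p i \<in> J" "poly p x = 1"
    and q: "\<And>i. coeff q i \<in> J" "poly q (inverse x) = 1"
    and le: "degree q \<le> degree p" and "x \<noteq> 0"
  shows "\<exists>r. (\<forall>i. coeff r i \<in> J) \<and> poly r x = 1 \<and> degree r < degree p"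
proof -
  note D = proper_ideal_ofD[OF A]
  define n where "n = degree p"
  define m where "m = degree q"
  define u where "u = inverse (1 - coeff q 0)"
  have "m > 0"
  proof (rule ccontr)
    assume "\<not> m > 0"
    then have "q = [:coeff q 0:]"
      by (metis degree_eq_zeroE coeff_pCons_0 m_def gr0I)
    then have "coeff q 0 = 1"
      using q(2) by (metis poly_const_conv)
    with q(1)[of 0] D(9) show False
      by simp
  qed
  have u: "u \<in> A" "1 - coeff q 0 \<noteq> 0"
    using inv[OF q(1)] q(1)[of 0] D(9) by (auto simp: u_def)
  have *: "(\<Sum>j=1..m. coeff q j * inverse x ^ j) = 1 - coeff q 0"
  proof -
    have "poly q (inverse x) = (\<Sum>j\<in>{0..m}. coeff q j * inverse x ^ j)"
      by (simp add: poly_altdef m_def atMost_atLeast0)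
    also have "\<dots> = coeff q 0 + (\<Sum>j=1..m. coeff q j * inverse x ^ j)"
      by (subst sum.atLeast_Suc_atMost) auto
    finally show ?thesis
      using q(2) by (simp add: algebra_simps)
  qed
  define s where "s = (\<Sum>j=1..m. Polynomial.monom (u * coeff q j) (n - j))"
  have "poly s x = (\<Sum>j=1..m. u * coeff q j * x ^ (n - j))"
    by (simp add: s_def poly_sum poly_monom)
  also have "\<dots> = (\<Sum>j=1..m. u * x ^ n * (coeff q j * inverse x ^ j))"
    using le \<open>x \<noteq> 0\<close>
    by (intro sum.cong refl) (auto simp: n_def m_def power_diff field_simps)
  also have "\<dots> = x ^ n"
    using u(2) * by (simp add: u_def flip: sum_distrib_left)
  finally have s: "poly s x = x ^ n" .
  have s_J: "coeff s i \<in> J" for i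
    unfolding s_def coeff_sum using q(1) u(1) D(6,8) by (intro proper_ideal_of_sum[OF A]) simp
  have s_deg: "coeff s i = 0" if "i \<ge> n" for i
    unfolding s_def coeff_sum using that \<open>m > 0\<close> le by (intro sum.neutral) (auto simp: n_def m_def)
  \<comment> \<open>Since \<open>poly s x = x ^ n\<close>, exchanging the leading monomial for a
    multiple of \<open>s\<close> keeps the value 1 at \<open>x\<close>.\<close>
  define r where "r = p - Polynomial.monom (coeff p n) n + smult (coeff p n) s"
  have r0: "coeff r i = 0" if "i \<ge> n" for i
    using that by (auto simp: r_def s_deg n_def coeff_eq_0)
  have "n > 0"
    using \<open>m > 0\<close> le by (simp add: n_def m_def)
  then have "degree r < n"
    using r0 by (metis leading_coeff_0_iff not_less degree_0)
  moreover have "poly r x = 1"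
    by (simp add: r_def poly_monom s p)
  moreover have "coeff r i \<in> J" for i
  proof (cases "i = n")
    case False
    have "coeff p n * coeff s i \<in> J"
      using D(8)[OF D(5)[OF p(1)] s_J] .
    then show ?thesis
      using D(7)[OF p(1)] False by (auto simp: r_def)
  qed (use r0[of i] D(6) in simp)
  ultimately show ?thesis
    by (auto simp: n_def)
qed

text \<open>In a pair of ring and ideal that is maximal under inclusion of both components, the ring
  is a valuation ring: if neither \<open>x\<close> nor \<open>inverse x\<close> can be adjoined, the
  ideal generates 1 in both extensions, and of two such equations of minimal degrees
  \<open>reduce_degree\<close> shortens one.\<close>

theorem chevalley:
  assumes "proper_ideal_of A J"
  obtains V where "valring V" "A \<subseteq> V" "J \<subseteq> valring.\<mm> V"
proof -
  define S where "S = {x. proper_ideal_of (fst x) (snd x) \<and> A \<subseteq> fst x \<and> J \<subseteq> snd x}"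
  define P :: "'a set \<times> 'a set \<Rightarrow> 'a set \<times> 'a set \<Rightarrow> bool"
    where "P = (\<lambda>x y. fst x \<subseteq> fst y \<and> snd x \<subseteq> snd y)"
  have po: "partial_order_on S (relation_of P S)"
    unfolding P_def by (auto simp: partial_order_on_def preorder_on_def refl_on_def trans_def
        antisym_def relation_of_def)
  have "\<exists>m\<in>S. \<forall>a\<in>S. P m a \<longrightarrow> a = m"
  proof (rule predicate_Zorn[OF po])
    fix C assume C: "C \<in> Chains (relation_of P S)"
    show "\<exists>u\<in>S. \<forall>a\<in>C. P a u"
    proof (cases "C = {}")
      case True
      then show ?thesis
        using assms by (auto simp: S_def)
    next
      case False
      have CS: "C \<subseteq> S" and tot: "\<And>x y. x \<in> C \<Longrightarrow> y \<in> C \<Longrightarrow> P x y \<or> P y x"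
        using C by (auto simp: Chains_def relation_of_def)
      \<comment> \<open>In a chain, finitely many memberships can be checked in a single member, so
        the closure properties pass to the unions.\<close>
      have upper: "\<exists>z\<in>C. fst x \<subseteq> fst z \<and> fst y \<subseteq> fst z \<and> snd x \<subseteq> snd z \<and> snd y \<subseteq> snd z"
        if "x \<in> C" "y \<in> C" for x y
        using tot[OF that]
      proof
        assume "P x y"
        then show ?thesis
          using that by (intro bexI[of _ y]) (simp_all add: P_def)
      next
        assume "P y x"
        then show ?thesis
          using that by (intro bexI[of _ x]) (simp_all add: P_def)
      qed
      have two: "\<exists>z\<in>C. a \<in> fst z \<and> b \<in> fst z" if "a \<in> \<Union>(fst ` C)" "b \<in> \<Union>(fst ` C)" for a b
        using that by (elim UN_E) (meson subsetD upper)
      have two': "\<exists>z\<in>C. a \<in> snd z \<and> b \<in> snd z" if "a \<in> \<Union>(snd ` C)" "b \<in> \<Union>(snd ` C)" for a b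
        using that by (elim UN_E) (meson subsetD upper)
      have two'': "\<exists>z\<in>C. a \<in> fst z \<and> b \<in> snd z" if "a \<in> \<Union>(fst ` C)" "b \<in> \<Union>(snd ` C)" for a b
        using that by (elim UN_E) (meson subsetD upper)
      have D: "proper_ideal_of (fst z) (snd z)" "A \<subseteq> fst z" "J \<subseteq> snd z" if "z \<in> C" for z
        using subsetD[OF CS that] by (simp_all add: S_def)
      note E = proper_ideal_ofD[OF D(1)]
      have 1: "a + b \<in> \<Union>(fst ` C)" "a * b \<in> \<Union>(fst ` C)"
        if ab: "a \<in> \<Union>(fst ` C)" "b \<in> \<Union>(fst ` C)" for a b
      proof -
        obtain z where "z \<in> C" "a \<in> fst z" "b \<in> fst z"
          using two[OF ab] by blast
        then show "a + b \<in> \<Union>(fst ` C)" "a * b \<in> \<Union>(fst ` C)"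
          using E(2,3)[of z a b] by blast+
      qed
      have 2: "a + b \<in> \<Union>(snd ` C)" if ab: "a \<in> \<Union>(snd ` C)" "b \<in> \<Union>(snd ` C)" for a b
      proof -
        obtain z where "z \<in> C" "a \<in> snd z" "b \<in> snd z"
          using two'[OF ab] by blast
        then show ?thesis
          using E(7)[of z a b] by blast
      qed
      have 3: "a * b \<in> \<Union>(snd ` C)" if ab: "a \<in> \<Union>(fst ` C)" "b \<in> \<Union>(snd ` C)" for a b
      proof -
        obtain z where "z \<in> C" "a \<in> fst z" "b \<in> snd z"
          using two''[OF ab] by blast
        then show ?thesis
          using E(8)[of z a b] by blast
      qed
      have 4: "- a \<in> \<Union>(fst ` C)" if "a \<in> \<Union>(fst ` C)" for a
        using that E(4)[of _ a] by blast
      have 5: "\<Union>(snd ` C) \<subseteq> \<Union>(fst ` C)" "1 \<notin> \<Union>(snd ` C)"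
        using E(5,9) by blast+
      obtain z where z: "z \<in> C"
        using False by blast
      then have 6: "1 \<in> \<Union>(fst ` C)" "0 \<in> \<Union>(snd ` C)" "A \<subseteq> \<Union>(fst ` C)" "J \<subseteq> \<Union>(snd ` C)"
        using E(1,6)[OF z] D(2,3)[OF z] by blast+
      have "proper_ideal_of (\<Union>(fst ` C)) (\<Union>(snd ` C))"
        by (rule proper_ideal_ofI) (rule 1 2 3 4 5 6; assumption)+
      then have "(\<Union>(fst ` C), \<Union>(snd ` C)) \<in> S"
        using 6(3,4) by (simp add: S_def)
      then show ?thesis
        by (intro bexI[of _ "(\<Union>(fst ` C), \<Union>(snd ` C))"]) (auto simp: P_def)
    qed
  qed
  then obtain V M where VM: "(V, M) \<in> S" and max: "\<forall>a\<in>S. P (V, M) a \<longrightarrow> a = (V, M)"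
    by auto
  have V: "proper_ideal_of V M" "A \<subseteq> V" "J \<subseteq> M"
    using VM by (auto simp: S_def)
  note D = proper_ideal_ofD[OF V(1)]
  have "0 \<in> V"
    by (rule D(5)[OF D(6)])
  \<comment> \<open>Maximality is used in this form: an element is missing from \<open>V\<close>
    only if adjoining it makes the ideal improper.\<close>
  have maximal: "x \<in> V" if "1 \<notin> adjoin M x" for x
  proof -
    have "proper_ideal_of (adjoin V x) (adjoin M x)"
      by (rule proper_ideal_of_adjoin[OF V(1) that])
    moreover have "V \<subseteq> adjoin V x" "M \<subseteq> adjoin M x"
      using \<open>0 \<in> V\<close> D(6) by (auto intro!: subset_adjoin)
    moreover from calculation have "(adjoin V x, adjoin M x) \<in> S"
      using order_trans[OF V(2)] order_trans[OF V(3)] by (simp add: S_def)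
    ultimately have "(adjoin V x, adjoin M x) = (V, M)"
      using max by (simp add: P_def)
    then show ?thesis
      using self_in_adjoin[OF \<open>0 \<in> V\<close> D(1), of x] by simp
  qed
  \<comment> \<open>The elements \<open>1 - b\<close> are units of \<open>V\<close>: an equation p(1
    / (1 - b)) = 1, cleared of denominators, puts \<open>(1 - b) ^ n\<close> into \<open>M\<close>,
    although this power is congruent to 1 modulo \<open>M\<close>.\<close>
  have inv: "inverse (1 - b) \<in> V" if b: "b \<in> M" for b
  proof (rule maximal, rule notI)
    assume "1 \<in> adjoin M (inverse (1 - b))"
    then obtain p where p: "\<And>i. coeff p i \<in> M" "poly p (inverse (1 - b)) = 1"
      by (metis adjoinE)
    define n where "n = degree p"
    have nz: "1 - b \<noteq> 0"
      using b D(9) by auto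
    have bV: "1 - b \<in> V"
      using D(2)[OF D(1) D(4)[OF D(5)[OF b]]] by simp
    have "(1 - b) ^ n = poly p (inverse (1 - b)) * (1 - b) ^ n"
      using p by simp
    also have "\<dots> = (\<Sum>i\<le>n. (1 - b) ^ (n - i) * coeff p i)"
      unfolding poly_altdef n_def[symmetric] sum_distrib_right
      using nz by (intro sum.cong refl) (auto simp: power_diff field_simps)
    also have "\<dots> \<in> M"
      using p bV by (intro proper_ideal_of_sum[OF V(1)] D(8) proper_ideal_of_power[OF V(1)]) auto
    finally have "(1 - b) ^ n \<in> M" .
    moreover have "1 - (1 - b) ^ n \<in> M"
    proof (induction n)
      case (Suc n)
      have "1 - (1 - b) ^ Suc n = (1 - (1 - b) ^ n) + (1 - b) ^ n * b"
        by (simp add: algebra_simps)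
      also have "\<dots> \<in> M"
        using Suc b bV by (intro D(7,8) proper_ideal_of_power[OF V(1)]) auto
      finally show ?case .
    qed (use D(6) in simp)
    ultimately have "(1 - b) ^ n + (1 - (1 - b) ^ n) \<in> M"
      by (rule D(7))
    then show False
      using D(9) by simp
  qed
  have total: "x \<in> V \<or> inverse x \<in> V" for x
  proof (rule ccontr)
    assume *: "\<not> (x \<in> V \<or> inverse x \<in> V)"
    then have "x \<noteq> 0"
      using \<open>0 \<in> V\<close> by auto
    define Q where "Q = (\<lambda>y p. (\<forall>i. coeff p i \<in> M) \<and> poly p y = 1)"
    have "\<exists>p. Q y p \<and> (\<forall>r. Q y r \<longrightarrow> degree p \<le> degree r)" if y: "y \<notin> V" for y
    proof -
      have "1 \<in> adjoin M y"
        using maximal y by blast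
      then obtain p where p: "\<And>i. coeff p i \<in> M" "poly p y = 1"
        by (metis adjoinE)
      then have "Q y p"
        by (simp add: Q_def)
      then show ?thesis
        by (rule ex_has_least_nat)
    qed
    then obtain p q where p: "Q x p" "\<And>r. Q x r \<Longrightarrow> degree p \<le> degree r"
        and q: "Q (inverse x) q" "\<And>r. Q (inverse x) r \<Longrightarrow> degree q \<le> degree r"
      using * by meson
    show False
    proof (cases "degree q \<le> degree p")
      case True
      have "\<exists>r. (\<forall>i. coeff r i \<in> M) \<and> poly r x = 1 \<and> degree r < degree p"
        by (rule reduce_degree[OF V(1) inv _ _ _ _ True]) (use p(1) q(1) \<open>x \<noteq> 0\<close> in \<open>auto simp: Q_def\<close>)
      then show False
        using p(2) by (auto simp: Q_def not_less[symmetric])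
    next
      case False
      then have "degree p \<le> degree q"
        by simp
      then have "\<exists>r. (\<forall>i. coeff r i \<in> M) \<and> poly r (inverse x) = 1 \<and> degree r < degree q"
        by (intro reduce_degree[OF V(1) inv]) (use p(1) q(1) \<open>x \<noteq> 0\<close> in \<open>auto simp: Q_def\<close>)
      then show False
        using q(2) by (auto simp: Q_def not_less[symmetric])
    qed
  qed
  interpret valring V
    by (unfold_locales; rule D total; assumption?)
  have "a \<in> \<mm>" if "a \<in> M" for a
    using that D(8)[of "inverse a" a] D(9) by (auto simp: \<mm>_def)
  then show thesis
    using that[of V] V valring_axioms by blast
qed

section \<open>Extensions with values in the divisible hull\<close>

locale field_embedding =
  fixes h :: "'a::field \<Rightarrow> 'b::field"
  assumes add: "h (a + b) = h a + h b"
    and mult: "h (a * b) = h a * h b"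
    and one: "h 1 = 1"
begin

lemma zero [simp]: "h 0 = 0"
  using add[of 0 0] by (metis add_cancel_right_right)

lemma minus: "h (- a) = - h a"
  using add[of a "- a"] by (simp add: eq_neg_iff_add_eq_0 add.commute)

lemma diff: "h (a - b) = h a - h b"
  using add[of a "- b"] by (simp add: minus)

lemma power: "h (a ^ n) = h a ^ n"
  by (induction n) (auto simp: one mult)

lemma sum: "h (\<Sum>i\<in>I. f i) = (\<Sum>i\<in>I. h (f i))"
  by (induction I rule: infinite_finite_induct) (auto simp: add)

lemma eq_0_iff [simp]: "h a = 0 \<longleftrightarrow> a = 0"
proof
  assume "h a = 0"
  then show "a = 0"
    using mult[of a "inverse a"] one by (cases "a = 0") auto
qed auto

lemma inverse: "h (inverse a) = inverse (h a)"
proof (cases "a = 0")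
  case False
  then have "h a * h (inverse a) = 1"
    by (simp add: one flip: mult)
  then show ?thesis
    by (simp add: inverse_unique)
qed auto

lemma divide: "h (a / b) = h a / h b"
  by (simp add: divide_inverse mult inverse)

lemma poly_map_poly_add: "poly (map_poly h (p + q)) y = poly (map_poly h p) y + poly (map_poly h q) y"
proof -
  have "map_poly h (p + q) = map_poly h p + map_poly h q"
    by (rule poly_eqI) (simp add: coeff_map_poly add)
  then show ?thesis
    by simp
qed

lemma poly_map_poly_mult: "poly (map_poly h (p * q)) y = poly (map_poly h p) y * poly (map_poly h q) y"
proof -
  have "map_poly h (p * q) = map_poly h p * map_poly h q"
    by (rule poly_eqI) (simp add: coeff_map_poly coeff_mult mult sum)
  then show ?thesis
    by simp
qed

lemma poly_map_poly_pcompose: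
  "poly (map_poly h (pcompose p q)) y = poly (map_poly h p) (poly (map_poly h q) y)"
  by (induction p)
    (auto simp: pcompose_pCons poly_map_poly_add poly_map_poly_mult map_poly_pCons)

lemma valuation_comp:
  assumes "valuation w"
  shows "valuation (w \<circ> h)"
  using assms by (auto simp: valuation_def add mult)

end

text \<open>All polynomials split, so a multiplicative statement needs checking only for constants
  and for one more linear factor.\<close>

lemma alg_closed_poly_induct [consumes 1, case_names const linear]:
  fixes p :: "'a::alg_closed_field poly"
  assumes "p \<noteq> 0" "\<And>c. c \<noteq> 0 \<Longrightarrow> P [:c:]" "\<And>b p. p \<noteq> 0 \<Longrightarrow> P p \<Longrightarrow> P ([:- b, 1:] * p)"
  shows "P p"
  using assms(1)
proof (induction "Polynomial.degree p" arbitrary: p)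
  case 0
  then obtain c where "p = [:c:]"
    by (metis degree_eq_zeroE)
  with 0 assms(2) show ?case
    by auto
next
  case (Suc n)
  then obtain b where "poly p b = 0"
    using alg_closed_imp_poly_has_root[of p] by auto
  then obtain q where q: "p = [:- b, 1:] * q"
    by (auto simp: poly_eq_0_iff_dvd elim: dvdE)
  with Suc.prems have "q \<noteq> 0"
    by auto
  moreover from this have "Polynomial.degree p = Suc (Polynomial.degree q)"
    unfolding q by (subst degree_mult_eq) auto
  ultimately show ?case
    using Suc.hyps q assms(3) by auto
qed

text \<open>Pairs with second component 0 represent nothing, so \<open>n = 0\<close> is sent to the
  representative of zero. For \<open>n > 0\<close> this is the fraction
  \<open>g / n\<close>.\<close>

lift_definition hull_frac :: "'g::linordered_ab_group_add \<Rightarrow> nat \<Rightarrow> 'g div_hull" is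
  "\<lambda>g n. if n = 0 then (0, 1) else (g, n)"
  by (simp add: div_hull_rel_def)

lemma hull_frac_le_iff: "n > 0 \<Longrightarrow> m > 0 \<Longrightarrow> hull_frac g n \<le> hull_frac h m \<longleftrightarrow> nsmul m g \<le> nsmul n h"
  by transfer simp

lemma hull_frac_eq_iff: "n > 0 \<Longrightarrow> m > 0 \<Longrightarrow> hull_frac g n = hull_frac h m \<longleftrightarrow> nsmul m g = nsmul n h"
  by transfer (simp add: div_hull_rel_def)

lemma hull_frac_add:
  "n > 0 \<Longrightarrow> m > 0 \<Longrightarrow> hull_frac g n + hull_frac h m = hull_frac (nsmul m g + nsmul n h) (n * m)"
  by transfer (simp add: div_hull_rel_def)

lemma hull_frac_0: "hull_frac 0 1 = 0"
  by transfer (simp add: div_hull_rel_def)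

lemma hull_frac_nonneg_iff: "n > 0 \<Longrightarrow> 0 \<le> hull_frac g n \<longleftrightarrow> 0 \<le> g"
  using hull_frac_le_iff[of 1 n 0 g] by (simp add: hull_frac_0[simplified])

context valring
begin

definition units :: "'a set" where
  "units = {a. a \<noteq> 0 \<and> a \<in> V \<and> inverse a \<in> V}"

lemma units_one: "1 \<in> units"
  by (simp add: units_def)

lemma units_mult: "a \<in> units \<Longrightarrow> b \<in> units \<Longrightarrow> a * b \<in> units"
  by (auto simp: units_def intro: mult)

lemma units_inverse: "a \<in> units \<Longrightarrow> inverse a \<in> units"
  by (auto simp: units_def)

lemma units_divide: "a \<in> units \<Longrightarrow> b \<in> units \<Longrightarrow> a / b \<in> units"
  unfolding divide_inverse by (intro units_mult units_inverse)

lemma units_power: "a \<in> units \<Longrightarrow> a ^ n \<in> units"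
  by (induction n) (auto intro: units_mult simp: units_one)

lemma mult_unit_in_iff: "u \<in> units \<Longrightarrow> a * u \<in> V \<longleftrightarrow> a \<in> V"
  using mult[of "a * u" "inverse u"] mult[of a u] by (auto simp: units_def mult.assoc)

end

text \<open>Only the lower field carries values yet; \<open>V\<close> is tied to them by membership
  alone.\<close>

locale valring_over = V: valring V + h: field_embedding h + w: valued w
  for V :: "'b::field set" and h :: "'a::field \<Rightarrow> 'b"
    and w :: "'a \<Rightarrow> 'g::linordered_ab_group_add with_inf" +
  assumes in_iff: "h a \<in> V \<longleftrightarrow> 0 \<le> w a"
begin

lemma in_units_iff: "h a \<in> V.units \<longleftrightarrow> w a = 0"
proof (cases "a = 0")
  case False
  then have "h a \<in> V.units \<longleftrightarrow> 0 \<le> w a \<and> 0 \<le> w (inverse a)"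
    by (simp add: V.units_def in_iff flip: h.inverse)
  also have "\<dots> \<longleftrightarrow> w a = 0"
    using w.inverse[OF False] False w.eq_Infty_iff[of a] w.eq_Infty_iff[of "inverse a"]
    by (cases "w a"; cases "w (inverse a)")
      (auto simp: zero_with_inf_def add_eq_0_iff simp del: w.eq_Infty_iff)
  finally show ?thesis .
qed (auto simp: V.units_def)

text \<open>The nonzero elements modulo \<open>V.units\<close> form the value group belonging to
  \<open>V\<close>. The set collects the elements whose class is torsion modulo the classes coming
  from the lower field.\<close>

definition torsion :: "'b set" where
  "torsion = {z. z \<noteq> 0 \<and> (\<exists>n f. n > 0 \<and> f \<noteq> 0 \<and> z ^ n / h f \<in> V.units)}"

lemma torsion_mult:
  assumes "y \<in> torsion" "z \<in> torsion"
  shows "y * z \<in> torsion"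
proof -
  obtain n f m g where *: "n > 0" "f \<noteq> 0" "y ^ n / h f \<in> V.units" "m > 0" "g \<noteq> 0" "z ^ m / h g \<in> V.units"
    using assms by (auto simp: torsion_def)
  have "(y ^ n / h f) ^ m * (z ^ m / h g) ^ n \<in> V.units"
    using * by (intro V.units_mult V.units_power)
  also have "(y ^ n / h f) ^ m * (z ^ m / h g) ^ n = (y * z) ^ (n * m) / h (f ^ m * g ^ n)"
    by (simp add: power_divide h.mult
        h.power power_mult_distrib
        mult.commute[of n m] flip: power_mult)
  finally show ?thesis
    using * assms by (auto simp: torsion_def intro!: exI[of _ "n * m"] exI[of _ "f ^ m * g ^ n"])
qed

lemma torsion_inverse:
  assumes "z \<in> torsion"
  shows "inverse z \<in> torsion"
proof -
  obtain n f where *: "n > 0" "f \<noteq> 0" "z ^ n / h f \<in> V.units"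
    using assms by (auto simp: torsion_def)
  have "inverse (z ^ n / h f) \<in> V.units"
    using * by (intro V.units_inverse)
  also have "inverse (z ^ n / h f) = inverse z ^ n / h (inverse f)"
    by (simp add: h.inverse divide_inverse power_inverse mult.commute)
  finally show ?thesis
    using * assms by (auto simp: torsion_def intro!: exI[of _ n] exI[of _ "inverse f"])
qed

text \<open>Two terms of a vanishing polynomial expression in \<open>z\<close> have equal value, and
  their quotient is a positive power of \<open>z\<close> times an element of the lower
  field.\<close>

lemma algebraic_imp_torsion:
  assumes "p \<noteq> 0" "poly (map_poly h p) z = 0" "z \<noteq> 0"
  shows "z \<in> torsion"
proof -
  define I where "I = {..Polynomial.degree p}"
  define t where "t = (\<lambda>i. h (Polynomial.coeff p i) * z ^ i)"
  have "(\<Sum>i\<in>I. t i) = 0"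
    using assms(2) by (simp add: poly_altdef degree_map_poly coeff_map_poly I_def t_def)
  moreover have "Polynomial.degree p \<in> I" "t (Polynomial.degree p) \<noteq> 0" "finite I"
    using assms by (auto simp: I_def t_def)
  ultimately obtain j k where jk: "j \<noteq> k" "t j \<noteq> 0" "t k \<noteq> 0" "t j / t k \<in> V" "t k / t j \<in> V"
    using V.sum_eq_0_imp_associated[of I t "Polynomial.degree p"] by blast
  have main: "z \<in> torsion" if "j < k" "t j \<noteq> 0" "t k \<noteq> 0" "t k / t j \<in> V.units" for j k
  proof -
    define c where "c = Polynomial.coeff p"
    have nz: "c j \<noteq> 0" "c k \<noteq> 0"
      using that by (auto simp: t_def c_def)
    have "z ^ k = z ^ j * z ^ (k - j)"
      using that(1) by (simp flip: power_add)
    then have "t k / t j = z ^ (k - j) / h (c j / c k)"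
      using assms(3) nz by (simp add: t_def c_def[symmetric] h.divide)
    with that assms(3) nz show ?thesis
      by (auto simp: torsion_def intro!: exI[of _ "k - j"] exI[of _ "c j / c k"])
  qed
  have "t k / t j \<in> V.units" "t j / t k \<in> V.units"
    using jk by (auto simp: V.units_def)
  then show ?thesis
    using main[of j k] main[of k j] jk by (cases "j < k") auto
qed

text \<open>If \<open>z ^ n / h f\<close> is a unit, the value of \<open>z\<close> can only be
  \<open>w f\<close> divided by \<open>n\<close>, and torsion supplies such \<open>n\<close> and
  \<open>f\<close>. The ultrametric inequality comes from the ring, not from a formula for the
  values.\<close>

lemma exists_valuation:
  assumes torsion: "\<And>z. z \<noteq> 0 \<Longrightarrow> z \<in> torsion"
  shows "\<exists>w' :: 'b \<Rightarrow> 'g div_hull with_inf. valuation w' \<and> valuation_ring w' = V"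
proof -
  define R where "R = (\<lambda>z n f g. n > 0 \<and> f \<noteq> 0 \<and> z ^ n / h f \<in> V.units \<and> w f = Fin g)"
  have ex: "\<exists>n f g. R z n f g" if z: "z \<noteq> 0" for z
  proof -
    obtain n f where nf: "n > 0" "f \<noteq> 0" "z ^ n / h f \<in> V.units"
      using torsion[OF z] unfolding torsion_def by blast
    moreover obtain g where "w f = Fin g"
      using nf(2) by (rule w.nonzero_cases)
    ultimately show ?thesis
      by (auto simp: R_def)
  qed
  \<comment> \<open>Two choices are compared by raising each to the exponent of the other: the
    powers of \<open>z\<close> cancel, and a unit in the image of \<open>h\<close> remains.\<close>
  have unique: "hull_frac g n = hull_frac g' n'" if "R z n f g" "R z n' f' g'" for z n f g n' f' g'
  proof -
    have nz: "z ^ n \<noteq> 0" "z ^ n' \<noteq> 0"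
      using that by (auto simp: R_def V.units_def)
    have "(z ^ n' / h f') ^ n / (z ^ n / h f) ^ n' \<in> V.units"
      by (rule V.units_divide[OF V.units_power V.units_power]) (use that in \<open>simp_all add: R_def\<close>)
    also have "(z ^ n' / h f') ^ n / (z ^ n / h f) ^ n' = h (f ^ n' / f' ^ n)"
      using nz by (simp add: power_divide h.divide
          h.power field_simps flip: power_mult)
    finally have "w (f ^ n' / f' ^ n) = 0"
      by (simp add: in_units_iff)
    then have "w (f ^ n') = w (f' ^ n)"
      using that by (subst w.eq_iff_divide) (auto simp: R_def)
    then show ?thesis
      using that by (simp add: R_def w.power nsmul_Fin hull_frac_eq_iff)
  qed
  define w' where "w' = (\<lambda>z. if z = 0 then Infty else
    Fin (SOME q. \<exists>n f g. R z n f g \<and> q = hull_frac g n))"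
  have w': "w' z = Fin (hull_frac g n)" if "R z n f g" for z n f g
  proof -
    have "z \<noteq> 0"
      using that by (auto simp: R_def V.units_def)
    have "(SOME q. \<exists>n f g. R z n f g \<and> q = hull_frac g n) = hull_frac g n"
      using that unique by (intro some_equality) blast+
    with \<open>z \<noteq> 0\<close> show ?thesis
      by (simp add: w'_def)
  qed
  \<comment> \<open>Unit factors do not affect membership, and \<open>z ^ n\<close> lies in
    \<open>V\<close> exactly when \<open>z\<close> does.\<close>
  have nonneg: "0 \<le> w' z \<longleftrightarrow> z \<in> V" for z
  proof (cases "z = 0")
    case False
    then obtain n f g where R: "R z n f g"
      using ex by blast
    have "0 \<le> w' z \<longleftrightarrow> 0 \<le> w f"
      using R by (auto simp: w'[OF R] R_def hull_frac_nonneg_iff zero_with_inf_def)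
    also have "\<dots> \<longleftrightarrow> h f \<in> V"
      by (simp add: in_iff)
    also have "\<dots> \<longleftrightarrow> h f * (z ^ n / h f) \<in> V"
      using R by (intro V.mult_unit_in_iff[symmetric]) (simp add: R_def)
    also have "\<dots> \<longleftrightarrow> z \<in> V"
      using R V.power_in_iff[of n z] by (auto simp: R_def)
    finally show ?thesis .
  qed (simp add: w'_def)
  have "valuation w'"
  proof (rule valuationI)
    fix y z :: 'b assume nz: "y \<noteq> 0" "z \<noteq> 0"
    obtain n f g m f' g' where R: "R y n f g" "R z m f' g'"
      using ex nz by meson
    have "(y ^ n / h f) ^ m * (z ^ m / h f') ^ n \<in> V.units"
      by (rule V.units_mult[OF V.units_power V.units_power]) (use R in \<open>simp_all add: R_def\<close>)
    also have "(y ^ n / h f) ^ m * (z ^ m / h f') ^ n = (y * z) ^ (n * m) / h (f ^ m * f' ^ n)"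
      by (simp add: power_divide h.mult
          h.power power_mult_distrib
          mult.commute[of n m] flip: power_mult)
    finally have "R (y * z) (n * m) (f ^ m * f' ^ n) (nsmul m g + nsmul n g')"
      using R by (simp add: R_def w.mult w.power nsmul_Fin)
    from w'[OF this] show "w' (y * z) = w' y + w' z"
      using R by (simp add: w'[OF R(1)] w'[OF R(2)] R_def hull_frac_add)
  next
    fix z assume "0 \<le> w' z"
    then show "0 \<le> w' (1 + z)"
      by (simp add: nonneg V.add)
  qed (simp add: w'_def)
  moreover have "valuation_ring w' = V"
    using nonneg by (auto simp: valuation_ring_def)
  ultimately show ?thesis
    by blast
qed

end

section \<open>Rational functions over a field and over its algebraic closure\<close>

lemma field_embedding_to_ac: "field_embedding to_ac"
  by unfold_locales auto

lemma field_embedding_ratfun_const: "field_embedding ratfun_const"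
proof
  show "ratfun_const (a * b) = ratfun_const a * ratfun_const b" for a b :: 'a
    by (simp add: ratfun_const_def flip: to_fract_mult)
  show "ratfun_const (a + b) = ratfun_const a + ratfun_const b" for a b :: 'a
    by (simp add: ratfun_const_def flip: to_fract_add)
qed (simp add: ratfun_const_def flip: one_pCons)

lemma map_poly_to_ac_add: "map_poly to_ac (p + q) = map_poly to_ac p + map_poly to_ac q"
  by (rule poly_eqI) (simp add: coeff_map_poly)

lemma field_embedding_ratfun_to_ac: "field_embedding ratfun_to_ac"
proof
  fix f g :: "'a poly fract"
  obtain a b c d where fg: "f = Fract a b" "b \<noteq> 0" "g = Fract c d" "d \<noteq> 0"
    by (metis Fract_cases)
  then have nz: "map_poly to_ac b \<noteq> 0" "map_poly to_ac d \<noteq> 0"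
    by (simp_all add: map_poly_to_ac_eq_0_iff)
  show "ratfun_to_ac (f + g) = ratfun_to_ac f + ratfun_to_ac g"
    using fg nz by (simp add: ratfun_to_ac_Fract map_poly_to_ac_mult map_poly_to_ac_add)
  show "ratfun_to_ac (f * g) = ratfun_to_ac f * ratfun_to_ac g"
    using fg nz by (simp add: ratfun_to_ac_Fract map_poly_to_ac_mult)
next
  show "ratfun_to_ac (1 :: 'a poly fract) = 1"
    using ratfun_to_ac_Fract[of 1 1] by (simp add: fract_collapse)
qed

lemma ratfun_to_ac_to_fract: "ratfun_to_ac (to_fract p) = to_fract (map_poly to_ac p)"
  by (simp add: to_fract_def ratfun_to_ac_Fract)

lemma ratfun_to_ac_const: "ratfun_to_ac (ratfun_const a) = ratfun_const (to_ac a)"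
  by (simp add: ratfun_const_def ratfun_to_ac_to_fract map_poly_pCons)

lemma ratfun_cases:
  fixes z :: "'a::field poly fract"
  obtains p q where "q \<noteq> 0" "z = to_fract p / to_fract q"
  by (metis Fract_cases Fract_conv_to_fract)

text \<open>The torsion elements form a group, and over the closure the nonzero constants and the
  elements x - b generate all nonzero rational functions. Both kinds of generators are algebraic
  over K(x).\<close>

lemma valring_over_ratfun_torsion:
  fixes V :: "'a::field alg_closure poly fract set"
    and w :: "'a poly fract \<Rightarrow> 'g::linordered_ab_group_add with_inf"
  assumes "valring_over V ratfun_to_ac w" "z \<noteq> 0"
  shows "z \<in> valring_over.torsion V ratfun_to_ac"
proof -
  interpret valring_over V ratfun_to_ac w
    by fact
  interpret c: field_embedding "ratfun_const :: 'a \<Rightarrow> _"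
    by (rule field_embedding_ratfun_const)
  interpret C: field_embedding "ratfun_const :: 'a alg_closure \<Rightarrow> _"
    by (rule field_embedding_ratfun_const)
  have map_C: "map_poly ratfun_to_ac (map_poly ratfun_const p) = map_poly ratfun_const (map_poly to_ac p)"
    for p :: "'a poly"
    by (simp add: map_poly_map_poly o_def ratfun_to_ac_const)
  have eval_C: "poly (map_poly ratfun_const p) (ratfun_const b) = ratfun_const (poly p b)"
    for p :: "'a alg_closure poly" and b
    by (induction p) (simp_all add: map_poly_pCons C.add C.mult)
  have of_const: "ratfun_const b \<in> torsion" if "b \<noteq> 0" for b
  proof -
    obtain p where p: "p \<noteq> 0" "poly (map_poly to_ac p) b = 0"
      by (rule alg_closure_algebraic)
    have "poly (map_poly ratfun_to_ac (map_poly ratfun_const p)) (ratfun_const b) = 0"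
      using p by (simp add: map_C eval_C)
    moreover have "map_poly ratfun_const p \<noteq> 0"
      using p by (simp add: map_poly_eq_0_iff)
    ultimately show ?thesis
      using that by (intro algebraic_imp_torsion) auto
  qed
  have lin: "to_fract [:- b, 1:] \<in> torsion" for b
  proof -
    obtain p where p: "p \<noteq> 0" "poly (map_poly to_ac p) b = 0"
      by (rule alg_closure_algebraic)
    \<comment> \<open>This is p(x - Y) as a polynomial in Y over K(x). As x - (x - b) = b and
      \<open>p\<close> vanishes at \<open>b\<close>, it has x - b as a root.\<close>
    define q where "q = pcompose (map_poly ratfun_const p) [:to_fract [:0, 1:], - 1:]"
    have "poly (map_poly ratfun_to_ac q) (to_fract [:- b, 1:]) =
        poly (map_poly ratfun_const (map_poly to_ac p)) (ratfun_const b)"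
      by (simp add: q_def h.poly_map_poly_pcompose map_C map_poly_pCons h.minus h.one
          ratfun_to_ac_to_fract ratfun_const_def flip: to_fract_diff to_fract_add to_fract_uminus)
    also have "\<dots> = 0"
      using p by (simp add: eval_C)
    finally have "poly (map_poly ratfun_to_ac q) (to_fract [:- b, 1:]) = 0" .
    moreover have "q \<noteq> 0"
      using p pcompose_eq_0[of "map_poly ratfun_const p" "[:to_fract [:0, 1:], - 1:]"]
      by (auto simp: q_def map_poly_eq_0_iff)
    ultimately show ?thesis
      by (intro algebraic_imp_torsion) auto
  qed
  have poly: "to_fract p \<in> torsion" if "p \<noteq> 0" for p
    using that
  proof (induction p rule: alg_closed_poly_induct)
    case (const c)
    then show ?case
      using of_const[of c] by (simp add: ratfun_const_def)
  next
    case (linear b p)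
    then show ?case
      using torsion_mult[OF lin] by (simp only: to_fract_mult)
  qed
  obtain p q where "q \<noteq> 0" "z = to_fract p / to_fract q"
    by (rule ratfun_cases[of z])
  then show ?thesis
    using poly[of p] poly[of q] torsion_mult torsion_inverse assms(2)
    by (auto simp: divide_inverse)
qed

section \<open>Common extensions of valuations of \<open>L\<close> and \<open>K(x)\<close>\<close>

lemma ratfun_common_denominator:
  fixes f :: "nat \<Rightarrow> 'a::field poly fract"
  assumes "finite I"
  shows "\<exists>q p. q \<noteq> 0 \<and> (\<forall>s\<in>I. f s = to_fract (p s) / to_fract q)"
  using assms
proof (induction I rule: finite_induct)
  case (insert t I)
  then obtain q p where q: "q \<noteq> 0" "\<And>s. s \<in> I \<Longrightarrow> f s = to_fract (p s) / to_fract q"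
    by blast
  obtain p' q' where q': "q' \<noteq> 0" "f t = to_fract p' / to_fract q'"
    by (rule ratfun_cases[of "f t"])
  have "f s = to_fract (if s = t then p' * q else p s * q') / to_fract (q * q')" if "s \<in> insert t I" for s
    using q q' that by (auto simp: field_simps)
  moreover have "q * q' \<noteq> 0"
    using q q' by simp
  ultimately show ?case
    by (intro exI[of _ "q * q'"] exI[of _ "\<lambda>s. if s = t then p' * q else p s * q'"]) blast
qed (auto intro: exI[of _ 1])

text \<open>The closure is a vector space over the field and \<open>{a}\<close> is independent in
  it, so a linear functional may be prescribed at \<open>a\<close>. It carries relations over the
  closure down to the field.\<close>

lemma to_ac_functional:
  assumes "a \<noteq> 0"
  obtains \<phi> :: "'a::field alg_closure \<Rightarrow> 'a" where "\<phi> a = 1" "\<And>x y. \<phi> (x + y) = \<phi> x + \<phi> y"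
    "\<And>c x. \<phi> (to_ac c * x) = c * \<phi> x"
proof -
  interpret vector_space_pair "\<lambda>(c::'a) x. to_ac c * x" "\<lambda>(c::'a) x. c * x"
    by unfold_locales (auto simp: algebra_simps)
  have "vs1.independent {a}"
    using assms by simp
  then obtain \<phi> where \<phi>: "Vector_Spaces.linear (\<lambda>(c::'a) x. to_ac c * x) (\<lambda>(c::'a) x. c * x) \<phi>" "\<phi> a = 1"
    using linear_independent_extend[of "{a}" "\<lambda>_. 1"] by auto
  interpret Vector_Spaces.linear "\<lambda>(c::'a) x. to_ac c * x" "\<lambda>(c::'a) x. c * x" \<phi>
    by fact
  show thesis
    using that[of \<phi>] \<phi>(2) add scale by blast
qed

text \<open>A common denominator turns the relation into equations between elements of the closure,
  one for each power of x, to which a linear functional is applied. Its value 1 at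
  \<open>a k\<close> keeps the result nontrivial.\<close>

lemma ratfun_linearly_disjoint:
  fixes f :: "nat \<Rightarrow> 'a::field poly fract" and a :: "nat \<Rightarrow> 'a alg_closure"
  assumes "finite I" "k \<in> I" "a k \<noteq> 0"
    and eq: "(\<Sum>s\<in>I. ratfun_const (a s) * ratfun_to_ac (f s)) = 0"
  shows "\<exists>c. c k = 1 \<and> (\<Sum>s\<in>I. ratfun_const (c s) * f s) = 0"
proof -
  interpret h: field_embedding "ratfun_to_ac :: 'a poly fract \<Rightarrow> _"
    by (rule field_embedding_ratfun_to_ac)
  obtain q p where q: "q \<noteq> 0" "\<And>s. s \<in> I \<Longrightarrow> f s = to_fract (p s) / to_fract q"
    using ratfun_common_denominator[OF assms(1), of f] by blast
  obtain \<phi> where \<phi>: "\<phi> (a k) = 1" "\<And>x y. \<phi> (x + y) = \<phi> x + \<phi> y" "\<And>c x. \<phi> (to_ac c * x) = c * \<phi> x"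
    using to_ac_functional[OF assms(3)] by blast
  have \<phi>0: "\<phi> 0 = 0"
    using \<phi>(3)[of 0 0] by simp
  have \<phi>_sum: "\<phi> (\<Sum>s\<in>I. g s) = (\<Sum>s\<in>I. \<phi> (g s))" for g
    using \<phi>0 by (induction I rule: infinite_finite_induct) (auto simp: \<phi>(2))
  have nz: "to_fract (map_poly to_ac q) \<noteq> 0"
    using q by (simp add: map_poly_to_ac_eq_0_iff)
  have "(\<Sum>s\<in>I. ratfun_const (a s) * ratfun_to_ac (f s)) =
      (\<Sum>s\<in>I. to_fract (smult (a s) (map_poly to_ac (p s))) / to_fract (map_poly to_ac q))"
    using q by (intro sum.cong refl)
      (simp add: h.divide ratfun_to_ac_to_fract ratfun_const_def flip: to_fract_mult)
  also have "\<dots> = to_fract (\<Sum>s\<in>I. smult (a s) (map_poly to_ac (p s))) / to_fract (map_poly to_ac q)"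
    by (simp add: sum_divide_distrib)
  finally have "(\<Sum>s\<in>I. smult (a s) (map_poly to_ac (p s))) = 0"
    using eq nz by (simp del: to_fract_sum)
  then have "(\<Sum>s\<in>I. a s * to_ac (Polynomial.coeff (p s) n)) = 0" for n
    by (auto simp: poly_eq_iff coeff_sum coeff_map_poly)
  then have "\<phi> (\<Sum>s\<in>I. a s * to_ac (Polynomial.coeff (p s) n)) = 0" for n
    by (simp add: \<phi>0)
  moreover have "\<phi> (x * to_ac c) = \<phi> x * c" for x c
    using \<phi>(3)[of c x] by (simp add: mult.commute)
  ultimately have "(\<Sum>s\<in>I. smult (\<phi> (a s)) (p s)) = 0"
    by (auto simp: poly_eq_iff coeff_sum \<phi>_sum)
  then have "to_fract (\<Sum>s\<in>I. smult (\<phi> (a s)) (p s)) / to_fract q = 0"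
    by simp
  also have "to_fract (\<Sum>s\<in>I. smult (\<phi> (a s)) (p s)) / to_fract q = (\<Sum>s\<in>I. ratfun_const (\<phi> (a s)) * f s)"
    unfolding to_fract_sum sum_divide_distrib using q
    by (intro sum.cong refl) (simp add: ratfun_const_def flip: to_fract_mult)
  finally show ?thesis
    using \<phi>(1) by (intro exI[of _ "\<lambda>s. \<phi> (a s)"]) auto
qed

locale ratfun_compatible = u: valued u + w: valued w
  for u :: "'a::field alg_closure \<Rightarrow> 'u::linordered_ab_group_add with_inf"
    and w :: "'a poly fract \<Rightarrow> 'g::linordered_ab_group_add with_inf" +
  assumes compatible: "equivalent (u \<circ> to_ac) (w \<circ> ratfun_const)"
begin

sublocale i: field_embedding "to_ac :: 'a \<Rightarrow> _"
  by (rule field_embedding_to_ac)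
sublocale k: field_embedding "ratfun_const :: 'a \<Rightarrow> _"
  by (rule field_embedding_ratfun_const)
sublocale j: field_embedding "ratfun_const :: 'a alg_closure \<Rightarrow> _"
  by (rule field_embedding_ratfun_const)
sublocale h: field_embedding "ratfun_to_ac :: 'a poly fract \<Rightarrow> _"
  by (rule field_embedding_ratfun_to_ac)

sublocale v: valued "u \<circ> to_ac"
  by unfold_locales (rule i.valuation_comp[OF u.valuation])

lemma nonneg_iff: "0 \<le> u (to_ac c) \<longleftrightarrow> 0 \<le> w (ratfun_const c)"
  using equivalent_le_iff[OF v.valuation k.valuation_comp[OF w.valuation] compatible, of 1 c]
  by (simp add: k.one)

lemma pos_iff: "0 < u (to_ac c) \<longleftrightarrow> 0 < w (ratfun_const c)"
  using equivalent_less_iff[OF v.valuation k.valuation_comp[OF w.valuation] compatible, of 1 c]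
  by (simp add: k.one)

text \<open>
  A relation over \<open>L\<close> yields one over \<open>K\<close> by linear disjointness. Normalised to have a unit
  coefficient, the latter is used to eliminate one of the \<open>f s\<close>.
\<close>

lemma no_unit_relation:
  fixes I :: "nat set"
  assumes "finite I" "0 \<notin> I" "u b = 0"
    and "\<And>s. s \<in> I \<Longrightarrow> 0 \<le> u (a s)" "\<And>s. s \<in> I \<Longrightarrow> 0 \<le> w (f s)"
    and "\<And>s. s \<in> I \<Longrightarrow> 0 < u (a s) \<or> 0 < w (f s)"
  shows "ratfun_const b + (\<Sum>s\<in>I. ratfun_const (a s) * ratfun_to_ac (f s)) \<noteq> 0"
  using assms
proof (induction "card I" arbitrary: I a b)
  case 0
  then show ?case
    using u.eq_Infty_iff[of b] by auto
next
  case (Suc n)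
  note a_nonneg = Suc.prems(4) and f_nonneg = Suc.prems(5) and pos = Suc.prems(6)
  have "b \<noteq> 0"
    using Suc.prems(3) by auto
  show ?case
  proof
    assume rel: "ratfun_const b + (\<Sum>s\<in>I. ratfun_const (a s) * ratfun_to_ac (f s)) = 0"
    \<comment> \<open>The constant term joins the others under the free index 0, with the function
      1.\<close>
    define I0 where "I0 = insert 0 I"
    define f' where "f' = f(0 := 1)"
    have fI: "finite I0" "0 \<in> I0"
      using Suc.prems by (auto simp: I0_def)
    have f': "f' 0 = 1" "\<And>s. s \<in> I \<Longrightarrow> f' s = f s"
      using Suc.prems(2) by (auto simp: f'_def)
    have split: "(\<Sum>s\<in>I0. g s) = g 0 + (\<Sum>s\<in>I. g s)" for g :: "nat \<Rightarrow> 'a poly fract"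
      using Suc.prems by (simp add: I0_def)
    have split': "(\<Sum>s\<in>I0. g s) = g 0 + (\<Sum>s\<in>I. g s)" for g :: "nat \<Rightarrow> 'a alg_closure poly fract"
      using Suc.prems by (simp add: I0_def)
    have "(\<Sum>s\<in>I. ratfun_const ((a(0 := b)) s) * ratfun_to_ac (f' s)) =
        (\<Sum>s\<in>I. ratfun_const (a s) * ratfun_to_ac (f s))"
      using Suc.prems(2) by (intro sum.cong refl) (auto simp: f'_def)
    then have "(\<Sum>s\<in>I0. ratfun_const ((a(0 := b)) s) * ratfun_to_ac (f' s)) = 0"
      using rel unfolding split' by (simp add: f'_def h.one)
    then obtain c where c: "c 0 = 1" "(\<Sum>s\<in>I0. ratfun_const (c s) * f' s) = 0"
      using ratfun_linearly_disjoint[OF fI, of "a(0 := b)" f'] \<open>b \<noteq> 0\<close> by auto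
    obtain d where d: "d \<in> I0" "c d \<noteq> 0" "\<And>s. s \<in> I0 \<Longrightarrow> 0 \<le> u (to_ac (c s / c d))"
      using valring.exists_dividing[OF v.valring fI, of c] c(1) by (auto simp: valuation_ring_def)
    \<comment> \<open>Scaling by a coefficient \<open>c d\<close> of least value gives all
      \<open>e s\<close> nonnegative value and makes one of them equal to 1.\<close>
    define e where "e = (\<lambda>s. c s / c d)"
    have "(\<Sum>s\<in>I0. ratfun_const (c s) * f' s) / ratfun_const (c d) = 0"
      using c by simp
    then have "(\<Sum>s\<in>I0. ratfun_const (e s) * f' s) = 0"
      unfolding sum_divide_distrib by (simp add: e_def k.divide)
    then have e: "ratfun_const (e 0) + (\<Sum>s\<in>I. ratfun_const (e s) * f s) = 0"
      unfolding split using f' by simp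
    have e_nonneg: "0 \<le> u (to_ac (e s))" if "s \<in> I0" for s
      using d that by (simp add: e_def)
    have "e d = 1"
      using d by (simp add: e_def)
    \<comment> \<open>Subtracting \<open>a s\<close> times the relation over K, scaled by
      \<open>e s\<close>, removes the term \<open>s\<close>. The induction hypothesis applies as
      soon as the constant term remains a unit and each remaining term keeps a factor of positive
      value.\<close>
    have eliminate: False
      if s: "s \<in> I" "u (to_ac (e s)) = 0" and b': "u (b - a s * to_ac (e 0 / e s)) = 0"
        and a': "\<And>t. t \<in> I \<Longrightarrow> 0 < u (a t - a s * to_ac (e t / e s)) \<or> 0 < w (f t)" for s
    proof -
      define g where "g = (\<lambda>t. e t / e s)"
      have nz: "e s \<noteq> 0"
        using s(2) by auto
      have "(ratfun_const (e 0) + (\<Sum>t\<in>I. ratfun_const (e t) * f t)) / ratfun_const (e s) = 0"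
        using e by simp
      then have "ratfun_const (g 0) + (\<Sum>t\<in>I. ratfun_const (g t) * f t) = 0"
        unfolding add_divide_distrib sum_divide_distrib by (simp add: g_def k.divide)
      then have "ratfun_to_ac (ratfun_const (g 0) + (\<Sum>t\<in>I. ratfun_const (g t) * f t)) = 0"
        by simp
      then have g: "ratfun_const (to_ac (g 0)) +
          (\<Sum>t\<in>I. ratfun_const (to_ac (g t)) * ratfun_to_ac (f t)) = 0"
        by (simp add: h.add h.sum h.mult ratfun_to_ac_const)
      define a'' where "a'' = (\<lambda>t. a t - a s * to_ac (g t))"
      have "g s = 1"
        using nz by (simp add: g_def)
      then have "a'' s = 0"
        by (simp add: a''_def)
      have "ratfun_const (b - a s * to_ac (g 0)) +
          (\<Sum>t\<in>I. ratfun_const (a'' t) * ratfun_to_ac (f t)) =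
          ratfun_const b + (\<Sum>t\<in>I. ratfun_const (a t) * ratfun_to_ac (f t)) - ratfun_const (a s) *
          (ratfun_const (to_ac (g 0)) + (\<Sum>t\<in>I. ratfun_const (to_ac (g t)) * ratfun_to_ac (f t)))"
        by (simp add: a''_def j.diff j.mult algebra_simps sum_distrib_left sum_subtractf)
      also have "\<dots> = 0"
        using g rel by simp
      also have "(\<Sum>t\<in>I. ratfun_const (a'' t) * ratfun_to_ac (f t)) =
          (\<Sum>t\<in>I - {s}. ratfun_const (a'' t) * ratfun_to_ac (f t))"
        using s(1) \<open>a'' s = 0\<close> Suc.prems(1) by (simp add: sum.remove[of I s])
      finally have "ratfun_const (b - a s * to_ac (g 0)) +
          (\<Sum>t\<in>I - {s}. ratfun_const (a'' t) * ratfun_to_ac (f t)) = 0" .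
      moreover have "ratfun_const (b - a s * to_ac (g 0)) +
          (\<Sum>t\<in>I - {s}. ratfun_const (a'' t) * ratfun_to_ac (f t)) \<noteq> 0"
      proof (rule Suc.hyps(1))
        show "n = card (I - {s})"
          using Suc.hyps(2) s(1) Suc.prems(1) by simp
        show "0 \<le> u (a'' t)" if "t \<in> I - {s}" for t
        proof -
          have "0 \<le> u (to_ac (e t) / to_ac (e s))"
            using e_nonneg[of t] s(2) that nz
            by (subst u.le_iff_divide[symmetric]) (auto simp: I0_def)
          then have "0 \<le> u (a s * to_ac (g t))"
            using a_nonneg[OF s(1)] by (intro u.mult_nonneg) (auto simp: g_def)
          then show ?thesis
            using a_nonneg[of t] that u.add_nonneg[of "a t" "- (a s * to_ac (g t))"]
            by (auto simp: a''_def)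
        qed
      qed (use Suc.prems b' a' in \<open>auto simp: g_def a''_def\<close>)
      ultimately show False
        by simp
    qed
    show False
    proof (cases "\<exists>s\<in>I. u (to_ac (e s)) = 0 \<and> w (f s) = 0")
      case True
      then obtain s where s: "s \<in> I" "u (to_ac (e s)) = 0" "w (f s) = 0"
        by blast
      \<comment> \<open>As \<open>f s\<close> is a unit, the coefficient \<open>a s\<close> has
        positive value, and so have all corrections to the other coefficients.\<close>
      then have as: "0 < u (a s)"
        using pos[of s] by auto
      have small: "0 < u (a s * to_ac (e t / e s))" if "t \<in> I0" for t
      proof -
        have "0 \<le> u (to_ac (e t) / to_ac (e s))"
          using e_nonneg[OF that] s(2) by (subst u.le_iff_divide[symmetric]) auto
        then show ?thesis
          using as by (intro u.mult_pos) auto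
      qed
      show False
      proof (rule eliminate[OF s(1,2)])
        show "u (b - a s * to_ac (e 0 / e s)) = 0"
          using u.unit_add_pos[OF Suc.prems(3), of "- (a s * to_ac (e 0 / e s))"] small[OF fI(2)] by simp
        show "0 < u (a t - a s * to_ac (e t / e s)) \<or> 0 < w (f t)" if "t \<in> I" for t
          using pos[OF that] small[of t] that u.diff_pos[of "a t"] by (auto simp: I0_def)
      qed
    next
      case False
      \<comment> \<open>Here \<open>e s\<close> has positive value whenever \<open>f s\<close> is a
        unit, so all terms over \<open>I\<close> of the relation over K have positive value. Then so
        has \<open>e 0\<close>; hence the index \<open>d\<close> with \<open>e d = 1\<close> is not
        0 and can be eliminated.\<close>
      have small: "0 < u (to_ac (e s))" if "s \<in> I" "\<not> 0 < w (f s)" for s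
        using False that e_nonneg[of s] f_nonneg[of s] by (auto simp: I0_def order_le_less)
      have "0 < w (ratfun_const (e s) * f s)" if "s \<in> I" for s
      proof (cases "0 < w (f s)")
        case True
        then have "0 < w (f s * ratfun_const (e s))"
          using e_nonneg[of s] that by (intro w.mult_pos) (auto simp: I0_def nonneg_iff)
        then show ?thesis
          by (simp add: mult.commute)
      next
        case False
        then show ?thesis
          using small[OF that] f_nonneg[OF that] by (intro w.mult_pos) (auto simp: pos_iff)
      qed
      then have "0 < w (\<Sum>s\<in>I. ratfun_const (e s) * f s)"
        by (rule w.sum_pos)
      moreover have "ratfun_const (e 0) = - (\<Sum>s\<in>I. ratfun_const (e s) * f s)"
        using e by (simp add: eq_neg_iff_add_eq_0)
      ultimately have e0: "0 < u (to_ac (e 0))"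
        by (simp add: pos_iff)
      have "d \<noteq> 0"
        using e0 \<open>e d = 1\<close> by (cases "d = 0") auto
      then have d: "d \<in> I"
        using d(1) by (simp add: I0_def)
      show False
      proof (rule eliminate[OF d])
        have "0 < u (to_ac (e 0) * a d)"
          using e0 a_nonneg[OF d] by (rule u.mult_pos)
        then show "u (b - a d * to_ac (e 0 / e d)) = 0"
          using u.unit_add_pos[OF Suc.prems(3), of "- (a d * to_ac (e 0 / e d))"] \<open>e d = 1\<close>
          by (simp add: mult.commute)
        show "0 < u (a t - a d * to_ac (e t / e d)) \<or> 0 < w (f t)" if "t \<in> I" for t
        proof (cases "0 < w (f t)")
          case False
          then have "0 < u (to_ac (e t) * a d)"
            using small[OF that] a_nonneg[OF d] by (intro u.mult_pos)
          then show ?thesis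
            using pos[OF that] False \<open>e d = 1\<close> u.diff_pos[of "a t" "to_ac (e t) * a d"]
            by (simp add: mult.commute)
        qed auto
      qed (simp add: \<open>e d = 1\<close>)
    qed
  qed
qed

end

section \<open>The compositum of the two valuation rings\<close>

inductive_set add_span :: "'a::field set \<Rightarrow> 'a set" for S where
  zero: "0 \<in> add_span S"
| step: "x \<in> S \<Longrightarrow> y \<in> add_span S \<Longrightarrow> x + y \<in> add_span S"

lemma add_span_incl: "x \<in> S \<Longrightarrow> x \<in> add_span S"
  using add_span.step[OF _ add_span.zero, of x S] by simp

lemma add_span_add: "x \<in> add_span S \<Longrightarrow> y \<in> add_span S \<Longrightarrow> x + y \<in> add_span S"
  by (induction rule: add_span.induct) (auto intro: add_span.intros simp: add.assoc)

lemma add_span_mono: "x \<in> add_span S \<Longrightarrow> S \<subseteq> T \<Longrightarrow> x \<in> add_span T"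
  by (induction rule: add_span.induct) (auto intro: add_span.intros)

lemma add_span_mult:
  assumes "x \<in> add_span S" "y \<in> add_span T" and ST: "\<And>a b. a \<in> S \<Longrightarrow> b \<in> T \<Longrightarrow> a * b \<in> R"
  shows "x * y \<in> add_span R"
proof -
  have *: "a * y \<in> add_span R" if "a \<in> S" for a
    using assms(2)
    by (induction rule: add_span.induct) (auto simp: distrib_left intro: add_span.intros ST that)
  show ?thesis
    using assms(1)
    by (induction rule: add_span.induct) (auto simp: distrib_right intro: add_span.zero add_span_add *)
qed

lemma add_span_minus:
  assumes "\<And>a. a \<in> S \<Longrightarrow> - a \<in> S"
  shows "x \<in> add_span S \<Longrightarrow> - x \<in> add_span S"
proof (induction rule: add_span.induct)
  case (step x y)
  then show ?case
    using add_span.step[of "- x" S "- y"] assms by simp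
qed (auto intro: add_span.zero)

lemma add_span_obtain:
  assumes "x \<in> add_span S"
  shows "\<exists>n g. (\<forall>i\<in>{1..n}. g i \<in> S) \<and> x = (\<Sum>i\<in>{1..n::nat}. g i)"
  using assms
proof (induction rule: add_span.induct)
  case zero
  show ?case
    by (rule exI[of _ 0]) simp
next
  case (step x y)
  then obtain n g where g: "\<forall>i\<in>{1..n}. g i \<in> S" "y = (\<Sum>i\<in>{1..n::nat}. g i)"
    by blast
  have "(\<Sum>i\<in>{1..Suc n}. (g(Suc n := x)) i) = x + y"
    by (simp add: g(2) add.commute)
  moreover have "\<forall>i\<in>{1..Suc n}. (g(Suc n := x)) i \<in> S"
    using g(1) step(1) by auto
  ultimately show ?case
    by metis
qed

text \<open>An element of negative value has its inverse in the maximal ideal, which goes into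
  \<open>\<mm>\<close>. Were its image in \<open>V\<close>, the product 1 would lie in
  \<open>\<mm>\<close>.\<close>

lemma valring_over_if_dominates:
  assumes V: "valring V" and h: "field_embedding h" and w: "valuation w"
    and ring: "\<And>a. 0 \<le> w a \<Longrightarrow> h a \<in> V" and ideal: "\<And>a. 0 < w a \<Longrightarrow> h a \<in> valring.\<mm> V"
  shows "valring_over V h w"
proof -
  interpret V: valring V by fact
  interpret h: field_embedding h by fact
  interpret w: valued w by (rule valued.intro, fact)
  show ?thesis
  proof
    fix a
    show "h a \<in> V \<longleftrightarrow> 0 \<le> w a"
    proof
      assume *: "h a \<in> V"
      show "0 \<le> w a"
      proof (rule ccontr)
        assume neg: "\<not> 0 \<le> w a"
        then have "a \<noteq> 0"
          by auto
        then have "0 < w (inverse a)"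
          using neg w.less_iff_divide[of a 1] by (simp add: divide_inverse not_le)
        then have "h (inverse a) * h a \<in> V.\<mm>"
          using * by (intro V.\<mm>_mult ideal)
        then show False
          using \<open>a \<noteq> 0\<close> by (simp add: h.one flip: h.mult)
      qed
    qed (rule ring)
  qed
qed

context ratfun_compatible
begin

text \<open>Products with a factor of positive value span an ideal of the compositum, proper by
  \<open>no_unit_relation\<close>. A valuation ring above this pair lies over both \<open>u\<close>
  and \<open>w\<close>. Its values are built from those of \<open>w\<close>, since every nonzero
  element is torsion over K(x).\<close>

lemma joint_extension:
  "\<exists>w' :: 'a alg_closure poly fract \<Rightarrow> 'g div_hull with_inf.
     valuation w' \<and> equivalent u (w' \<circ> ratfun_const) \<and> equivalent w (w' \<circ> ratfun_to_ac)"
proof -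
  define S where "S = {ratfun_const a * ratfun_to_ac f | a f. 0 \<le> u a \<and> 0 \<le> w f}"
  define T where "T = {ratfun_const a * ratfun_to_ac f | a f. 0 \<le> u a \<and> 0 \<le> w f \<and> (0 < u a \<or> 0 < w f)}"
  have S_I: "ratfun_const a * ratfun_to_ac f \<in> S" if "0 \<le> u a" "0 \<le> w f" for a f
    using that by (auto simp: S_def)
  have T_I: "ratfun_const a * ratfun_to_ac f \<in> T" if "0 \<le> u a" "0 \<le> w f" "0 < u a \<or> 0 < w f" for a f
    using that by (auto simp: T_def)
  \<comment> \<open>The factors are exchanged because \<open>mult_pos\<close> expects the factor of
    positive value first, and that is the one coming from \<open>T\<close>.\<close>
  have mult_eq: "ratfun_const a * ratfun_to_ac f * (ratfun_const b * ratfun_to_ac g) =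
      ratfun_const (b * a) * ratfun_to_ac (g * f)" for a b :: "'a alg_closure" and f g
    by (simp add: j.mult h.mult)
  have "proper_ideal_of (add_span S) (add_span T)"
  proof (rule proper_ideal_ofI)
    show "1 \<in> add_span S"
      using S_I[of 1 1] by (auto intro: add_span_incl simp: j.one h.one)
    show "a * b \<in> add_span S" if "a \<in> add_span S" "b \<in> add_span S" for a b
    proof (rule add_span_mult[OF that])
      fix x y assume "x \<in> S" "y \<in> S"
      then show "x * y \<in> S"
        unfolding S_def[unfolded set_eq_iff, THEN spec, of x]
          S_def[unfolded set_eq_iff, THEN spec, of y]
        using S_I u.mult_nonneg w.mult_nonneg by (auto simp: mult_eq)
    qed
    show "a * b \<in> add_span T" if "a \<in> add_span S" "b \<in> add_span T" for a b
    proof (rule add_span_mult[OF that])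
      fix x y assume "x \<in> S" "y \<in> T"
      then show "x * y \<in> T"
        unfolding S_def[unfolded set_eq_iff, THEN spec, of x]
          T_def[unfolded set_eq_iff, THEN spec, of y]
        using T_I u.mult_nonneg w.mult_nonneg u.mult_pos w.mult_pos by (auto simp: mult_eq)
    qed
    show "- a \<in> add_span S" if "a \<in> add_span S" for a
    proof (rule add_span_minus[OF _ that])
      fix x assume "x \<in> S"
      then obtain b f where "x = ratfun_const b * ratfun_to_ac f" "0 \<le> u b" "0 \<le> w f"
        by (auto simp: S_def)
      then show "- x \<in> S"
        using S_I[of "- b" f] by (simp add: j.minus)
    qed
    have "T \<subseteq> S"
      by (auto simp: S_def T_def)
    then show "add_span T \<subseteq> add_span S"
      using add_span_mono[of _ T S] by auto
    show "1 \<notin> add_span T"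
    proof
      assume "1 \<in> add_span T"
      then obtain n g where g: "\<forall>i\<in>{1..n}. g i \<in> T" "1 = (\<Sum>i\<in>{1..n::nat}. g i)"
        using add_span_obtain[of 1 T] by metis
      then have "\<forall>i\<in>{1..n}. \<exists>a f. g i = ratfun_const a * ratfun_to_ac f \<and>
          0 \<le> u a \<and> 0 \<le> w f \<and> (0 < u a \<or> 0 < w f)"
        by (auto simp: T_def)
      then obtain a f where af: "\<And>i. i \<in> {1..n} \<Longrightarrow> g i = ratfun_const (a i) * ratfun_to_ac (f i) \<and>
          0 \<le> u (a i) \<and> 0 \<le> w (f i) \<and> (0 < u (a i) \<or> 0 < w (f i))"
        by metis
      \<comment> \<open>A representation of 1 is a relation with the unit \<open>- 1\<close> as
        constant term. The indices start at 1 because \<open>no_unit_relation\<close> keeps 0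
        free.\<close>
      have "ratfun_const (- 1) + (\<Sum>i\<in>{1..n}. ratfun_const (a i) * ratfun_to_ac (f i)) = 0"
        using g(2) af by (simp add: j.minus j.one)
      then show False
        using no_unit_relation[of "{1..n}" "- 1" a f] af by auto
    qed
  qed (auto intro: add_span_add add_span.zero)
  then obtain V where V: "valring V" "add_span S \<subseteq> V" "add_span T \<subseteq> valring.\<mm> V"
    by (rule chevalley)
  have "ratfun_to_ac f \<in> V" if "0 \<le> w f" for f
    using V(2) add_span_incl[OF S_I[of 1 f]] that by (auto simp: j.one)
  moreover have "ratfun_to_ac f \<in> valring.\<mm> V" if "0 < w f" for f
    using V(3) add_span_incl[OF T_I[of 1 f]] that by (auto simp: j.one)
  ultimately have w_over: "valring_over V ratfun_to_ac w"
    by (intro valring_over_if_dominates V(1) h.field_embedding_axioms w.valuation)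
  have "ratfun_const a \<in> V" if "0 \<le> u a" for a
    using V(2) add_span_incl[OF S_I[of a 1]] that by (auto simp: h.one)
  moreover have "ratfun_const a \<in> valring.\<mm> V" if "0 < u a" for a
    using V(3) add_span_incl[OF T_I[of a 1]] that by (auto simp: h.one)
  ultimately have u_over: "valring_over V ratfun_const u"
    by (intro valring_over_if_dominates V(1) j.field_embedding_axioms u.valuation)
  obtain w' :: "'a alg_closure poly fract \<Rightarrow> 'g div_hull with_inf"
    where w': "valuation w'" "valuation_ring w' = V"
    using valring_over.exists_valuation[OF w_over] valring_over_ratfun_torsion[OF w_over] by blast
  have "0 \<le> w' z \<longleftrightarrow> z \<in> V" for z
    using w'(2) by (auto simp: valuation_ring_def)
  then show ?thesis
    using w'(1) valring_over.in_iff[OF w_over] valring_over.in_iff[OF u_over]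
    by (auto simp: equivalent_def valuation_ring_def)
qed

end

text \<open>Nothing is prescribed on the closure here, so the images of the valuation ring of
  \<open>w\<close> and of its maximal ideal already form a pair for \<open>chevalley\<close>. The
  ideal is proper because the embedding is injective.\<close>

lemma valuation_extends_to_ac:
  fixes w :: "'a::field poly fract \<Rightarrow> 'g::linordered_ab_group_add with_inf"
  assumes "valuation w"
  shows "\<exists>w' :: 'a alg_closure poly fract \<Rightarrow> 'g div_hull with_inf.
    valuation w' \<and> equivalent w (w' \<circ> ratfun_to_ac)"
proof -
  interpret h: field_embedding "ratfun_to_ac :: 'a poly fract \<Rightarrow> _"
    by (rule field_embedding_ratfun_to_ac)
  interpret w: valued w
    by (rule valued.intro, fact)
  define A where "A = ratfun_to_ac ` {f. 0 \<le> w f}"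
  define J where "J = ratfun_to_ac ` {f. 0 < w f}"
  have A_I: "ratfun_to_ac f \<in> A" if "0 \<le> w f" for f
    using that by (auto simp: A_def)
  have J_I: "ratfun_to_ac f \<in> J" if "0 < w f" for f
    using that by (auto simp: J_def)
  have "proper_ideal_of A J"
  proof (rule proper_ideal_ofI)
    show "1 \<in> A"
      using A_I[of 1] by (simp add: h.one)
    show "0 \<in> J"
      using J_I[of 0] by simp
    show "J \<subseteq> A"
      by (auto simp: A_def J_def)
    show "a + b \<in> A" if "a \<in> A" "b \<in> A" for a b
      using that w.add_nonneg by (auto simp: A_def simp flip: h.add)
    show "a * b \<in> A" if "a \<in> A" "b \<in> A" for a b
      using that w.mult_nonneg by (auto simp: A_def simp flip: h.mult)
    show "- a \<in> A" if "a \<in> A" for a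
      using that by (auto simp: A_def simp flip: h.minus)
    show "a + b \<in> J" if "a \<in> J" "b \<in> J" for a b
      using that w.add_pos by (auto simp: J_def simp flip: h.add)
    show "a * b \<in> J" if "a \<in> A" "b \<in> J" for a b
      using that w.mult_pos by (subst mult.commute) (auto simp: A_def J_def simp flip: h.mult)
    show "1 \<notin> J"
    proof
      assume "1 \<in> J"
      then obtain f where f: "1 = ratfun_to_ac f" "0 < w f"
        by (auto simp: J_def)
      then have "ratfun_to_ac (f - 1) = 0"
        by (simp add: h.diff h.one)
      then show False
        using f by simp
    qed
  qed
  then obtain V where V: "valring V" "A \<subseteq> V" "J \<subseteq> valring.\<mm> V"
    by (rule chevalley)
  then have over: "valring_over V ratfun_to_ac w"
    using A_I J_I by (intro valring_over_if_dominates h.field_embedding_axioms assms) blast+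
  obtain w' :: "'a alg_closure poly fract \<Rightarrow> 'g div_hull with_inf"
    where w': "valuation w'" "valuation_ring w' = V"
    using valring_over.exists_valuation[OF over] valring_over_ratfun_torsion[OF over] by blast
  have "0 \<le> w' z \<longleftrightarrow> z \<in> V" for z
    using w'(2) by (auto simp: valuation_ring_def)
  then show ?thesis
    using w'(1) valring_over.in_iff[OF over]
    by (auto simp: equivalent_def valuation_ring_def)
qed

section \<open>Monomial valuations and pseudo Cauchy sequences\<close>

abbreviation lin :: "'a::field \<Rightarrow> 'a poly fract" where
  "lin b \<equiv> to_fract [:- b, 1:]"

lemma lin_diff: "lin b - lin c = ratfun_const (c - b)"
  by (simp add: ratfun_const_def flip: to_fract_diff)

lemma lin_nonzero [simp]: "lin b \<noteq> 0"
  by simp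

text \<open>Monomial values and eventual values along a sequence share these two properties, which
  make \<open>ratfun_val\<close> independent of the representing fraction.\<close>

locale poly_val =
  fixes m :: "'a::field poly \<Rightarrow> 'g::linordered_ab_group_add with_inf"
  assumes mult: "m (g * h) = m g + m h"
    and eq_Infty_iff: "m h = Infty \<longleftrightarrow> h = 0"
begin

lemma ratfun_val_divide:
  assumes "h \<noteq> 0"
  shows "ratfun_val m (to_fract g / to_fract h) = m g - m h"
proof -
  define f where "f = Fract g h"
  obtain g' h' where rep: "rep_fract f = (g', h')"
    by fastforce
  have h': "h' \<noteq> 0" "f = Fract g' h'"
    using fract_eq_Fract_rep[of f] rep by auto
  then have "g * h' = g' * h"
    using assms by (simp add: f_def eq_fract)
  then have "m g + m h' = m g' + m h"
    by (simp flip: mult)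
  moreover have "m h' \<noteq> Infty" "m h \<noteq> Infty"
    using h' assms by (auto simp: eq_Infty_iff)
  ultimately have "m g' - m h' = m g - m h"
    by (cases "m g"; cases "m h"; cases "m g'"; cases "m h'") (auto simp: algebra_simps)
  then show ?thesis
    using rep by (simp add: ratfun_val_def f_def Fract_conv_to_fract)
qed

lemma equivalent_le_iff:
  assumes "valuation w" "equivalent w (ratfun_val m)" "h \<noteq> 0"
  shows "w (to_fract h) \<le> w (to_fract g) \<longleftrightarrow> m h \<le> m g"
proof -
  interpret w: valued w
    by (rule valued.intro, fact)
  have "w (to_fract h) \<le> w (to_fract g) \<longleftrightarrow> 0 \<le> w (to_fract g / to_fract h)"
    using assms(3) by (intro w.le_iff_divide) simp
  also have "\<dots> \<longleftrightarrow> 0 \<le> ratfun_val m (to_fract g / to_fract h)"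
    using assms(2) by (auto simp: equivalent_def valuation_ring_def)
  also have "\<dots> \<longleftrightarrow> m h \<le> m g"
    using assms(3) by (simp add: ratfun_val_divide with_inf_le_minus_iff eq_Infty_iff)
  finally show ?thesis .
qed

end

section \<open>Monomial valuations\<close>

context valued
begin

definition coeff_value :: "'g \<Rightarrow> 'a poly \<Rightarrow> nat \<Rightarrow> 'g with_inf" where
  "coeff_value \<gamma> p i = w (Polynomial.coeff p i) + Fin (nsmul i \<gamma>)"

text \<open>Running over all indices, with vanishing coefficients contributing \<open>Infty\<close>,
  keeps degrees out of the product formula.\<close>

definition is_gauss_value :: "'g \<Rightarrow> 'a poly \<Rightarrow> 'g with_inf \<Rightarrow> bool" where
  "is_gauss_value \<gamma> p y \<longleftrightarrow> (\<forall>i. y \<le> coeff_value \<gamma> p i) \<and> (\<exists>i. coeff_value \<gamma> p i = y)"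

lemma is_gauss_value_unique: "is_gauss_value \<gamma> p y \<Longrightarrow> is_gauss_value \<gamma> p z \<Longrightarrow> y = z"
  unfolding is_gauss_value_def by (metis order_antisym)

lemma is_gauss_value_monomial_poly_val:
  "is_gauss_value \<gamma> (pcompose g [:a, 1:]) (monomial_poly_val w a \<gamma> g)"
proof -
  define p where "p = pcompose g [:a, 1:]"
  have deg: "Polynomial.degree p = Polynomial.degree g"
    by (simp add: p_def degree_pcompose)
  have eq: "monomial_poly_val w a \<gamma> g = Min (coeff_value \<gamma> p ` {0..Polynomial.degree p})"
    unfolding monomial_poly_val_def deg unfolding coeff_value_def p_def ..
  have "Min (coeff_value \<gamma> p ` {0..Polynomial.degree p}) \<in> coeff_value \<gamma> p ` {0..Polynomial.degree p}"
    by (intro Min_in) auto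
  then obtain i where "coeff_value \<gamma> p i = monomial_poly_val w a \<gamma> g"
    unfolding eq by (metis imageE)
  moreover have "monomial_poly_val w a \<gamma> g \<le> coeff_value \<gamma> p i" for i
  proof (cases "i \<le> Polynomial.degree p")
    case True
    then show ?thesis
      unfolding eq by (intro Min_le) auto
  next
    case False
    then show ?thesis
      by (simp add: coeff_value_def coeff_eq_0)
  qed
  ultimately show ?thesis
    unfolding is_gauss_value_def p_def by blast
qed

lemma sum_add_ge:
  assumes "\<And>i. i \<in> I \<Longrightarrow> y \<le> w (f i) + c"
  shows "y \<le> w (\<Sum>i\<in>I. f i) + c"
  using assms
proof (induction I rule: infinite_finite_induct)
  case (insert i I)
  then have "y \<le> min (w (f i)) (w (sum f I)) + c"
    by (simp add: min_add_distrib)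
  also have "\<dots> \<le> w (f i + sum f I) + c"
    by (intro add_right_mono add)
  finally show ?case
    using insert by simp
qed auto

lemma sum_add_greater:
  assumes "\<And>i. i \<in> I \<Longrightarrow> y < w (f i) + c" "y \<noteq> Infty"
  shows "y < w (\<Sum>i\<in>I. f i) + c"
  using assms
proof (induction I rule: infinite_finite_induct)
  case (insert i I)
  then have "y < min (w (f i)) (w (sum f I)) + c"
    by (simp add: min_add_distrib)
  also have "\<dots> \<le> w (f i + sum f I) + c"
    by (intro add_right_mono add)
  finally show ?case
    using insert by simp
qed auto

lemma coeff_value_mult:
  assumes "j \<le> n"
  shows "w (Polynomial.coeff p j * Polynomial.coeff q (n - j)) + Fin (nsmul n \<gamma>) =
    coeff_value \<gamma> p j + coeff_value \<gamma> q (n - j)"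
proof -
  have "Fin (nsmul n \<gamma>) = Fin (nsmul j \<gamma>) + Fin (nsmul (n - j) \<gamma>)"
    using nsmul_add_left[of j "n - j" \<gamma>] assms by simp
  then show ?thesis
    by (simp only: coeff_value_def mult ac_simps)
qed

text \<open>
  Gauss's lemma: the least indices at which the minima of \<open>p\<close> and \<open>q\<close> are attained add up to the
  index of a coefficient of \<open>p * q\<close> with a single term of minimal value.
\<close>

lemma is_gauss_value_mult:
  assumes p: "is_gauss_value \<gamma> p y" and q: "is_gauss_value \<gamma> q z"
  shows "is_gauss_value \<gamma> (p * q) (y + z)"
proof -
  let ?p = "Polynomial.coeff p" and ?q = "Polynomial.coeff q"
  have ge: "y + z \<le> coeff_value \<gamma> (p * q) n" for n
    unfolding coeff_value_def coeff_mult
  proof (rule sum_add_ge)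
    fix j assume "j \<in> {..n}"
    then have "j \<le> n"
      by simp
    then show "y + z \<le> w (?p j * ?q (n - j)) + Fin (nsmul n \<gamma>)"
      using p q unfolding coeff_value_mult[OF \<open>j \<le> n\<close>] is_gauss_value_def by (auto intro: add_mono)
  qed
  have "\<exists>n. coeff_value \<gamma> (p * q) n = y + z"
  proof (cases "y = Infty \<or> z = Infty")
    case True
    \<comment> \<open>An infinite minimum makes the lower bound \<open>Infty\<close>, so already the
      coefficient at index 0 attains it.\<close>
    then have "y + z = Infty"
      by auto
    then show ?thesis
      using ge[of 0] by (intro exI[of _ 0]) auto
  next
    case False
    define i where "i = (LEAST i. coeff_value \<gamma> p i = y)"
    define j where "j = (LEAST j. coeff_value \<gamma> q j = z)"
    have i: "coeff_value \<gamma> p i = y" "\<And>k. k < i \<Longrightarrow> y < coeff_value \<gamma> p k"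
      using p LeastI_ex[of "\<lambda>i. coeff_value \<gamma> p i = y"] not_less_Least[of _ "\<lambda>i. coeff_value \<gamma> p i = y"]
      unfolding is_gauss_value_def i_def by (blast, metis order_le_less)
    have j: "coeff_value \<gamma> q j = z" "\<And>k. k < j \<Longrightarrow> z < coeff_value \<gamma> q k"
      using q LeastI_ex[of "\<lambda>i. coeff_value \<gamma> q i = z"] not_less_Least[of _ "\<lambda>i. coeff_value \<gamma> q i = z"]
      unfolding is_gauss_value_def j_def by (blast, metis order_le_less)
    define n where "n = i + j"
    define R where "R = (\<Sum>k\<in>{..n} - {i}. ?p k * ?q (n - k))"
    have main: "w (?p i * ?q j) + Fin (nsmul n \<gamma>) = y + z"
      using coeff_value_mult[of i n p q \<gamma>] i j by (simp add: n_def)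
    have "y + z < w R + Fin (nsmul n \<gamma>)"
      unfolding R_def
    proof (rule sum_add_greater)
      fix k assume k: "k \<in> {..n} - {i}"
      have ge: "y \<le> coeff_value \<gamma> p k" "z \<le> coeff_value \<gamma> q (n - k)"
        using p q by (auto simp: is_gauss_value_def)
      have "y + z < coeff_value \<gamma> p k + coeff_value \<gamma> q (n - k)"
      proof (cases "k < i")
        case True
        then show ?thesis
          using with_inf_add_less_le_mono[OF i(2)[OF True] ge(2)] False by auto
      next
        case k': False
        then have "n - k < j"
          using k by (auto simp: n_def)
        then show ?thesis
          using with_inf_add_less_le_mono[OF j(2)[OF \<open>n - k < j\<close>] ge(1)] False by (auto simp: add.commute)
      qed
      then show "y + z < w (?p k * ?q (n - k)) + Fin (nsmul n \<gamma>)"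
        using k by (subst coeff_value_mult) auto
    qed (use False in auto)
    then have "w (?p i * ?q j) < w R"
      unfolding main[symmetric] by (subst (asm) (1 2) add.commute) (simp add: with_inf_add_less_cancel)
    then have "w (?p i * ?q j + R) = w (?p i * ?q j)"
      by (rule add_eq_left)
    moreover have "Polynomial.coeff (p * q) n = ?p i * ?q j + R"
      unfolding coeff_mult R_def by (subst sum.remove[of "{..n}" i]) (auto simp: n_def)
    ultimately have "coeff_value \<gamma> (p * q) n = y + z"
      using main by (simp add: coeff_value_def)
    then show ?thesis
      by blast
  qed
  with ge show ?thesis
    by (auto simp: is_gauss_value_def)
qed

lemma monomial_poly_val_eqI:
  "is_gauss_value \<gamma> (pcompose g [:a, 1:]) y \<Longrightarrow> monomial_poly_val w a \<gamma> g = y"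
  using is_gauss_value_monomial_poly_val is_gauss_value_unique by blast

lemma poly_val_monomial: "poly_val (monomial_poly_val w a \<gamma>)"
proof
  fix g h
  show "monomial_poly_val w a \<gamma> (g * h) = monomial_poly_val w a \<gamma> g + monomial_poly_val w a \<gamma> h"
    by (intro monomial_poly_val_eqI)
      (auto simp: pcompose_mult intro: is_gauss_value_mult is_gauss_value_monomial_poly_val)
  define p where "p = pcompose h [:a, 1:]"
  have "is_gauss_value \<gamma> p (monomial_poly_val w a \<gamma> h)"
    unfolding p_def by (rule is_gauss_value_monomial_poly_val)
  then have "monomial_poly_val w a \<gamma> h = Infty \<longleftrightarrow> (\<forall>i. coeff_value \<gamma> p i = Infty)"
    unfolding is_gauss_value_def by (metis Infty_le_iff)
  also have "\<dots> \<longleftrightarrow> p = 0"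
    by (simp add: coeff_value_def poly_eq_iff)
  also have "\<dots> \<longleftrightarrow> h = 0"
    using pcompose_eq_0[of h "[:a, 1:]"] by (auto simp: p_def)
  finally show "monomial_poly_val w a \<gamma> h = Infty \<longleftrightarrow> h = 0" .
qed

lemma monomial_poly_val_const: "monomial_poly_val w a \<gamma> [:c:] = w c"
  by (simp add: monomial_poly_val_def pcompose_pCons Fin_0)

lemma monomial_poly_val_lin: "monomial_poly_val w a \<gamma> [:- b, 1:] = min (w (a - b)) (Fin \<gamma>)"
proof -
  have "{0..Polynomial.degree [:- b, 1:]} = {0, 1}"
    by auto
  then show ?thesis
    by (simp add: monomial_poly_val_def pcompose_pCons Fin_0)
qed

end

text \<open>The monomial valuation gives x - b the value
  \<open>min (u (a - b)) (Fin \<gamma>)\<close>, which is largest at \<open>b = a\<close>. Comparing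
  values carries this over to \<open>w\<close>, although its group may differ from that of
  \<open>u\<close>.\<close>

lemma equivalent_monomial_val_maximal:
  assumes "valuation u" "valuation w" "equivalent w (monomial_val u a \<gamma>)"
  shows "w (lin b) \<le> w (lin a)"
    and "\<gamma> \<in> carrier (value_group u) \<longleftrightarrow> (\<exists>d. w (ratfun_const d) = w (lin a))"
proof -
  interpret u: valued u
    by (rule valued.intro, fact)
  interpret w: valued w
    by (rule valued.intro, fact)
  interpret m: poly_val "monomial_poly_val u a \<gamma>"
    by (rule u.poly_val_monomial)
  note le = m.equivalent_le_iff[OF assms(2) assms(3)[unfolded monomial_val_def]]
  show "w (lin b) \<le> w (lin a)"
    by (subst le) (auto simp: u.monomial_poly_val_lin)
  have d: "w (ratfun_const d) = w (lin a) \<longleftrightarrow> u d = Fin \<gamma>" for d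
  proof (cases "d = 0")
    case True
    moreover have "Infty \<noteq> w (lin a)"
      using w.eq_Infty_iff[of "lin a"] by (metis lin_nonzero)
    ultimately show ?thesis
      by (simp add: ratfun_const_def)
  next
    case False
    have "monomial_poly_val u a \<gamma> [:- a, 1:] = Fin \<gamma>"
      by (simp add: u.monomial_poly_val_lin min_def)
    then have "w (ratfun_const d) \<le> w (lin a) \<longleftrightarrow> u d \<le> Fin \<gamma>"
        "w (lin a) \<le> w (ratfun_const d) \<longleftrightarrow> Fin \<gamma> \<le> u d"
      using le[of "[:d:]" "[:- a, 1:]"] le[of "[:- a, 1:]" "[:d:]"] False
      by (simp_all only: ratfun_const_def u.monomial_poly_val_const) simp_all
    then show ?thesis
      by (metis order_antisym order_refl)
  qed
  show "\<gamma> \<in> carrier (value_group u) \<longleftrightarrow> (\<exists>d. w (ratfun_const d) = w (lin a))"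
    by (simp add: d value_group_def)
qed

lemma maximal_imp_monomial_val:
  fixes w :: "'a::alg_closed_field poly fract \<Rightarrow> 'g::linordered_ab_group_add with_inf"
  assumes "valuation w" and max: "\<And>b. w (lin b) \<le> w (lin a)" and \<gamma>: "w (lin a) = Fin \<gamma>"
  shows "monomial_val (w \<circ> ratfun_const) a \<gamma> = w"
proof (rule ext)
  fix z :: "'a poly fract"
  interpret w: valued w
    by (rule valued.intro, fact)
  interpret j: field_embedding "ratfun_const :: 'a \<Rightarrow> _"
    by (rule field_embedding_ratfun_const)
  interpret u: valued "w \<circ> ratfun_const"
    by (rule valued.intro, rule j.valuation_comp, fact)
  interpret m: poly_val "monomial_poly_val (w \<circ> ratfun_const) a \<gamma>"
    by (rule u.poly_val_monomial)
  \<comment> \<open>If x - b and x - a have equal value, \<open>a - b\<close> has at least this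
    value; otherwise \<open>a - b\<close> has the smaller of the two, that of x - b. Either way the
    minimum is w(x - b).\<close>
  have lin: "monomial_poly_val (w \<circ> ratfun_const) a \<gamma> [:- b, 1:] = w (lin b)" for b
  proof (cases "w (lin b) = w (lin a)")
    case True
    have "min (w (lin b)) (w (lin a)) \<le> w (ratfun_const (a - b))"
      using w.diff[of "lin b" "lin a"] by (simp only: lin_diff)
    then show ?thesis
      using True by (simp add: u.monomial_poly_val_lin \<gamma>)
  next
    case False
    then have "w (ratfun_const (a - b)) = w (lin b)"
      using w.diff_eq_min[of "lin b" "lin a"] max[of b] by (simp only: lin_diff) (simp add: min_def)
    then show ?thesis
      using max[of b] by (simp add: u.monomial_poly_val_lin \<gamma> min_def)
  qed
  have poly: "monomial_poly_val (w \<circ> ratfun_const) a \<gamma> p = w (to_fract p)" for p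
  proof (cases "p = 0")
    case False
    then show ?thesis
    proof (induction p rule: alg_closed_poly_induct)
      case (const c)
      have "monomial_poly_val (w \<circ> ratfun_const) a \<gamma> [:c:] = w (ratfun_const c)"
        by (simp only: u.monomial_poly_val_const o_apply)
      then show ?case
        by (simp only: ratfun_const_def[of c])
    next
      case (linear b p)
      then show ?case
        by (simp only: m.mult lin w.mult to_fract_mult)
    qed
  qed (simp add: m.eq_Infty_iff)
  obtain g h where gh: "h \<noteq> 0" "z = to_fract g / to_fract h"
    by (rule ratfun_cases[of z])
  then show "monomial_val (w \<circ> ratfun_const) a \<gamma> z = w z"
    using w.divide[of "to_fract h" "to_fract g"]
    by (simp add: monomial_val_def m.ratfun_val_divide poly with_inf_minus_eq_iff)
qed

section \<open>Pseudo Cauchy sequences of transcendental type\<close>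

lemma limit_orderD:
  assumes "limit_order r"
  shows "i \<in> Field r \<Longrightarrow> (i, i) \<in> r"
    and "(i, j) \<in> r \<Longrightarrow> (j, k) \<in> r \<Longrightarrow> (i, k) \<in> r"
    and "i \<in> Field r \<Longrightarrow> j \<in> Field r \<Longrightarrow> \<exists>k\<in>Field r. (i, k) \<in> r \<and> (j, k) \<in> r"
    and "i \<in> Field r \<Longrightarrow> \<exists>j\<in>Field r. (i, j) \<in> r - Id"
    and "\<exists>i. i \<in> Field r"
    and "(i, j) \<in> r - Id \<Longrightarrow> (j, k) \<in> r \<Longrightarrow> (i, k) \<in> r - Id"
proof -
  have r: "refl_on (Field r) r" "trans r" "antisym r" "total_on (Field r) r"
    using assms by (auto simp: limit_order_def well_order_on_def linear_order_on_def
        partial_order_on_def preorder_on_def)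
  show refl: "(i, i) \<in> r" if "i \<in> Field r" for i
    using r(1) that by (rule refl_onD)
  show "(i, j) \<in> r \<Longrightarrow> (j, k) \<in> r \<Longrightarrow> (i, k) \<in> r"
    using r(2) by (rule transD)
  show "\<exists>k\<in>Field r. (i, k) \<in> r \<and> (j, k) \<in> r" if "i \<in> Field r" "j \<in> Field r"
    using r(4) that refl unfolding total_on_def by metis
  show "i \<in> Field r \<Longrightarrow> \<exists>j\<in>Field r. (i, j) \<in> r - Id"
    using assms by (auto simp: limit_order_def)
  show "\<exists>i. i \<in> Field r"
    using assms by (auto simp: limit_order_def)
  show "(i, k) \<in> r - Id" if "(i, j) \<in> r - Id" "(j, k) \<in> r"
    using that transD[OF r(2)] antisymD[OF r(3)] by blast
qed

lemma has_eventual_value_unique: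
  assumes r: "limit_order r" and "has_eventual_value w r A g y" "has_eventual_value w r A g z"
  shows "y = z"
proof -
  obtain i j where *: "i \<in> Field r" "j \<in> Field r" "\<And>k. (i, k) \<in> r \<Longrightarrow> w (poly g (A k)) = y"
      "\<And>k. (j, k) \<in> r \<Longrightarrow> w (poly g (A k)) = z"
    using assms by (auto simp: has_eventual_value_def)
  then obtain k where "(i, k) \<in> r" "(j, k) \<in> r"
    using limit_orderD(3)[OF r] by meson
  with * show ?thesis
    by metis
qed

lemma the_eventual_value:
  assumes "limit_order r" "has_eventual_value w r A g y"
  shows "(THE y. has_eventual_value w r A g y) = y"
  using assms has_eventual_value_unique by (intro the_equality) blast+

lemma (in valued) has_eventual_value_mult:
  assumes r: "limit_order r" and "has_eventual_value w r A g y" "has_eventual_value w r A h z"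
  shows "has_eventual_value w r A (g * h) (y + z)"
proof -
  obtain i j where *: "i \<in> Field r" "j \<in> Field r" "\<And>k. (i, k) \<in> r \<Longrightarrow> w (poly g (A k)) = y"
      "\<And>k. (j, k) \<in> r \<Longrightarrow> w (poly h (A k)) = z"
    using assms by (auto simp: has_eventual_value_def)
  then obtain k where k: "k \<in> Field r" "(i, k) \<in> r" "(j, k) \<in> r"
    using limit_orderD(3)[OF r] by meson
  have "w (poly (g * h) (A l)) = y + z" if "(k, l) \<in> r" for l
    using *(3,4)[of l] limit_orderD(2)[OF r k(2) that] limit_orderD(2)[OF r k(3) that]
    by (simp add: mult)
  then show ?thesis
    using k by (auto simp: has_eventual_value_def)
qed

locale transcendental_sequence = valued u
  for u :: "'a::alg_closed_field \<Rightarrow> 'g::linordered_ab_group_add with_inf" +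
  fixes r :: "'i rel" and A :: "'i \<Rightarrow> 'a"
  assumes type: "transcendental_type u r A"
begin

definition ev :: "'a poly \<Rightarrow> 'g with_inf" where
  "ev g = (THE y. has_eventual_value u r A g y)"

lemma limit_order: "limit_order r"
  and pseudo_cauchy: "(\<rho>, \<sigma>) \<in> r - Id \<Longrightarrow> (\<sigma>, \<tau>) \<in> r - Id \<Longrightarrow> u (A \<sigma> - A \<rho>) < u (A \<tau> - A \<sigma>)"
  using type by (auto simp: transcendental_type_def pseudo_cauchy_def)

lemma ev_eqI: "has_eventual_value u r A g y \<Longrightarrow> ev g = y"
  unfolding ev_def by (rule the_eventual_value[OF limit_order])

lemma has_ev: "has_eventual_value u r A g (ev g)"
proof -
  obtain y where "has_eventual_value u r A g y"
    using type by (auto simp: transcendental_type_def)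
  with ev_eqI show ?thesis
    by blast
qed

lemma ev_eventually:
  obtains i where "i \<in> Field r" "\<And>k. (i, k) \<in> r \<Longrightarrow> u (poly g (A k)) = ev g"
  using has_ev[of g] by (auto simp: has_eventual_value_def)

lemma ev_mult: "ev (g * h) = ev g + ev h"
  by (intro ev_eqI has_eventual_value_mult limit_order has_ev)

text \<open>If the value of \<open>A k - b\<close> has settled by the index \<open>i\<close>, a
  later term \<open>A j\<close> is closer to the tail than \<open>b\<close>: the settled value is at
  most that of \<open>A j - A i\<close>, which is below that of \<open>A k - A j\<close>.\<close>

lemma ev_lin_less: "\<exists>b'. ev [:- b, 1:] < ev [:- b', 1:]"
proof -
  obtain i where i: "i \<in> Field r" "\<And>k. (i, k) \<in> r \<Longrightarrow> u (poly [:- b, 1:] (A k)) = ev [:- b, 1:]"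
    using ev_eventually[of "[:- b, 1:]"] by blast
  obtain j where j: "j \<in> Field r" "(i, j) \<in> r - Id"
    using limit_orderD(4)[OF limit_order i(1)] by blast
  obtain l where l: "l \<in> Field r" "\<And>k. (l, k) \<in> r \<Longrightarrow> u (poly [:- A j, 1:] (A k)) = ev [:- A j, 1:]"
    using ev_eventually[of "[:- A j, 1:]"] by blast
  obtain j' where j': "j' \<in> Field r" "(j, j') \<in> r - Id"
    using limit_orderD(4)[OF limit_order j(1)] by blast
  obtain k where k: "(j', k) \<in> r" "(l, k) \<in> r"
    using limit_orderD(3)[OF limit_order j'(1) l(1)] by blast
  have "(j, k) \<in> r - Id"
    by (rule limit_orderD(6)[OF limit_order j'(2) k(1)])
  from pseudo_cauchy[OF j(2) this] have "u (A j - A i) < ev [:- A j, 1:]"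
    using l(2)[OF k(2)] by simp
  moreover have "min (u (A j - b)) (u (A i - b)) \<le> u (A j - A i)"
    using diff[of "A j - b" "A i - b"] by simp
  moreover have "u (A j - b) = ev [:- b, 1:]" "u (A i - b) = ev [:- b, 1:]"
    using i(2)[of j] j(2) i(2)[of i] limit_orderD(1)[OF limit_order i(1)] by auto
  ultimately show ?thesis
    by (auto intro!: exI[of _ "A j"])
qed

lemma ev_const: "ev [:c:] = u c"
  using limit_orderD(5)[OF limit_order] by (intro ev_eqI) (auto simp: has_eventual_value_def)

sublocale ev: poly_val ev
proof
  fix g h
  show "ev (g * h) = ev g + ev h"
    by (rule ev_mult)
  have "ev h \<noteq> Infty" if "h \<noteq> 0" for h
    using that
  proof (induction h rule: alg_closed_poly_induct)
    case (const c)
    then show ?case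
      by (simp add: ev_const)
  next
    case (linear b p)
    \<comment> \<open>Being exceeded by another value, the eventual value of a linear polynomial is
      finite.\<close>
    moreover have "ev [:- b, 1:] \<noteq> Infty"
      using ev_lin_less[of b] by auto
    ultimately show ?case
      by (simp only: ev_mult plus_eq_Infty_iff) simp
  qed
  then show "ev h = Infty \<longleftrightarrow> h = 0"
    using ev_const[of 0] by auto
qed

lemma limit_val_eq: "limit_val u r A = ratfun_val ev"
  unfolding limit_val_def ev_def ..

end

lemma equivalent_limit_val_unbounded:
  fixes w :: "'a::alg_closed_field poly fract \<Rightarrow> 'g::linordered_ab_group_add with_inf"
    and u :: "'a \<Rightarrow> 'h::linordered_ab_group_add with_inf"
  assumes "valuation u" "valuation w" "transcendental_type u r A" "equivalent w (limit_val u r A)"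
  shows "\<exists>b'. w (lin b) < w (lin b')"
proof -
  interpret transcendental_sequence u r A
    using assms by unfold_locales
  obtain b' where "ev [:- b, 1:] < ev [:- b', 1:]"
    using ev_lin_less by blast
  then have "\<not> w (lin b') \<le> w (lin b)"
    using ev.equivalent_le_iff[OF assms(2) assms(4)[unfolded limit_val_eq], of "[:- b', 1:]" "[:- b, 1:]"]
    by simp
  then show ?thesis
    unfolding not_le by (rule exI)
qed

text \<open>
  The sequence is indexed by the record elements of a well-order \<open>r0\<close> of the field, i.e.\ those \<open>b\<close>
  for which \<open>w (lin b)\<close> exceeds all earlier values.
\<close>

lemma unbounded_imp_limit_val:
  fixes w :: "'a::alg_closed_field poly fract \<Rightarrow> 'g::linordered_ab_group_add with_inf"
    and u :: "'a \<Rightarrow> 'h::linordered_ab_group_add with_inf"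
  assumes "valuation w" "valuation u" and equiv: "equivalent u (w \<circ> ratfun_const)"
    and unbounded: "\<And>b. \<exists>b'. w (lin b) < w (lin b')"
  shows "\<exists>(r :: 'a rel) A. transcendental_type u r A \<and> equivalent w (limit_val u r A)"
proof -
  interpret w: valued w
    by (rule valued.intro, fact)
  interpret u: valued u
    by (rule valued.intro, fact)
  interpret j: field_embedding "ratfun_const :: 'a \<Rightarrow> _"
    by (rule field_embedding_ratfun_const)
  have wc: "valuation (w \<circ> ratfun_const)"
    by (rule j.valuation_comp, fact)
  obtain r0 :: "'a rel" where "well_order_on UNIV r0"
    using well_order_on by blast
  then have r0: "Well_order r0" "Field r0 = UNIV"
    using well_order_on_Well_order by blast+
  have r0': "wf (r0 - Id)" "refl r0" "trans r0" "antisym r0" "total r0"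
    using r0 by (auto simp: well_order_on_def linear_order_on_def partial_order_on_def preorder_on_def)
  define D where "D = {b. \<forall>c. (c, b) \<in> r0 - Id \<longrightarrow> w (lin c) < w (lin b)}"
  define r where "r = Restr r0 D"
  have field: "Field r = D"
    using r0'(2) by (auto simp: r_def Field_def refl_on_def)
  have r_iff: "(c, b) \<in> r \<longleftrightarrow> (c, b) \<in> r0 \<and> c \<in> D \<and> b \<in> D" for c b
    by (auto simp: r_def)
  have mono: "w (lin c) < w (lin b)" if "(c, b) \<in> r - Id" for c b
    using that by (auto simp: D_def r_iff)
  have mono': "w (lin c) \<le> w (lin b)" if "(c, b) \<in> r" for c b
    using mono[of c b] that by (cases "c = b") auto
  \<comment> \<open>The first element in the order \<open>r0\<close> whose value reaches that of
    \<open>b\<close> exceeds all earlier ones, so it belongs to \<open>D\<close>.\<close>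
  have cofinal: "\<exists>c\<in>D. w (lin b) \<le> w (lin c)" for b
  proof -
    have "b \<in> {c. w (lin b) \<le> w (lin c)}"
      by simp
    then obtain c where c: "c \<in> {c. w (lin b) \<le> w (lin c)}"
        "\<And>d. (d, c) \<in> r0 - Id \<Longrightarrow> d \<notin> {c. w (lin b) \<le> w (lin c)}"
      using wfE_min[OF r0'(1)] by metis
    then have "c \<in> D"
      by (fastforce simp: D_def)
    with c(1) show ?thesis
      by auto
  qed
  have larger: "\<exists>c\<in>D. w (lin b) < w (lin c)" for b
    using unbounded[of b] cofinal by (meson less_le_trans)
  have "well_order_on D r"
    using Well_order_Restr[OF r0(1), of D] field by (simp add: r_def)
  have limit: "limit_order r"
    unfolding limit_order_def field
  proof (intro conjI ballI)
    show "well_order_on D r"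
      by fact
    show "D \<noteq> {}"
      using cofinal by auto
    show "\<exists>c\<in>D. (b, c) \<in> r - Id" if b: "b \<in> D" for b
    proof -
      obtain c where c: "c \<in> D" "w (lin b) < w (lin c)"
        using larger by blast
      then have "\<not> (c, b) \<in> r - Id" "b \<noteq> c"
        using mono[of c b] by (auto dest: order_less_asym)
      then have "(b, c) \<in> r - Id"
        using r0'(5) b c by (auto simp: r_iff total_on_def)
      with c show ?thesis
        by blast
    qed
  qed
  \<comment> \<open>When \<open>c\<close> is closer to x than \<open>b\<close>, the constant
    \<open>c - b\<close> has the value of x - b. Thus substituting later members of the family for x
    preserves the value of x - b.\<close>
  have diff: "w (ratfun_const (c - b)) = w (lin b)" if "w (lin b) < w (lin c)" for b c
    using w.diff_eq_min[of "lin b" "lin c"] that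
    by (simp only: lin_diff) (simp add: min_def less_imp_le)
  have "u (\<sigma> - \<rho>) < u (\<tau> - \<sigma>)" if *: "(\<rho>, \<sigma>) \<in> r - Id" "(\<sigma>, \<tau>) \<in> r - Id" for \<rho> \<sigma> \<tau>
  proof -
    have "w (ratfun_const (\<sigma> - \<rho>)) < w (ratfun_const (\<tau> - \<sigma>))"
      using mono[OF *(1)] by (simp only: diff[OF mono[OF *(1)]] diff[OF mono[OF *(2)]])
    then show ?thesis
      by (simp add: equivalent_less_iff[OF assms(2) wc equiv])
  qed
  then have cauchy: "pseudo_cauchy u r (\<lambda>x. x)"
    using limit by (simp add: pseudo_cauchy_def)
  \<comment> \<open>For linear factors this is \<open>diff\<close>, and all polynomials
    split.\<close>
  have eventually: "\<exists>i\<in>D. \<forall>k. (i, k) \<in> r \<longrightarrow> w (ratfun_const (poly g k)) = w (to_fract g)" for g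
  proof (cases "g = 0")
    case True
    then show ?thesis
      using cofinal by auto
  next
    case False
    then show ?thesis
    proof (induction g rule: alg_closed_poly_induct)
      case (const c)
      then show ?case
        using cofinal by (auto simp: ratfun_const_def)
    next
      case (linear b p)
      then obtain i where i: "i \<in> D" "\<And>k. (i, k) \<in> r \<Longrightarrow> w (ratfun_const (poly p k)) = w (to_fract p)"
        by blast
      obtain l where l: "l \<in> D" "w (lin b) < w (lin l)"
        using larger by blast
      obtain k where k: "k \<in> D" "(i, k) \<in> r" "(l, k) \<in> r"
        using limit_orderD(3)[OF limit, of i l] i(1) l(1) by (auto simp: field)
      have "w (ratfun_const (poly ([:- b, 1:] * p) m)) = w (to_fract ([:- b, 1:] * p))"
        if m: "(k, m) \<in> r" for m
      proof -
        have "w (lin b) < w (lin m)"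
          using less_le_trans[OF l(2) mono'[OF limit_orderD(2)[OF limit k(3) m]]] .
        then have "w (ratfun_const (m - b)) = w (lin b)"
          by (rule diff)
        moreover have "poly ([:- b, 1:] * p) m = (m - b) * poly p m"
          by (simp add: algebra_simps)
        ultimately show ?thesis
          using i(2)[OF limit_orderD(2)[OF limit k(2) m]]
          by (simp only: j.mult w.mult to_fract_mult)
      qed
      with k(1) show ?case
        by blast
    qed
  qed
  have "\<exists>y. has_eventual_value u r (\<lambda>x. x) g y" for g
  proof -
    obtain i where i: "i \<in> D" "\<And>k. (i, k) \<in> r \<Longrightarrow> w (ratfun_const (poly g k)) = w (to_fract g)"
      using eventually by blast
    have "u (poly g k) = u (poly g i)" if "(i, k) \<in> r" for k
      using i that limit_orderD(1)[OF limit, of i]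
      by (simp add: equivalent_eq_iff[OF assms(2) wc equiv] field)
    then show ?thesis
      using i(1) by (auto simp: has_eventual_value_def field)
  qed
  then have type: "transcendental_type u r (\<lambda>x. x)"
    using cauchy by (simp add: transcendental_type_def)
  then interpret transcendental_sequence u r "\<lambda>x. x"
    by unfold_locales
  have "0 \<le> w z \<longleftrightarrow> 0 \<le> limit_val u r (\<lambda>x. x) z" for z
  proof -
    obtain g h where gh: "h \<noteq> 0" "z = to_fract g / to_fract h"
      by (rule ratfun_cases[of z])
    obtain i where i: "i \<in> D" "\<And>k. (i, k) \<in> r \<Longrightarrow> w (ratfun_const (poly g k)) = w (to_fract g)"
      using eventually by blast
    obtain i' where i': "i' \<in> D" "\<And>k. (i', k) \<in> r \<Longrightarrow> w (ratfun_const (poly h k)) = w (to_fract h)"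
      using eventually by blast
    obtain l where l: "l \<in> Field r" "\<And>k. (l, k) \<in> r \<Longrightarrow> u (poly g k) = ev g"
      using ev_eventually[of g] by blast
    obtain l' where l': "l' \<in> Field r" "\<And>k. (l', k) \<in> r \<Longrightarrow> u (poly h k) = ev h"
      using ev_eventually[of h] by blast
    obtain k1 where k1: "k1 \<in> Field r" "(i, k1) \<in> r" "(i', k1) \<in> r"
      using limit_orderD(3)[OF limit, of i i'] i(1) i'(1) by (auto simp: field)
    obtain k2 where k2: "k2 \<in> Field r" "(l, k2) \<in> r" "(l', k2) \<in> r"
      using limit_orderD(3)[OF limit l(1) l'(1)] by auto
    \<comment> \<open>Beyond all thresholds, both \<open>w\<close> and \<open>ev\<close> give
      \<open>g\<close> and \<open>h\<close> the values of the constants \<open>poly g k\<close> and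
      \<open>poly h k\<close>, which the equivalence on the field of constants compares.\<close>
    obtain k where k: "(k1, k) \<in> r" "(k2, k) \<in> r"
      using limit_orderD(3)[OF limit k1(1) k2(1)] by auto
    note tr = limit_orderD(2)[OF limit]
    have "0 \<le> w z \<longleftrightarrow> w (to_fract h) \<le> w (to_fract g)"
      using gh w.le_iff_divide[of "to_fract h" "to_fract g"] by simp
    also have "\<dots> \<longleftrightarrow> w (ratfun_const (poly h k)) \<le> w (ratfun_const (poly g k))"
      using i(2)[OF tr[OF k1(2) k(1)]] i'(2)[OF tr[OF k1(3) k(1)]] by simp
    also have "\<dots> \<longleftrightarrow> ev h \<le> ev g"
      using l(2)[OF tr[OF k2(2) k(2)]] l'(2)[OF tr[OF k2(3) k(2)]]
        equivalent_le_iff[OF assms(2) wc equiv, of "poly h k" "poly g k"] by simp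
    also have "\<dots> \<longleftrightarrow> 0 \<le> limit_val u r (\<lambda>x. x) z"
      using gh by (simp add: limit_val_eq ev.ratfun_val_divide with_inf_le_minus_iff ev.eq_Infty_iff)
    finally show ?thesis .
  qed
  then have "equivalent w (limit_val u r (\<lambda>x. x))"
    by (auto simp: equivalent_def valuation_ring_def)
  with type show ?thesis
    by blast
qed

section \<open>Rational rank and value groups\<close>

context comm_group
begin

lemma finprod_single_power:
  fixes k :: int
  assumes "finite B" "B \<subseteq> carrier G" "b \<in> B"
  shows "finprod G (\<lambda>x. x [^] (if x = b then k else 0)) B = b [^] k"
proof -
  have "finprod G (\<lambda>x. x [^] (if x = b then k else 0)) B = finprod G (\<lambda>x. if b = x then x [^] k else \<one>) B"
    using assms by (intro finprod_cong') (auto intro: int_pow_closed)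
  also have "\<dots> = b [^] k"
    using assms by (subst finprod_singleton) (auto intro: int_pow_closed)
  finally show ?thesis .
qed

text \<open>The relation extends to all of \<open>B\<close> with exponent 0 at the other
  elements.\<close>

lemma rationally_independent_pair:
  fixes k l :: int
  assumes ind: "rationally_independent G B" and B: "finite B" "B \<subseteq> carrier G"
    and ab: "a \<in> B" "b \<in> B" "a \<noteq> b" and eq: "a [^] k \<otimes> b [^] l = \<one>"
  shows "k = 0" "l = 0"
proof -
  define c where "c = (\<lambda>x. (if x = a then k else 0) + (if x = b then l else 0))"
  have "finprod G (\<lambda>x. x [^] c x) B =
      finprod G (\<lambda>x. x [^] (if x = a then k else 0) \<otimes> x [^] (if x = b then l else 0)) B"
    using B by (intro finprod_cong') (auto simp: c_def int_pow_mult)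
  also have "\<dots> = \<one>"
    using B ab eq by (subst finprod_multf) (auto simp: finprod_single_power intro: int_pow_closed)
  finally have "\<forall>b\<in>B. c b = 0"
    using ind by (simp add: rationally_independent_def)
  with ab show "k = 0" "l = 0"
    by (auto simp: c_def split: if_splits)
qed

text \<open>Some positive power of each element lies in the group generated by \<open>t\<close>, so
  no two elements are independent. The exponents \<open>m\<close> and \<open>n\<close> stand on
  separate sides because in the application they belong to powers in a numerator and in a
  denominator.\<close>

lemma rational_rank_eq_1I:
  assumes t: "t \<in> carrier G" "\<And>n::nat. n > 0 \<Longrightarrow> t [^] n \<noteq> \<one>"
    and gen: "\<And>b. b \<in> carrier G \<Longrightarrow> \<exists>(N::nat) (m::nat) (n::nat). N > 0 \<and> b [^] N \<otimes> t [^] m = t [^] n"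
  shows "rational_rank G = 1"
proof -
  have t_int: "k = 0" if "t [^] k = \<one>" for k :: int
  proof (rule ccontr)
    assume "k \<noteq> 0"
    have "t [^] nat \<bar>k\<bar> = \<one>"
    proof (cases "k < 0")
      case True
      then have "inv (t [^] nat (- k)) = \<one>"
        using that by (simp only: int_pow_def2 if_True)
      then have "t [^] nat (- k) = \<one>"
        using t(1) by (subst (asm) inv_eq_1_iff) auto
      with True show ?thesis
        by simp
    next
      case False
      then have "t [^] nat k = \<one>"
        using that by (simp only: int_pow_def2 if_False)
      with False show ?thesis
        by simp
    qed
    with t(2)[of "nat \<bar>k\<bar>"] \<open>k \<noteq> 0\<close> show False
      by simp
  qed
  have gen': "\<exists>(N::int) (k::int). N > 0 \<and> b [^] N = t [^] k" if b: "b \<in> carrier G" for b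
  proof -
    obtain N m n :: nat where N: "N > 0" "b [^] N \<otimes> t [^] m = t [^] n"
      using gen[OF b] by blast
    have "b [^] N = b [^] N \<otimes> t [^] m \<otimes> inv (t [^] m)"
      using b t(1) by (simp add: m_assoc)
    then have "b [^] N = t [^] n \<otimes> inv (t [^] m)"
      unfolding N(2) .
    then have "b [^] int N = t [^] (int n - int m)"
      using int_pow_diff[OF t(1), of "int n" "int m"] by (simp only: int_pow_int)
    then show ?thesis
      using N(1) by (intro exI[of _ "int N"] exI[of _ "int n - int m"]) auto
  qed
  define S where "S = {enat (card B) | B. finite B \<and> B \<subseteq> carrier G \<and> rationally_independent G B}"
  have "rationally_independent G {t}"
    unfolding rationally_independent_def using t(1) t_int by (auto simp: finprod_insert int_pow_closed)
  then have "1 \<in> S"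
    using t(1) by (auto simp: S_def one_enat_def intro!: exI[of _ "{t}"])
  have "s \<le> 1" if s: "s \<in> S" for s
  proof -
    obtain B where B: "s = enat (card B)" "finite B" "B \<subseteq> carrier G" "rationally_independent G B"
      using s by (auto simp: S_def)
    have "card B \<le> 1"
    proof (rule ccontr)
      assume "\<not> card B \<le> 1"
      then obtain a b where ab: "a \<in> B" "b \<in> B" "a \<noteq> b"
        using B(2) by (metis One_nat_def card_le_Suc0_iff_eq)
      then have carr: "a \<in> carrier G" "b \<in> carrier G"
        using B(3) by auto
      obtain M k N l :: int where *: "M > 0" "a [^] M = t [^] k" "N > 0" "b [^] N = t [^] l"
        using gen'[OF carr(1)] gen'[OF carr(2)] by blast
      \<comment> \<open>The powers of \<open>t\<close> that \<open>a\<close> and \<open>b\<close>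
        reach are raised to a common one and cancelled. Independence then forces
        \<open>l = 0\<close>, which leaves a relation on \<open>b\<close> alone.\<close>
      have "a [^] (M * l) \<otimes> b [^] (N * - k) = (a [^] M) [^] l \<otimes> (b [^] N) [^] (- k)"
        using carr by (simp add: int_pow_pow)
      also have "\<dots> = \<one>"
        using t(1) by (simp add: * int_pow_pow int_pow_neg mult.commute)
      finally have "M * l = 0"
        by (rule rationally_independent_pair[OF B(4,2,3) ab])
      then have "b [^] N \<otimes> a [^] (0::int) = \<one>"
        using * carr t(1) by auto
      then have "N = 0"
        by (rule rationally_independent_pair(1)[OF B(4,2,3) ab(2,1) ab(3)[symmetric]])
      with * show False
        by simp
    qed
    then show ?thesis
      using B(1) by (simp add: one_enat_def)
  qed
  then have "Sup S = 1"
    using \<open>1 \<in> S\<close> by (intro antisym Sup_least Sup_upper) auto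
  then show ?thesis
    by (simp add: rational_rank_def S_def)
qed

text \<open>A torsion element gives a nontrivial relation on every finite set containing it, so only
  the empty set is independent and the rank is 0.\<close>

lemma torsion_imp_rational_rank_neq_1:
  assumes "torsion_group G"
  shows "rational_rank G \<noteq> 1"
proof -
  have "B = {}" if B: "finite B" "B \<subseteq> carrier G" "rationally_independent G B" for B
  proof (rule ccontr)
    assume "B \<noteq> {}"
    then obtain b where b: "b \<in> B"
      by blast
    then obtain n :: nat where n: "n > 0" "b [^] n = \<one>"
      using assms B(2) by (auto simp: torsion_group_def)
    have "finprod G (\<lambda>x. x [^] (if x = b then int n else 0)) B = \<one>"
      using finprod_single_power[OF B(1,2) b, of "int n"] n by (simp add: int_pow_int)
    then have "\<forall>x\<in>B. (if x = b then int n else 0) = 0"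
      by (rule B(3)[unfolded rationally_independent_def, THEN spec, THEN mp])
    with b n show False
      by auto
  qed
  then have "rational_rank G \<le> 0"
    unfolding rational_rank_def by (intro Sup_least) (auto simp: zero_enat_def)
  then show ?thesis
    by auto
qed

end

section \<open>Value groups of a field extension\<close>

locale valued_extension = h: field_embedding \<iota> + valued w
  for \<iota> :: "'a::field \<Rightarrow> 'b::field" and w :: "'b \<Rightarrow> 'g::linordered_ab_group_add with_inf"
begin

text \<open>Unspecified at 0, where the value is infinite. It moves finite values from
  \<open>with_inf\<close> into the group.\<close>

definition value_of :: "'b \<Rightarrow> 'g" where
  "value_of z = (case w z of Fin g \<Rightarrow> g)"

lemma value_of: "z \<noteq> 0 \<Longrightarrow> w z = Fin (value_of z)"
  using eq_Infty_iff[of z] by (cases "w z") (simp_all add: value_of_def)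

lemma value_of_mult: "y \<noteq> 0 \<Longrightarrow> z \<noteq> 0 \<Longrightarrow> value_of (y * z) = value_of y + value_of z"
  using value_of[of "y * z"] value_of[of y] value_of[of z] by (simp add: mult)

lemma carrier_value_group: "carrier (value_group w) = value_of ` (UNIV - {0})"
proof -
  have "g \<in> value_of ` (UNIV - {0})" if "w z = Fin g" for z g
  proof -
    have "z \<noteq> 0"
      using that by auto
    with that value_of[of z] have "g = value_of z"
      by simp
    with \<open>z \<noteq> 0\<close> show ?thesis
      by blast
  qed
  then show ?thesis
    using value_of by (auto simp: value_group_def)
qed

lemma comm_group_value_group: "comm_group (value_group w)"
proof (rule comm_groupI)
  fix x y assume "x \<in> carrier (value_group w)" "y \<in> carrier (value_group w)"
  then show "x \<otimes>\<^bsub>value_group w\<^esub> y \<in> carrier (value_group w)"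
    unfolding carrier_value_group by (auto simp: value_group_def simp flip: value_of_mult)
next
  show "\<one>\<^bsub>value_group w\<^esub> \<in> carrier (value_group w)"
    using one by (auto simp: value_group_def zero_with_inf_def simp del: one)
next
  fix x assume "x \<in> carrier (value_group w)"
  then obtain z where z: "z \<noteq> 0" "x = value_of z"
    by (auto simp: carrier_value_group)
  then have "value_of (inverse z) + value_of z = 0"
    using inverse[OF z(1)] by (simp add: value_of zero_with_inf_def add.commute)
  then show "\<exists>y\<in>carrier (value_group w). y \<otimes>\<^bsub>value_group w\<^esub> x = \<one>\<^bsub>value_group w\<^esub>"
    using z unfolding carrier_value_group by (auto simp: value_group_def)
qed (auto simp: value_group_def ac_simps)

definition coset_of :: "'b \<Rightarrow> 'g set" where
  "coset_of z = carrier (value_group (w \<circ> \<iota>)) #>\<^bsub>value_group w\<^esub> value_of z"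

lemma subgroup_value_group: "subgroup (carrier (value_group (w \<circ> \<iota>))) (value_group w)"
proof -
  \<comment> \<open>With the identity as embedding, the restriction of \<open>w\<close> is another
    instance of the locale, so its values form a group too.\<close>
  interpret e: valued_extension id "w \<circ> \<iota>"
    using h.valuation_comp[OF valuation] by unfold_locales auto
  interpret G: comm_group "value_group w"
    by (rule comm_group_value_group)
  interpret H: comm_group "value_group (w \<circ> \<iota>)"
    by (rule e.comm_group_value_group)
  show ?thesis
  proof (rule G.subgroupI)
    fix x assume x: "x \<in> carrier (value_group (w \<circ> \<iota>))"
    obtain y where y: "y \<in> carrier (value_group (w \<circ> \<iota>))" "y + x = 0"
      using H.l_inv_ex[OF x] by (auto simp: value_group_def)
    have sub: "z \<in> carrier (value_group w)" if "z \<in> carrier (value_group (w \<circ> \<iota>))" for z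
      using that by (auto simp: value_group_def)
    have "inv\<^bsub>value_group w\<^esub> x = y"
      using sub x y by (intro G.inv_equality) (auto simp: value_group_def)
    with y show "inv\<^bsub>value_group w\<^esub> x \<in> carrier (value_group (w \<circ> \<iota>))"
      by simp
  next
    fix x y assume "x \<in> carrier (value_group (w \<circ> \<iota>))" "y \<in> carrier (value_group (w \<circ> \<iota>))"
    from H.m_closed[OF this] show "x \<otimes>\<^bsub>value_group w\<^esub> y \<in> carrier (value_group (w \<circ> \<iota>))"
      by (simp add: value_group_def)
  qed (use H.one_closed in \<open>auto simp: value_group_def\<close>)
qed

abbreviation Q :: "'g set monoid" where
  "Q \<equiv> value_group_quotient \<iota> w"

lemma normal_value_group: "carrier (value_group (w \<circ> \<iota>)) \<lhd> value_group w"
  using comm_group.normal_iff_subgroup[OF comm_group_value_group] subgroup_value_group by blast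

lemma comm_group_quotient: "comm_group Q"
  unfolding value_group_quotient_def
  by (rule comm_group.abelian_FactGroup[OF comm_group_value_group subgroup_value_group])

lemma carrier_quotient: "carrier Q = coset_of ` (UNIV - {0})"
  unfolding value_group_quotient_def carrier_FactGroup carrier_value_group coset_of_def by auto

lemma coset_of_in_carrier: "z \<noteq> 0 \<Longrightarrow> coset_of z \<in> carrier Q"
  by (auto simp: carrier_quotient)

lemma coset_of_mult: "y \<noteq> 0 \<Longrightarrow> z \<noteq> 0 \<Longrightarrow> coset_of y \<otimes>\<^bsub>Q\<^esub> coset_of z = coset_of (y * z)"
  unfolding coset_of_def value_group_quotient_def mult_FactGroup
  by (subst normal.rcos_sum[OF normal_value_group])
    (simp_all add: carrier_value_group value_of_mult value_group_def[of w, THEN arg_cong[of _ _ monoid.mult]])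

lemma coset_of_eq_one_iff:
  assumes "z \<noteq> 0"
  shows "coset_of z = \<one>\<^bsub>Q\<^esub> \<longleftrightarrow> (\<exists>c. c \<noteq> 0 \<and> w z = w (\<iota> c))"
proof -
  interpret G: comm_group "value_group w"
    by (rule comm_group_value_group)
  have carr: "value_of z \<in> carrier (value_group w)"
    using assms by (auto simp: carrier_value_group)
  have "coset_of z = \<one>\<^bsub>Q\<^esub> \<longleftrightarrow> value_of z \<in> carrier (value_group (w \<circ> \<iota>))"
    unfolding coset_of_def value_group_quotient_def one_FactGroup
    using G.coset_join1[OF _ carr subgroup_value_group] G.coset_join2[OF carr subgroup_value_group] by blast
  also have "\<dots> \<longleftrightarrow> (\<exists>c. w (\<iota> c) = Fin (value_of z))"
    by (simp add: value_group_def)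
  also have "\<dots> \<longleftrightarrow> (\<exists>c. c \<noteq> 0 \<and> w z = w (\<iota> c))"
    using value_of[OF assms] by (metis eq_Infty_iff h.eq_0_iff assms)
  finally show ?thesis .
qed

lemma coset_of_one: "coset_of 1 = \<one>\<^bsub>Q\<^esub>"
  using coset_of_eq_one_iff[of 1] h.one by (metis one_neq_zero)

lemma coset_of_power: "z \<noteq> 0 \<Longrightarrow> coset_of z [^]\<^bsub>Q\<^esub> n = coset_of (z ^ n)"
proof (induction n)
  case 0
  then show ?case
    by (simp add: coset_of_one)
next
  case (Suc n)
  then show ?case
    by (simp add: coset_of_mult power_Suc2 del: power_Suc)
qed

lemma torsion_quotient_iff:
  "torsion_group Q \<longleftrightarrow> (\<forall>z. z \<noteq> 0 \<longrightarrow> (\<exists>n c. n > 0 \<and> c \<noteq> 0 \<and> w (z ^ n) = w (\<iota> c)))"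
  unfolding torsion_group_def carrier_quotient
  by (auto simp: coset_of_power coset_of_eq_one_iff)

lemma coset_of_cong: "y \<noteq> 0 \<Longrightarrow> z \<noteq> 0 \<Longrightarrow> w y = w z \<Longrightarrow> coset_of y = coset_of z"
  by (simp add: coset_of_def value_of)

end

section \<open>Residue fields\<close>

context valued_extension
begin

definition R0 :: "'b ring" where
  "R0 = ring_of_type_algebra\<lparr>carrier := valuation_ring w\<rparr>"

definition residue :: "'b \<Rightarrow> 'b set" where
  "residue z = {a. 0 < w a} +>\<^bsub>R0\<^esub> z"

abbreviation F :: "'b set ring" where
  "F \<equiv> residue_field w"

abbreviation k0 :: "'b set set" where
  "k0 \<equiv> residue_subfield \<iota> w"

lemma R0_simps [simp]:
  "carrier R0 = {a. 0 \<le> w a}" "a \<otimes>\<^bsub>R0\<^esub> b = a * b" "a \<oplus>\<^bsub>R0\<^esub> b = a + b" "\<one>\<^bsub>R0\<^esub> = 1" "\<zero>\<^bsub>R0\<^esub> = 0"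
  by (simp_all add: R0_def ring_of_type_algebra_def valuation_ring_def)

lemma cring_R0: "cring R0"
proof (rule cringI)
  show "abelian_group R0"
  proof (rule abelian_groupI)
    fix x assume "x \<in> carrier R0"
    then show "\<exists>y\<in>carrier R0. y \<oplus>\<^bsub>R0\<^esub> x = \<zero>\<^bsub>R0\<^esub>"
      by (intro bexI[of _ "- x"]) auto
  qed (auto simp: add_nonneg ac_simps)
  show "comm_monoid R0"
    by (rule comm_monoidI) (auto simp: mult_nonneg ac_simps)
qed (simp add: distrib_right)

lemma a_inv_R0:
  assumes "0 \<le> w a"
  shows "\<ominus>\<^bsub>R0\<^esub> a = - a"
proof -
  interpret cring R0
    by (rule cring_R0)
  show ?thesis
    using assms by (intro minus_equality) auto
qed

lemma maximalideal_R0: "maximalideal {a. 0 < w a} R0"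
proof (rule maximalidealI)
  interpret R: cring R0
    by (rule cring_R0)
  show "ideal {a. 0 < w a} R0"
  proof (rule idealI)
    show "subgroup {a. 0 < w a} (add_monoid R0)"
    proof (rule R.add.subgroupI)
      fix x assume "x \<in> {a. 0 < w a}"
      then show "\<ominus>\<^bsub>R0\<^esub> x \<in> {a. 0 < w a}"
        by (simp add: a_inv_R0 less_imp_le)
    qed (auto simp: add_pos intro: exI[of _ 0] less_imp_le)
    show "x \<otimes>\<^bsub>R0\<^esub> a \<in> {a. 0 < w a}" if "a \<in> {a. 0 < w a}" "x \<in> carrier R0" for a x
      using that mult_pos[of a x] by (simp add: mult.commute)
    show "a \<otimes>\<^bsub>R0\<^esub> x \<in> {a. 0 < w a}" if "a \<in> {a. 0 < w a}" "x \<in> carrier R0" for a x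
      using that mult_pos[of a x] by simp
  qed (rule R.ring_axioms)
  have "1 \<in> carrier R0" "1 \<notin> {a. 0 < w a}"
    by auto
  then show "carrier R0 \<noteq> {a. 0 < w a}"
    by blast
  fix J assume J: "ideal J R0" "{a. 0 < w a} \<subseteq> J" "J \<subseteq> carrier R0"
  interpret J: ideal J R0
    by fact
  show "J = {a. 0 < w a} \<or> J = carrier R0"
  proof (rule disjCI)
    assume "J \<noteq> carrier R0"
    have "0 < w a" if a: "a \<in> J" for a
    proof (rule ccontr)
      assume "\<not> 0 < w a"
      then have wa: "w a = 0"
        using J(3) a by (auto simp: order_le_less)
      then have "a \<noteq> 0"
        by auto
      with wa have "w (inverse a) = 0"
        using inverse[of a] by simp
      then have "inverse a \<otimes>\<^bsub>R0\<^esub> a \<in> J"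
        by (intro J.I_l_closed[OF a]) simp
      then have "\<one>\<^bsub>R0\<^esub> \<in> J"
        using \<open>a \<noteq> 0\<close> by simp
      with \<open>J \<noteq> carrier R0\<close> J.one_imp_carrier show False
        by blast
    qed
    with J(2) show "J = {a. 0 < w a}"
      by blast
  qed
qed

lemma F_eq: "F = R0 Quot {a. 0 < w a}"
  by (simp add: residue_field_def R0_def)

lemma field_F: "field F"
  unfolding F_eq by (rule maximalideal.quotient_is_field[OF maximalideal_R0 cring_R0])

sublocale F: field F
  by (rule field_F)

lemma ideal_R0: "ideal {a. 0 < w a} R0"
  using maximalideal_R0 by (rule maximalideal.axioms)

lemma carrier_F: "carrier F = residue ` {a. 0 \<le> w a}"
  unfolding F_eq FactRing_def A_RCOSETS_def' residue_def by auto

lemma residue_in_carrier: "0 \<le> w z \<Longrightarrow> residue z \<in> carrier F"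
  by (auto simp: carrier_F)

lemma residue_hom: "residue \<in> ring_hom R0 F"
  using ideal.rcos_ring_hom[OF ideal_R0] unfolding F_eq residue_def[abs_def] .

lemma residue_mult: "0 \<le> w y \<Longrightarrow> 0 \<le> w z \<Longrightarrow> residue (y * z) = residue y \<otimes>\<^bsub>F\<^esub> residue z"
  using ring_hom_mult[OF residue_hom, of y z] by simp

lemma residue_add: "0 \<le> w y \<Longrightarrow> 0 \<le> w z \<Longrightarrow> residue (y + z) = residue y \<oplus>\<^bsub>F\<^esub> residue z"
  using ring_hom_add[OF residue_hom, of y z] by simp

lemma residue_one: "residue 1 = \<one>\<^bsub>F\<^esub>"
  using ring_hom_one[OF residue_hom] by simp

lemma residue_eq_zero_iff:
  assumes "0 \<le> w z"
  shows "residue z = \<zero>\<^bsub>F\<^esub> \<longleftrightarrow> 0 < w z"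
proof -
  interpret R: cring R0
    by (rule cring_R0)
  have "\<zero>\<^bsub>F\<^esub> = {a. 0 < w a}"
    by (simp add: F_eq FactRing_def)
  moreover have "residue z = {a. 0 < w a} \<Longrightarrow> z \<in> {a. 0 < w a}"
    unfolding residue_def using assms by (intro ideal.rcos_const_imp_mem[OF ideal_R0]) auto
  moreover have "z \<in> {a. 0 < w a} \<Longrightarrow> residue z = {a. 0 < w a}"
    unfolding residue_def by (rule R.a_rcos_zero[OF ideal_R0])
  ultimately show ?thesis
    by auto
qed

lemma residue_minus: "0 \<le> w z \<Longrightarrow> residue (- z) = \<ominus>\<^bsub>F\<^esub> residue z"
  using residue_add[of "- z" z] residue_eq_zero_iff[of 0] F.minus_equality[of "residue (- z)" "residue z"]
  by (simp add: residue_in_carrier)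

lemma residue_inverse:
  assumes "w z = 0"
  shows "residue (inverse z) = inv\<^bsub>F\<^esub> residue z"
proof -
  have "z \<noteq> 0"
    using assms by auto
  moreover from this have "w (inverse z) = 0"
    using assms inverse[of z] by simp
  ultimately have "residue (inverse z) \<otimes>\<^bsub>F\<^esub> residue z = \<one>\<^bsub>F\<^esub>"
    using assms by (simp add: residue_one flip: residue_mult)
  then show ?thesis
    using assms \<open>w (inverse z) = 0\<close> F.m_comm[of "residue z" "residue (inverse z)"]
    by (intro F.comm_inv_char[symmetric]) (auto simp: residue_in_carrier)
qed

lemma residue_cong:
  assumes "0 \<le> w y" "0 < w (z - y)"
  shows "residue z = residue y"
proof -
  have "residue (y + (z - y)) = residue y \<oplus>\<^bsub>F\<^esub> residue (z - y)"
    using assms by (intro residue_add) auto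
  also have "residue (z - y) = \<zero>\<^bsub>F\<^esub>"
    using assms by (subst residue_eq_zero_iff) auto
  finally show ?thesis
    using assms by (simp add: residue_in_carrier)
qed

lemma residue_power: "0 \<le> w z \<Longrightarrow> residue (z ^ n) = residue z [^]\<^bsub>F\<^esub> n"
proof (induction n)
  case (Suc n)
  moreover have "0 \<le> w (z ^ n)" for n
    using Suc.prems by (induction n) (auto intro: mult_nonneg)
  ultimately show ?case
    by (simp add: residue_mult F.m_comm residue_in_carrier)
qed (simp add: residue_one)

lemma k0_eq: "k0 = (\<lambda>c. residue (\<iota> c)) ` {c. 0 \<le> w (\<iota> c)}"
  unfolding residue_subfield_def residue_def R0_def valuation_ring_def by auto

lemma subfield_k0: "subfield k0 F"
proof (rule F.subfieldI')
  show "subring k0 F"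
  proof (rule F.subringI)
    show "k0 \<subseteq> carrier F"
      by (auto simp: k0_eq residue_in_carrier)
    show "\<one>\<^bsub>F\<^esub> \<in> k0"
      unfolding k0_eq by (rule image_eqI[of _ _ 1]) (auto simp: h.one residue_one)
    show "\<ominus>\<^bsub>F\<^esub> x \<in> k0" if x: "x \<in> k0" for x
    proof -
      obtain c where "x = residue (\<iota> c)" "0 \<le> w (\<iota> c)"
        using x by (auto simp: k0_eq)
      then show ?thesis
        unfolding k0_eq by (intro image_eqI[of _ _ "- c"]) (auto simp: h.minus residue_minus)
    qed
    show "x \<otimes>\<^bsub>F\<^esub> y \<in> k0" "x \<oplus>\<^bsub>F\<^esub> y \<in> k0" if xy: "x \<in> k0" "y \<in> k0" for x y
    proof -
      obtain c d where *: "x = residue (\<iota> c)" "0 \<le> w (\<iota> c)" "y = residue (\<iota> d)" "0 \<le> w (\<iota> d)"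
        using xy by (auto simp: k0_eq)
      show "x \<otimes>\<^bsub>F\<^esub> y \<in> k0"
        using * unfolding k0_eq
        by (intro image_eqI[of _ _ "c * d"]) (simp_all add: h.mult residue_mult mult_nonneg)
      show "x \<oplus>\<^bsub>F\<^esub> y \<in> k0"
        using * unfolding k0_eq
        by (intro image_eqI[of _ _ "c + d"]) (simp_all add: h.add residue_add add_nonneg)
    qed
  qed
  show "inv\<^bsub>F\<^esub> x \<in> k0" if x: "x \<in> k0 - {\<zero>\<^bsub>F\<^esub>}" for x
  proof -
    obtain c where c: "x = residue (\<iota> c)" "0 \<le> w (\<iota> c)"
      using x by (auto simp: k0_eq)
    then have wc: "w (\<iota> c) = 0"
      using x by (auto simp: residue_eq_zero_iff order_le_less)
    then have "c \<noteq> 0"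
      by auto
    then have "w (\<iota> (inverse c)) = 0"
      using wc inverse[of "\<iota> c"] by (simp add: h.inverse)
    then show ?thesis
      unfolding k0_eq c using wc
      by (intro image_eqI[of _ _ "inverse c"]) (simp_all add: h.inverse residue_inverse)
  qed
qed

text \<open>Polynomials as lists for \<open>F.eval\<close> have the leading coefficient first, hence
  \<open>rev\<close>. Evaluation commutes with reduction because \<open>residue\<close> is a
  homomorphism.\<close>

lemma eval_residue:
  assumes "set xs \<subseteq> {a. 0 \<le> w a}" "0 \<le> w z"
  shows "0 \<le> w (poly (Poly (rev xs)) z) \<and> F.eval (map residue xs) (residue z) = residue (poly (Poly (rev xs)) z)"
  using assms(1)
proof (induction xs)
  case Nil
  then show ?case
    using residue_eq_zero_iff[of 0] by simp
next
  case (Cons a xs)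
  have nonneg: "0 \<le> w (z ^ n)" for n
    using assms(2) by (induction n) (auto intro: mult_nonneg)
  have "poly (Poly (rev (a # xs))) z = a * z ^ length xs + poly (Poly (rev xs)) z"
    by (simp add: Poly_append poly_monom)
  then show ?case
    using Cons nonneg[of "length xs"] assms(2)
    by (simp add: residue_add residue_mult residue_power add_nonneg mult_nonneg)
qed

lemma normalize_neq_Nil: "x \<in> set xs \<Longrightarrow> x \<noteq> \<zero>\<^bsub>F\<^esub> \<Longrightarrow> F.normalize xs \<noteq> []"
  by (induction xs) auto

text \<open>Reducing the coefficients of \<open>p\<close> gives the equation. The unit coefficient
  keeps the reduced polynomial from vanishing, but its leading coefficients may vanish, hence
  \<open>normalize\<close>.\<close>

lemma residue_algebraicI:
  assumes z: "0 \<le> w z" and p: "\<And>i. 0 \<le> w (\<iota> (Polynomial.coeff p i))" "w (\<iota> (Polynomial.coeff p j)) = 0"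
    and root: "0 < w (poly (map_poly \<iota> p) z)"
  shows "(F.algebraic over k0) (residue z)"
proof -
  define xs where "xs = rev (coeffs (map_poly \<iota> p))"
  have "set xs \<subseteq> {\<iota> c | c. 0 \<le> w (\<iota> c)}"
    using p(1) by (auto simp: xs_def coeffs_def coeff_map_poly split: if_splits)
  then have xs: "set xs \<subseteq> {a. 0 \<le> w a}" "set (map residue xs) \<subseteq> k0"
    by (auto simp: k0_eq)
  have sub: "k0 \<subseteq> carrier F"
    by (auto simp: k0_eq residue_in_carrier)
  have "Polynomial.coeff p j \<noteq> 0"
    using p(2) by auto
  then have nz: "Polynomial.coeff (map_poly \<iota> p) j \<noteq> 0"
    by (simp add: coeff_map_poly)
  then have "map_poly \<iota> p \<noteq> 0"
    by (metis coeff_0)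
  from coeff_in_coeffs[OF this le_degree[OF nz]] have "\<iota> (Polynomial.coeff p j) \<in> set xs"
    by (simp add: xs_def coeff_map_poly)
  then have "F.normalize (map residue xs) \<noteq> []"
    using p(2) residue_eq_zero_iff[of "\<iota> (Polynomial.coeff p j)"]
    by (intro normalize_neq_Nil[of "residue (\<iota> (Polynomial.coeff p j))"]) auto
  moreover have "F.normalize (map residue xs) \<in> carrier (k0[X]\<^bsub>F\<^esub>)"
    using F.normalize_gives_polynomial[OF xs(2)] by (simp add: univ_poly_def)
  moreover have "F.eval (F.normalize (map residue xs)) (residue z) = \<zero>\<^bsub>F\<^esub>"
    using xs sub residue_in_carrier[OF z] eval_residue[OF xs(1) z] root residue_eq_zero_iff
    by (subst F.eval_normalize) (auto simp: xs_def)
  ultimately show ?thesis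
    unfolding over_def by (intro F.algebraicI[unfolded over_def])
qed

text \<open>Coefficients are lifted one by one. The leading one is nonzero in the residue field, so
  its lift has value 0.\<close>

lemma residue_algebraicE:
  assumes z: "0 \<le> w z" and alg: "(F.algebraic over k0) (residue z)"
  obtains p where "p \<noteq> 0" "w (\<iota> (Polynomial.lead_coeff p)) = 0" "0 < w (poly (map_poly \<iota> p) z)"
proof -
  obtain P where P: "P \<in> carrier (k0[X]\<^bsub>F\<^esub>)" "P \<noteq> []" "F.eval P (residue z) = \<zero>\<^bsub>F\<^esub>"
    using F.algebraicE[OF subfieldE(1)[OF subfield_k0] residue_in_carrier[OF z] alg] by blast
  then have P': "set P \<subseteq> k0" "hd P \<noteq> \<zero>\<^bsub>F\<^esub>"
    by (auto simp: univ_poly_def polynomial_def)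
  then have "\<forall>x\<in>set P. \<exists>c. 0 \<le> w (\<iota> c) \<and> residue (\<iota> c) = x"
    by (auto simp: k0_eq)
  then obtain f where f: "\<And>x. x \<in> set P \<Longrightarrow> 0 \<le> w (\<iota> (f x)) \<and> residue (\<iota> (f x)) = x"
    by metis
  define cs where "cs = map f P"
  have cs: "map residue (map \<iota> cs) = P" "\<And>c. c \<in> set cs \<Longrightarrow> 0 \<le> w (\<iota> c)" "cs \<noteq> []"
    using f P(2) by (auto simp: cs_def o_def intro!: map_idI)
  have "hd P = residue (\<iota> (hd cs))" "0 \<le> w (\<iota> (hd cs))"
    using cs(1)[symmetric] cs(2)[of "hd cs"] cs(3) by (auto simp: hd_map)
  then have lead: "w (\<iota> (hd cs)) = 0"
    using P'(2) by (auto simp: residue_eq_zero_iff order_le_less)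
  then have "last (rev cs) \<noteq> 0"
    using cs(3) by (auto simp: last_rev)
  define p where "p = Poly (rev cs)"
  have coeffs: "coeffs p = rev cs"
    using \<open>last (rev cs) \<noteq> 0\<close> cs(3) by (cases cs) (simp_all add: p_def)
  then have "p \<noteq> 0"
    using cs(3) by auto
  moreover have "Polynomial.lead_coeff p = hd cs"
    using last_coeffs_eq_coeff_degree[OF \<open>p \<noteq> 0\<close>] coeffs cs(3) by (simp add: last_rev)
  moreover have "Poly (rev (map \<iota> cs)) = map_poly \<iota> p"
    by (simp add: map_poly_def coeffs rev_map)
  moreover have "0 \<le> w (poly (Poly (rev (map \<iota> cs))) z)"
      "\<zero>\<^bsub>F\<^esub> = residue (poly (Poly (rev (map \<iota> cs))) z)"
    using eval_residue[of "map \<iota> cs" z] cs z P(3) by auto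
  ultimately show thesis
    using that[of p] lead residue_eq_zero_iff by metis
qed

end

section \<open>The three kinds of extensions\<close>

text \<open>The nonzero constants and the elements x - b generate the multiplicative group. The
  decompositions below are stable under products and inverses, so only x - b requires an
  argument.\<close>

lemma ratfun_induct [consumes 1, case_names const lin mult inverse]:
  fixes z :: "'a::alg_closed_field poly fract"
  assumes "z \<noteq> 0" and const: "\<And>c. c \<noteq> 0 \<Longrightarrow> P (ratfun_const c)" and lin: "\<And>b. P (lin b)"
    and mult: "\<And>y z. y \<noteq> 0 \<Longrightarrow> z \<noteq> 0 \<Longrightarrow> P y \<Longrightarrow> P z \<Longrightarrow> P (y * z)"
    and inverse: "\<And>z. z \<noteq> 0 \<Longrightarrow> P z \<Longrightarrow> P (inverse z)"
  shows "P z"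
proof -
  have poly: "P (to_fract p)" if "p \<noteq> 0" for p
    using that
  proof (induction p rule: alg_closed_poly_induct)
    case (const c)
    then show ?case
      using assms(2)[of c] by (simp add: ratfun_const_def)
  next
    case (linear b p)
    then have "P (lin b * to_fract p)"
      by (intro mult lin) simp_all
    then show ?case
      by (simp only: to_fract_mult)
  qed
  obtain p q where pq: "q \<noteq> 0" "z = to_fract p / to_fract q"
    by (rule ratfun_cases[of z])
  with assms(1) have "p \<noteq> 0"
    by auto
  have "P (to_fract p * inverse (to_fract q))"
    using \<open>p \<noteq> 0\<close> pq(1) by (intro mult inverse poly) simp_all
  with pq show ?thesis
    by (simp add: divide_inverse)
qed

section \<open>Factors congruent to 1 and the kinds of extensions\<close>

context valued
begin

text \<open>Multiplication by such an element changes neither values nor residues, so both can be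
  computed from elements known up to such a factor.\<close>

definition one_units :: "'a set" where
  "one_units = {z. 0 < w (z - 1)}"

lemma one_units_value: "z \<in> one_units \<Longrightarrow> w z = 0"
  using unit_add_pos[of 1 "z - 1"] by (simp add: one_units_def)

lemma one_units_mult:
  assumes "y \<in> one_units" "z \<in> one_units"
  shows "y * z \<in> one_units"
proof -
  have "0 < w ((y - 1) * z + (z - 1))"
    using assms one_units_value[OF assms(2)] by (intro add_pos mult_pos) (auto simp: one_units_def)
  then show ?thesis
    by (simp add: one_units_def algebra_simps)
qed

lemma one_units_inverse:
  assumes "z \<in> one_units"
  shows "inverse z \<in> one_units"
proof -
  have wz: "w z = 0"
    by (rule one_units_value[OF assms])
  then have "z \<noteq> 0"
    by auto
  have "0 < w (z - 1)"
    using assms by (simp add: one_units_def)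
  then have "0 < w ((z - 1) / z)"
    using divide[OF \<open>z \<noteq> 0\<close>, of "z - 1"] wz by simp
  then have "0 < w (- ((z - 1) / z))"
    by simp
  also have "- ((z - 1) / z) = inverse z - 1"
    using \<open>z \<noteq> 0\<close> by (simp add: field_simps)
  finally show ?thesis
    by (simp add: one_units_def)
qed

lemma one_units_addI:
  assumes "w a < w b"
  shows "(a + b) / a \<in> one_units"
proof -
  have "a \<noteq> 0"
    using assms by auto
  moreover from this have "0 < w (b / a)"
    using assms by (simp add: less_iff_divide)
  ultimately show ?thesis
    by (simp add: one_units_def add_divide_distrib)
qed

lemma one_units_one: "1 \<in> one_units"
  by (simp add: one_units_def)

end

lemma (in valued_extension) residue_one_units: "z \<in> one_units \<Longrightarrow> residue z = \<one>\<^bsub>F\<^esub>"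
  using residue_cong[of 1 z] by (simp add: one_units_def residue_one)

locale ratfun_valuation = valued w
  for w :: "'a::field alg_closure poly fract \<Rightarrow> 'g::linordered_ab_group_add with_inf"
begin

sublocale j: field_embedding "ratfun_const :: 'a alg_closure \<Rightarrow> _"
  by (rule field_embedding_ratfun_const)

sublocale valued_extension "ratfun_const \<circ> to_ac" w
  using field_embedding_to_ac[where ?'a = 'a] j.field_embedding_axioms
  by unfold_locales (auto simp: field_embedding_def)

abbreviation \<iota> :: "'a \<Rightarrow> 'a alg_closure poly fract" where
  "\<iota> \<equiv> ratfun_const \<circ> to_ac"

lemma map_poly_\<iota>: "map_poly \<iota> p = map_poly ratfun_const (map_poly to_ac p)"
  by (simp add: map_poly_map_poly)

lemma eval_const: "poly (map_poly ratfun_const p) (ratfun_const b) = ratfun_const (poly p b)"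
  for p :: "'a alg_closure poly"
  by (induction p) (simp_all add: map_poly_pCons j.add j.mult)

text \<open>Elements of the closure are algebraic over K. The argument for valuation rings applies
  to the ring of \<open>w\<close> itself, which lies over the restriction of \<open>w\<close> to
  K.\<close>

lemma const_torsion:
  assumes "c \<noteq> 0"
  obtains n f where "n > 0" "f \<noteq> 0" "w (ratfun_const c ^ n) = w (\<iota> f)"
proof -
  interpret V: valring "valuation_ring w"
    by (rule valring)
  interpret V: valring_over "valuation_ring w" \<iota> "w \<circ> \<iota>"
    using h.valuation_comp[OF valuation]
    by unfold_locales (auto simp: valuation_ring_def)
  obtain p where p: "p \<noteq> 0" "poly (map_poly to_ac p) c = 0"
    by (rule alg_closure_algebraic)
  then have "poly (map_poly \<iota> p) (ratfun_const c) = 0"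
    by (simp only: map_poly_\<iota> eval_const) simp
  then have "ratfun_const c \<in> V.torsion"
    using p assms by (intro V.algebraic_imp_torsion) auto
  then obtain n f where nf: "n > 0" "f \<noteq> 0" "ratfun_const c ^ n / \<iota> f \<in> V.units"
    unfolding V.torsion_def by blast
  have fnz: "\<iota> f \<noteq> 0" and cnz: "ratfun_const c ^ n \<noteq> 0"
    using nf assms by auto
  have "0 \<le> w (ratfun_const c ^ n / \<iota> f)" "0 \<le> w (\<iota> f / ratfun_const c ^ n)"
    using nf(3) unfolding V.units_def by (simp_all add: valuation_ring_def)
  then have "w (ratfun_const c ^ n) = w (\<iota> f)"
    using le_iff_divide[OF fnz] le_iff_divide[OF cnz] by (metis order_antisym)
  with nf show thesis
    using that by blast
qed

text \<open>A polynomial over K vanishing at \<open>c\<close>, divided by a coefficient of least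
  value, has a nonzero reduction.\<close>

lemma const_algebraic:
  assumes "0 \<le> w (ratfun_const c)"
  shows "(F.algebraic over k0) (residue (ratfun_const c))"
proof -
  obtain p where p: "p \<noteq> 0" "poly (map_poly to_ac p) c = 0"
    by (rule alg_closure_algebraic)
  interpret v: valued "w \<circ> \<iota>"
    by unfold_locales (rule h.valuation_comp[OF valuation])
  obtain d where d: "Polynomial.coeff p d \<noteq> 0"
      "\<And>i. i \<le> Polynomial.degree p \<Longrightarrow> 0 \<le> w (\<iota> (Polynomial.coeff p i / Polynomial.coeff p d))"
    using valring.exists_dividing[OF v.valring, of "{..Polynomial.degree p}" "Polynomial.degree p" "Polynomial.coeff p"] p(1)
    by (auto simp: valuation_ring_def)
  define q where "q = smult (inverse (Polynomial.coeff p d)) p"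
  have coeff_q: "Polynomial.coeff q i = Polynomial.coeff p i / Polynomial.coeff p d" for i
    by (simp add: q_def divide_inverse mult.commute)
  show ?thesis
  proof (rule residue_algebraicI[OF assms])
    show "0 \<le> w (\<iota> (Polynomial.coeff q i))" for i
      unfolding coeff_q using d(2)[of i]
      by (cases "i \<le> Polynomial.degree p") (auto simp: coeff_eq_0)
    show "w (\<iota> (Polynomial.coeff q d)) = 0"
      unfolding coeff_q using d(1) h.one by simp
    have "poly (map_poly to_ac q) c = 0"
      using p(2) by (simp add: q_def map_poly_smult)
    then show "0 < w (poly (map_poly \<iota> q) (ratfun_const c))"
      by (simp only: map_poly_\<iota> eval_const) simp
  qed
qed

lemma subring_k0: "subring k0 F"
  by (rule subfieldE(1)[OF subfield_k0])

lemma lin_eq: "lin b = lin a + ratfun_const (a - b)"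
  using lin_diff[of b a] by (simp only: algebra_simps)

text \<open>Up to a factor congruent to 1, \<open>z\<close> is the constant \<open>c\<close>, so the
  two have the same residue.\<close>

lemma residue_algebraic_unit:
  assumes "w z = 0" "z / ratfun_const c \<in> one_units"
  shows "(F.algebraic over k0) (residue z)"
proof -
  have wu: "w (z / ratfun_const c) = 0"
    by (rule one_units_value[OF assms(2)])
  then have "ratfun_const c \<noteq> 0"
    by (auto simp del: j.eq_0_iff)
  then have "w (ratfun_const c) = 0"
    using divide[of "ratfun_const c" z] wu assms(1) by simp
  moreover have "residue z = residue (ratfun_const c * (z / ratfun_const c))"
    using \<open>ratfun_const c \<noteq> 0\<close> by simp
  ultimately have "residue z = residue (ratfun_const c)"
    using wu residue_one_units[OF assms(2)]
    by (simp only: residue_mult order_refl) (simp add: residue_in_carrier)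
  with const_algebraic[of c] \<open>w (ratfun_const c) = 0\<close> show ?thesis
    by simp
qed

lemma algebraic_extension_if_units:
  assumes "\<And>z. w z = 0 \<Longrightarrow> (F.algebraic over k0) (residue z)"
  shows "algebraic_extension F k0"
  unfolding algebraic_extension_def
proof
  fix x assume "x \<in> carrier F"
  then obtain z where z: "0 \<le> w z" "x = residue z"
    by (auto simp: carrier_F)
  show "F.algebraic k0 x"
  proof (cases "w z = 0")
    case True
    then show ?thesis
      using assms[of z] z by (simp add: over_def)
  next
    case False
    then have "x = \<zero>\<^bsub>F\<^esub>"
      using z by (simp add: residue_eq_zero_iff)
    then show ?thesis
      using F.zero_is_algebraic[OF subring_k0] by (simp add: over_def)
  qed
qed

text \<open>The values of x - a and of the constant \<open>a - b\<close> never coincide, so x - b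
  equals one of the two up to a factor congruent to 1. Every nonzero element thus becomes a constant
  times a power of x - a; \<open>m\<close> and \<open>n\<close> represent its integer exponent by
  natural numbers.\<close>

lemma value_transcendental_if:
  assumes a: "\<And>d. w (ratfun_const d) \<noteq> w (lin a)"
  shows "value_transcendental \<iota> w"
proof -
  interpret Q: comm_group Q
    by (rule comm_group_quotient)
  have decompose: "\<exists>c m n. c \<noteq> 0 \<and> z * lin a ^ m / (ratfun_const c * lin a ^ n) \<in> one_units"
    if "z \<noteq> 0" for z
    using that
  proof (induction z rule: ratfun_induct)
    case (const c)
    then show ?case
      using one_units_one by (intro exI[of _ c] exI[of _ 0]) auto
  next
    case (lin b)
    show ?case
    proof (cases "w (lin a) < w (ratfun_const (a - b))")
      case True
      from one_units_addI[OF this] show ?thesis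
        unfolding lin_eq[of b a] by (intro exI[of _ 1] exI[of _ 0]) (simp add: j.one)
    next
      case False
      then have less: "w (ratfun_const (a - b)) < w (lin a)"
        using a[of "a - b"] by simp
      then have "a \<noteq> b"
        by auto
      with one_units_addI[OF less] show ?thesis
        unfolding lin_eq[of b a] by (intro exI[of _ "a - b"] exI[of _ 0]) (simp add: add.commute)
    qed
  next
    case (mult y z)
    then obtain c m n c' m' n' where *: "c \<noteq> 0" "c' \<noteq> 0"
        "y * lin a ^ m / (ratfun_const c * lin a ^ n) \<in> one_units"
        "z * lin a ^ m' / (ratfun_const c' * lin a ^ n') \<in> one_units"
      by blast
    have "y * z * lin a ^ (m + m') / (ratfun_const (c * c') * lin a ^ (n + n')) =
        y * lin a ^ m / (ratfun_const c * lin a ^ n) * (z * lin a ^ m' / (ratfun_const c' * lin a ^ n'))"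
      by (simp add: j.mult power_add ac_simps)
    also have "\<dots> \<in> one_units"
      by (intro one_units_mult *)
    finally show ?case
      using * by (intro exI[of _ "c * c'"] exI[of _ "m + m'"] exI[of _ "n + n'"]) simp
  next
    case (inverse z)
    then obtain c m n where *: "c \<noteq> 0" "z * lin a ^ m / (ratfun_const c * lin a ^ n) \<in> one_units"
      by blast
    have "inverse z * lin a ^ n / (ratfun_const (inverse c) * lin a ^ m) =
        inverse (z * lin a ^ m / (ratfun_const c * lin a ^ n))"
      by (simp add: j.inverse divide_inverse ac_simps)
    also have "\<dots> \<in> one_units"
      by (intro one_units_inverse *)
    finally show ?case
      using * by (intro exI[of _ "inverse c"] exI[of _ n] exI[of _ m]) simp
  qed
  \<comment> \<open>Constants have \<open>n\<close>-th roots, so an equality for the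
    \<open>n\<close>-th power descends to x - a itself.\<close>
  have not_torsion: "w (lin a ^ n) \<noteq> w (ratfun_const c)" if n: "n > 0" for n c
  proof
    assume eq: "w (lin a ^ n) = w (ratfun_const c)"
    obtain d where "d ^ n = c"
      using nth_root_exists[OF n] by blast
    then have "w (lin a ^ n) = w (ratfun_const d ^ n)"
      using eq by (simp flip: j.power)
    then have "nsmul n (w (lin a)) = nsmul n (w (ratfun_const d))"
      by (simp only: power)
    then show False
      using root_value[OF n] a by metis
  qed
  have value_eq: "w (z * lin a ^ m) = w (ratfun_const c * lin a ^ n)"
    if "c \<noteq> 0" "z * lin a ^ m / (ratfun_const c * lin a ^ n) \<in> one_units" for z c m n
    using one_units_value[OF that(2)] that(1) by (subst eq_iff_divide) auto
  have rank: "rational_rank Q = 1"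
  proof (rule Q.rational_rank_eq_1I)
    show "coset_of (lin a) \<in> carrier Q"
      by (rule coset_of_in_carrier) simp
    show "coset_of (lin a) [^]\<^bsub>Q\<^esub> n \<noteq> \<one>\<^bsub>Q\<^esub>" if "n > 0" for n :: nat
      using not_torsion[OF that] by (simp add: coset_of_power coset_of_eq_one_iff)
    fix b assume "b \<in> carrier Q"
    then obtain z where z: "z \<noteq> 0" "b = coset_of z"
      by (auto simp: carrier_quotient)
    obtain c m n where c: "c \<noteq> 0" "z * lin a ^ m / (ratfun_const c * lin a ^ n) \<in> one_units"
      using decompose[OF z(1)] by blast
    \<comment> \<open>A power of the constant has the value of an element of K, which is trivial in
      the quotient.\<close>
    obtain N f where N: "N > 0" "f \<noteq> 0" "w (ratfun_const c ^ N) = w (\<iota> f)"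
      using const_torsion[OF c(1)] by blast
    have "w (z ^ N * lin a ^ (m * N)) = w ((z * lin a ^ m) ^ N)"
      by (simp only: power_mult power_mult_distrib)
    also have "\<dots> = w ((ratfun_const c * lin a ^ n) ^ N)"
      by (simp only: power value_eq[OF c])
    also have "\<dots> = w (\<iota> f * lin a ^ (n * N))"
      using N(3) by (simp only: power_mult_distrib power_mult mult)
    finally have "coset_of (z ^ N * lin a ^ (m * N)) = coset_of (\<iota> f * lin a ^ (n * N))"
      using z(1) N(2) by (intro coset_of_cong) auto
    also have "\<dots> = coset_of (\<iota> f) \<otimes>\<^bsub>Q\<^esub> coset_of (lin a ^ (n * N))"
      using N(2) by (intro coset_of_mult[symmetric]) auto
    also have "coset_of (\<iota> f) = \<one>\<^bsub>Q\<^esub>"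
      using N(2) by (subst coset_of_eq_one_iff) auto
    also have "\<one>\<^bsub>Q\<^esub> \<otimes>\<^bsub>Q\<^esub> coset_of (lin a ^ (n * N)) = coset_of (lin a ^ (n * N))"
      by (intro Q.l_one coset_of_in_carrier) simp
    finally have eq: "coset_of (z ^ N * lin a ^ (m * N)) = coset_of (lin a ^ (n * N))" .
    have "b [^]\<^bsub>Q\<^esub> N \<otimes>\<^bsub>Q\<^esub> coset_of (lin a) [^]\<^bsub>Q\<^esub> (m * N) = coset_of (z ^ N * lin a ^ (m * N))"
      using z by (simp add: coset_of_power coset_of_mult)
    also note eq
    also have "coset_of (lin a ^ (n * N)) = coset_of (lin a) [^]\<^bsub>Q\<^esub> (n * N)"
      by (rule coset_of_power[symmetric]) simp
    finally have "b [^]\<^bsub>Q\<^esub> N \<otimes>\<^bsub>Q\<^esub> coset_of (lin a) [^]\<^bsub>Q\<^esub> (m * N) = coset_of (lin a) [^]\<^bsub>Q\<^esub> (n * N)" .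
    with N(1) show "\<exists>(N::nat) (m::nat) (n::nat). N > 0 \<and>
        b [^]\<^bsub>Q\<^esub> N \<otimes>\<^bsub>Q\<^esub> coset_of (lin a) [^]\<^bsub>Q\<^esub> m = coset_of (lin a) [^]\<^bsub>Q\<^esub> n"
      by blast
  qed
  have "(F.algebraic over k0) (residue z)" if wz: "w z = 0" for z
  proof -
    have "z \<noteq> 0"
      using wz by auto
    then obtain c m n where c: "c \<noteq> 0" "z * lin a ^ m / (ratfun_const c * lin a ^ n) \<in> one_units"
      using decompose by blast
    have eq: "w (lin a ^ m) = w (ratfun_const c) + w (lin a ^ n)"
      using value_eq[OF c] wz by (simp add: mult)
    \<comment> \<open>Since \<open>z\<close> has value 0, different exponents would make a positive
      multiple of w(x - a) the value of a constant.\<close>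
    have "m = n"
    proof (rule ccontr)
      assume "m \<noteq> n"
      show False
      proof (cases "m < n")
        case True
        then have n: "w (lin a ^ n) = w (lin a ^ m) + w (lin a ^ (n - m))"
          by (simp flip: mult power_add)
        have "w (lin a ^ m) + 0 = w (ratfun_const c) + (w (lin a ^ m) + w (lin a ^ (n - m)))"
          unfolding n[symmetric] eq[symmetric] by (rule add_0_right)
        then have "w (lin a ^ m) + 0 = w (lin a ^ m) + (w (ratfun_const c) + w (lin a ^ (n - m)))"
          by (simp only: add.left_commute)
        then have "w (ratfun_const c) + w (lin a ^ (n - m)) = 0"
          by (subst (asm) with_inf_add_eq_cancel) auto
        then have "w (ratfun_const c) + w (lin a ^ (n - m)) = w (ratfun_const c) + w (ratfun_const (inverse c))"
          using c(1) inverse[of "ratfun_const c"] by (simp add: j.inverse)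
        then have "w (lin a ^ (n - m)) = w (ratfun_const (inverse c))"
          using c(1) by (subst (asm) with_inf_add_eq_cancel) auto
        then show False
          using not_torsion[of "n - m"] True by auto
      next
        case False
        then have m: "w (lin a ^ m) = w (lin a ^ n) + w (lin a ^ (m - n))"
          by (simp flip: mult power_add)
        have "w (lin a ^ n) + w (lin a ^ (m - n)) = w (lin a ^ n) + w (ratfun_const c)"
          unfolding m[symmetric] eq by (rule add.commute)
        then have "w (lin a ^ (m - n)) = w (ratfun_const c)"
          by (subst (asm) with_inf_add_eq_cancel) auto
        then show False
          using not_torsion[of "m - n"] False \<open>m \<noteq> n\<close> by auto
      qed
    qed
    then have "z / ratfun_const c \<in> one_units"
      using c(2) by simp
    with wz show ?thesis
      by (rule residue_algebraic_unit)
  qed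
  then have "algebraic_extension F k0"
    by (rule algebraic_extension_if_units)
  with rank show ?thesis
    by (simp add: value_transcendental_def)
qed

lemma torsion_if_const_values:
  assumes "\<And>z. z \<noteq> 0 \<Longrightarrow> \<exists>c. c \<noteq> 0 \<and> w z = w (ratfun_const c)"
  shows "torsion_group Q"
  unfolding torsion_quotient_iff
proof (intro allI impI)
  fix z :: "'a alg_closure poly fract"
  assume "z \<noteq> 0"
  then obtain c where c: "c \<noteq> 0" "w z = w (ratfun_const c)"
    using assms by blast
  obtain n f where "n > 0" "f \<noteq> 0" "w (ratfun_const c ^ n) = w (\<iota> f)"
    using const_torsion[OF c(1)] by blast
  moreover have "w (z ^ n) = w (ratfun_const c ^ n)"
    by (simp only: power c(2))
  ultimately show "\<exists>n f. n > 0 \<and> f \<noteq> 0 \<and> w (z ^ n) = w (\<iota> f)"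
    by auto
qed

text \<open>With \<open>a\<close> closer to x than \<open>b\<close>, the element x - b is the
  constant \<open>a - b\<close> up to a factor congruent to 1.\<close>

lemma valuation_algebraic_if:
  assumes unbounded: "\<And>b. \<exists>b'. w (lin b) < w (lin b')"
  shows "valuation_algebraic \<iota> w"
proof -
  have decompose: "\<exists>c. c \<noteq> 0 \<and> z / ratfun_const c \<in> one_units" if "z \<noteq> 0" for z
    using that
  proof (induction z rule: ratfun_induct)
    case (const c)
    then show ?case
      using one_units_one by (intro exI[of _ c]) auto
  next
    case (lin b)
    obtain a where a: "w (lin b) < w (lin a)"
      using unbounded by blast
    then have "w (ratfun_const (a - b)) = w (lin b)"
      using diff_eq_min[of "lin b" "lin a"] by (simp only: lin_diff) (simp add: min_def less_imp_le)
    with a have less: "w (ratfun_const (a - b)) < w (lin a)"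
      by simp
    have "a \<noteq> b"
      using a by auto
    with one_units_addI[OF less] show ?case
      unfolding lin_eq[of b a] by (intro exI[of _ "a - b"]) (simp add: add.commute)
  next
    case (mult y z)
    then obtain c c' where *: "c \<noteq> 0" "y / ratfun_const c \<in> one_units"
        "c' \<noteq> 0" "z / ratfun_const c' \<in> one_units"
      by blast
    have "y * z / ratfun_const (c * c') = y / ratfun_const c * (z / ratfun_const c')"
      by (simp add: j.mult)
    also have "\<dots> \<in> one_units"
      by (intro one_units_mult *)
    finally show ?case
      using * by (intro exI[of _ "c * c'"]) simp
  next
    case (inverse z)
    then obtain c where *: "c \<noteq> 0" "z / ratfun_const c \<in> one_units"
      by blast
    have "inverse z / ratfun_const (inverse c) = inverse (z / ratfun_const c)"
      by (simp add: j.inverse divide_inverse)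
    also have "\<dots> \<in> one_units"
      by (intro one_units_inverse *)
    finally show ?case
      using * by (intro exI[of _ "inverse c"]) simp
  qed
  have "\<exists>c. c \<noteq> 0 \<and> w z = w (ratfun_const c)" if z: "z \<noteq> 0" for z
  proof -
    obtain c where "c \<noteq> 0" "z / ratfun_const c \<in> one_units"
      using decompose[OF z] by blast
    then show ?thesis
      using one_units_value[of "z / ratfun_const c"]
      by (intro exI[of _ c]) (simp add: eq_iff_divide)
  qed
  then have "torsion_group Q"
    by (rule torsion_if_const_values)
  moreover have "(F.algebraic over k0) (residue z)" if wz: "w z = 0" for z
  proof -
    have "z \<noteq> 0"
      using wz by auto
    then obtain c where "z / ratfun_const c \<in> one_units"
      using decompose by blast
    with wz show ?thesis
      by (rule residue_algebraic_unit)
  qed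
  then have "algebraic_extension F k0"
    by (rule algebraic_extension_if_units)
  ultimately show ?thesis
    by (simp add: valuation_algebraic_def)
qed

text \<open>
  With \<open>d\<close> a constant of the same value as \<open>x - a\<close>, the residue of \<open>(x - a)/d\<close> is transcendental
  because no \<open>(x - a)/d - e\<close> has positive value.
\<close>

lemma residue_transcendental_if:
  assumes max: "\<And>b. w (lin b) \<le> w (lin a)" and d: "w (ratfun_const d) = w (lin a)"
  shows "residue_transcendental \<iota> w"
proof -
  have "d \<noteq> 0"
    using d eq_Infty_iff[of "lin a"] by (metis j.zero zero lin_nonzero)
  define y where "y = lin a / ratfun_const d"
  have wy: "w y = 0"
    using d \<open>d \<noteq> 0\<close> by (simp add: y_def flip: eq_iff_divide)
  define t where "t = residue y"
  have t: "t \<in> carrier F"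
    using wy by (simp add: t_def residue_in_carrier)
  \<comment> \<open>The difference is x - (a + d e) divided by \<open>d\<close>, so the maximality
    of w(x - a) bounds its value by 0.\<close>
  have y_diff: "w (y - ratfun_const e) \<le> 0" for e
  proof -
    have "y - ratfun_const e = lin (a + d * e) / ratfun_const d"
      using \<open>d \<noteq> 0\<close> lin_eq[of "a + d * e" a]
      by (simp only: y_def) (simp add: field_simps j.minus j.mult)
    then have "w (y - ratfun_const e) + w (ratfun_const d) = w (lin (a + d * e))"
      using \<open>d \<noteq> 0\<close> by (simp only:) (rule divide, simp)
    also have "\<dots> \<le> w (ratfun_const d) + 0"
      using max[of "a + d * e"] d by simp
    finally have "w (ratfun_const d) + w (y - ratfun_const e) \<le> w (ratfun_const d) + 0"
      by (simp add: add.commute)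
    then show ?thesis
      using \<open>d \<noteq> 0\<close> by (subst (asm) with_inf_add_le_cancel) auto
  qed
  \<comment> \<open>Each linear factor in \<open>y\<close> contributes at most 0. So a polynomial
    with leading coefficient of value 0 has no positive value at \<open>y\<close>, whereas an
    algebraic equation for \<open>t\<close> would lift to one that has.\<close>
  have bound: "w (poly (map_poly ratfun_const q) y) \<le> w (ratfun_const (Polynomial.lead_coeff q))"
    if "q \<noteq> 0" for q
    using that
  proof (induction q rule: alg_closed_poly_induct)
    case (const c)
    then show ?case
      by (simp add: map_poly_pCons)
  next
    case (linear b q)
    have "poly (map_poly ratfun_const ([:- b, 1:] * q)) y = (y - ratfun_const b) * poly (map_poly ratfun_const q) y"
      unfolding j.poly_map_poly_mult by (simp add: map_poly_pCons j.one j.minus)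
    moreover have "Polynomial.lead_coeff ([:- b, 1:] * q) = Polynomial.lead_coeff q"
      by (simp only: lead_coeff_mult) simp
    moreover have "w (y - ratfun_const b) + w (poly (map_poly ratfun_const q) y) \<le>
        0 + w (ratfun_const (Polynomial.lead_coeff q))"
      by (intro add_mono y_diff linear.IH)
    ultimately show ?case
      by (simp only: mult) simp
  qed
  have transcendental: "F.transcendental k0 t"
  proof (rule ccontr)
    assume "\<not> F.transcendental k0 t"
    then have "(F.algebraic over k0) (residue y)"
      by (simp add: over_def t_def)
    then obtain p where p: "p \<noteq> 0" "w (\<iota> (Polynomial.lead_coeff p)) = 0" "0 < w (poly (map_poly \<iota> p) y)"
      using residue_algebraicE[of y] wy by auto
    have "Polynomial.lead_coeff (map_poly to_ac p) = to_ac (Polynomial.lead_coeff p)"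
      by (simp add: coeff_map_poly degree_map_poly)
    then have "w (poly (map_poly \<iota> p) y) \<le> 0"
      using bound[of "map_poly to_ac p"] p(1,2) by (simp add: map_poly_\<iota> map_poly_to_ac_eq_0_iff)
    with p(3) show False
      by simp
  qed
  define K where "K = generate_field F (k0 \<union> {t})"
  have k0_carrier: "k0 \<subseteq> carrier F"
    by (rule subringE(1)[OF subring_k0])
  have K: "subfield K F" "k0 \<union> {t} \<subseteq> K"
    unfolding K_def using k0_carrier t
    by (auto intro!: F.generate_field_is_subfield intro: generate_field.incl)
  \<comment> \<open>As the relative algebraic closure of k0(t), \<open>A\<close> is a field. So it
    suffices to find in it the residues of suitably scaled constants and elements x - b.\<close>
  define A where "A = {x \<in> carrier F. (F.algebraic over K) x}"
  have A: "subfield A F"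
    unfolding A_def by (rule F.subfield_of_algebraics[OF K(1)])
  note A_ring = subringE[OF subfieldE(1)[OF A]]
  have const_A: "residue (ratfun_const c) \<in> A" if "0 \<le> w (ratfun_const c)" for c
    using const_algebraic[OF that] F.algebraic_mono[of k0 K] K(2) that
    by (auto simp: A_def residue_in_carrier)
  have t_A: "t \<in> A"
    unfolding A_def using K t by (auto intro!: F.algebraic_self[OF subfieldE(1)[OF K(1)]])
  have decompose: "\<exists>c. c \<noteq> 0 \<and> w (z / ratfun_const c) = 0 \<and> residue (z / ratfun_const c) \<in> A"
    if "z \<noteq> 0" for z
    using that
  proof (induction z rule: ratfun_induct)
    case (const c)
    then show ?case
      using A_ring(3) by (intro exI[of _ c]) (simp add: residue_one)
  next
    case (lin b)
    show ?case
    proof (cases "w (ratfun_const (a - b)) < w (lin a)")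
      case True
      then have "a \<noteq> b"
        by auto
      have "lin b / ratfun_const (a - b) \<in> one_units"
        using one_units_addI[OF True] unfolding lin_eq[of b a] by (simp add: add.commute)
      with \<open>a \<noteq> b\<close> show ?thesis
        using A_ring(3) by (intro exI[of _ "a - b"]) (auto simp: residue_one_units one_units_value)
    next
      case False
      define e where "e = (a - b) / d"
      have e: "ratfun_const e = ratfun_const (a - b) / ratfun_const d"
        by (simp only: e_def j.divide)
      have eq: "lin b / ratfun_const d = y + ratfun_const e"
        unfolding lin_eq[of b a] e y_def by (rule add_divide_distrib)
      have we: "0 \<le> w (ratfun_const e)"
        unfolding e using False d \<open>d \<noteq> 0\<close> by (subst le_iff_divide[symmetric]) auto
      \<comment> \<open>As a sum, y + e has nonnegative value; the bound from above makes it a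
        unit.\<close>
      have "w (y - ratfun_const (- e)) \<le> 0"
        by (rule y_diff)
      then have "w (y + ratfun_const e) = 0"
        using add_nonneg[of y "ratfun_const e"] wy we by (simp add: j.minus)
      moreover have "residue (y + ratfun_const e) \<in> A"
        using wy we t_A const_A[OF we] A_ring(7) by (simp add: residue_add flip: t_def)
      ultimately show ?thesis
        using \<open>d \<noteq> 0\<close> eq by (intro exI[of _ d]) simp
    qed
  next
    case (mult y z)
    then obtain c c' where *: "c \<noteq> 0" "w (y / ratfun_const c) = 0" "residue (y / ratfun_const c) \<in> A"
        "c' \<noteq> 0" "w (z / ratfun_const c') = 0" "residue (z / ratfun_const c') \<in> A"
      by blast
    have eq: "y * z / ratfun_const (c * c') = y / ratfun_const c * (z / ratfun_const c')"
      by (simp add: j.mult)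
    have "w (y / ratfun_const c * (z / ratfun_const c')) = 0"
      by (subst valued.mult[OF valued_axioms]) (simp only: * add_0_left)
    moreover have "residue (y / ratfun_const c * (z / ratfun_const c')) \<in> A"
      using * A_ring(6) by (subst residue_mult) auto
    ultimately have "w (y * z / ratfun_const (c * c')) = 0 \<and> residue (y * z / ratfun_const (c * c')) \<in> A"
      unfolding eq by blast
    then show ?case
      using *(1,4) by (intro exI[of _ "c * c'"]) simp
  next
    case (inverse z)
    then obtain c where *: "c \<noteq> 0" "w (z / ratfun_const c) = 0" "residue (z / ratfun_const c) \<in> A"
      by blast
    define u where "u = z / ratfun_const c"
    have u: "w u = 0" "residue u \<in> A"
      using * by (simp_all add: u_def)
    have eq: "inverse z / ratfun_const (inverse c) = inverse u"
      by (simp add: u_def j.inverse divide_inverse)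
    have "u \<noteq> 0"
      using u by auto
    then have "w (inverse u) = 0"
      using valued.inverse[OF valued_axioms, of u] u by simp
    moreover have "residue (inverse u) \<in> A"
      using u residue_eq_zero_iff[of u] F.subfield_m_inv(1)[OF A, of "residue u"]
      by (simp add: residue_inverse)
    ultimately show ?case
      using * eq by (intro exI[of _ "inverse c"]) simp
  qed
  have "\<exists>c. c \<noteq> 0 \<and> w z = w (ratfun_const c)" if "z \<noteq> 0" for z
    using decompose[OF that] by (auto simp: eq_iff_divide)
  then have "torsion_group Q"
    by (rule torsion_if_const_values)
  moreover have "x \<in> A" if x: "x \<in> carrier F" for x
  proof -
    obtain z where z: "0 \<le> w z" "x = residue z"
      using x by (auto simp: carrier_F)
    show ?thesis
    proof (cases "w z = 0")
      case True
      then have "z \<noteq> 0"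
        by auto
      then obtain c where c: "c \<noteq> 0" "w (z / ratfun_const c) = 0" "residue (z / ratfun_const c) \<in> A"
        using decompose by blast
      have "w (ratfun_const c) = 0"
        using c True by (simp flip: eq_iff_divide)
      moreover have "z = z / ratfun_const c * ratfun_const c"
        using c by simp
      ultimately show ?thesis
        using c z(2) const_A[of c] A_ring(6) residue_mult[of "z / ratfun_const c" "ratfun_const c"] by simp
    next
      case False
      then have "x = \<zero>\<^bsub>F\<^esub>"
        using z by (simp add: residue_eq_zero_iff)
      then show ?thesis
        using A_ring(2) by simp
    qed
  qed
  then have "algebraic_extension F K"
    by (auto simp: algebraic_extension_def A_def over_def)
  \<comment> \<open>For a basis with one element, transcendence is required over the field generated
    by \<open>k0\<close> alone.\<close>
  moreover have "generate_field F k0 = k0"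
    using F.generate_field_min_subfield1[OF k0_carrier subfield_k0] by (auto intro: generate_field.incl)
  ultimately show ?thesis
    using transcendental t
    by (auto simp: residue_transcendental_def has_transcendence_degree_def transcendence_basis_def K_def
        intro!: exI[of _ "{t}"])
qed

lemma value_transcendental_imp_not_torsion:
  "value_transcendental \<iota> w \<Longrightarrow> \<not> torsion_group Q"
  using comm_group.torsion_imp_rational_rank_neq_1[OF comm_group_quotient]
  by (auto simp: value_transcendental_def)

lemma residue_transcendental_imp_not_algebraic:
  assumes "residue_transcendental \<iota> w"
  shows "\<not> algebraic_extension F k0"
proof
  assume alg: "algebraic_extension F k0"
  obtain t where t: "t \<in> carrier F" "F.transcendental (generate_field F k0) t"
    using assms
    by (auto simp: residue_transcendental_def has_transcendence_degree_def transcendence_basis_def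
        card_1_singleton_iff)
  have "k0 \<subseteq> generate_field F k0"
    by (auto intro: generate_field.incl)
  from F.transcendental_mono[OF this, of t] t(2) have "F.transcendental k0 t"
    by (simp add: over_def)
  with alg t(1) show False
    by (auto simp: algebraic_extension_def)
qed

end

section \<open>Classification of the valuations of L(x)\<close>

lemma extends_restrict:
  assumes "extends (ratfun_const \<circ> to_ac) v w"
  shows "extends to_ac v (w \<circ> ratfun_const)"
  using assms field_embedding.valuation_comp[OF field_embedding_ratfun_const, of w]
  by (simp add: extends_def comp_assoc)

context ratfun_valuation
begin

lemma monomial_val_imp_value_transcendental:
  assumes "valuation u" "equivalent w (monomial_val u a \<gamma>)" "\<gamma> \<notin> carrier (value_group u)"
  shows "value_transcendental \<iota> w"
  using equivalent_monomial_val_maximal(2)[OF assms(1) valuation assms(2)] assms(3)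
  by (intro value_transcendental_if[of a]) auto

lemma monomial_val_imp_residue_transcendental:
  assumes "valuation u" "equivalent w (monomial_val u a \<gamma>)" "\<gamma> \<in> carrier (value_group u)"
  shows "residue_transcendental \<iota> w"
proof -
  obtain d where "w (ratfun_const d) = w (lin a)"
    using equivalent_monomial_val_maximal(2)[OF assms(1) valuation assms(2)] assms(3) by auto
  with equivalent_monomial_val_maximal(1)[OF assms(1) valuation assms(2)] show ?thesis
    by (rule residue_transcendental_if)
qed

lemma limit_val_imp_valuation_algebraic:
  assumes "valuation u" "transcendental_type u r A" "equivalent w (limit_val u r A)"
  shows "valuation_algebraic \<iota> w"
  using equivalent_limit_val_unbounded[OF assms(1) valuation assms(2,3)]
  by (rule valuation_algebraic_if)

text \<open>A maximal value w(x - a) itself serves as \<open>\<gamma>\<close>, so the monomial form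
  lives in the group of \<open>w\<close>.\<close>

lemma monomial_val_or_unbounded:
  "(\<exists>a \<gamma>. equivalent w (monomial_val (w \<circ> ratfun_const) a \<gamma>)) \<or> (\<forall>b. \<exists>b'. w (lin b) < w (lin b'))"
proof (cases "\<exists>a. \<forall>b. w (lin b) \<le> w (lin a)")
  case True
  then obtain a where a: "\<And>b. w (lin b) \<le> w (lin a)"
    by blast
  obtain \<gamma> where "w (lin a) = Fin \<gamma>"
    using nonzero_cases[of "lin a"] by auto
  then have "monomial_val (w \<circ> ratfun_const) a \<gamma> = w"
    by (rule maximal_imp_monomial_val[OF valuation a])
  then show ?thesis
    by (metis equivalent_refl)
next
  case False
  then show ?thesis
    by (auto simp: not_le)
qed

lemma monomial_val_or_limit_val:
  assumes "valuation u" "equivalent u (w \<circ> ratfun_const)"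
  shows "(\<exists>a \<gamma>. equivalent w (monomial_val (w \<circ> ratfun_const) a \<gamma>)) \<or>
    (\<exists>(r :: 'a alg_closure rel) A. transcendental_type u r A \<and> equivalent w (limit_val u r A))"
  using monomial_val_or_unbounded unbounded_imp_limit_val[OF valuation assms] by blast

lemma not_value_transcendental_if:
  "residue_transcendental \<iota> w \<or> valuation_algebraic \<iota> w \<Longrightarrow> \<not> value_transcendental \<iota> w"
  using value_transcendental_imp_not_torsion
  by (auto simp: residue_transcendental_def valuation_algebraic_def)

lemma not_residue_transcendental_if:
  "valuation_algebraic \<iota> w \<Longrightarrow> \<not> residue_transcendental \<iota> w"
  using residue_transcendental_imp_not_algebraic by (auto simp: valuation_algebraic_def)

end

text \<open>Ordered groups are types, over which a formula cannot quantify. Existence is therefore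
  claimed in the group of \<open>w\<close>, or in its divisible hull for K(x), while the
  implications with \<open>'h\<close> and \<open>'i\<close> say that a form written over any other
  group or index type determines the same kind. A fixed \<open>vt\<^sub>0\<close> is kept for
  sequences; in the monomial case an equivalent \<open>vt\<close> replaces it, as \<open>vt\<close>
  and \<open>\<gamma>\<close> must share a group.\<close>

theorem theorem3p11:
  fixes v :: "'k::field \<Rightarrow> 'v::linordered_ab_group_add with_inf"
  assumes "valuation v"
  shows
    "(\<forall>w :: 'k alg_closure poly fract \<Rightarrow> 'g::linordered_ab_group_add with_inf.
        extends (ratfun_const \<circ> to_ac) v w \<longrightarrow>
          ((\<exists>(vt :: 'k alg_closure \<Rightarrow> 'g with_inf) a \<gamma>.
              extends to_ac v vt \<and> equivalent w (monomial_val vt a \<gamma>)) \<or>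
           (\<exists>(vt :: 'k alg_closure \<Rightarrow> 'g with_inf) (r :: 'k alg_closure rel) A.
              extends to_ac v vt \<and> transcendental_type vt r A \<and> equivalent w (limit_val vt r A))) \<and>
          ((\<exists>(vt :: 'k alg_closure \<Rightarrow> 'g with_inf) a \<gamma>.
              extends to_ac v vt \<and> equivalent w (monomial_val vt a \<gamma>) \<and>
              \<gamma> \<notin> carrier (value_group vt))
            \<longleftrightarrow> value_transcendental (ratfun_const \<circ> to_ac) w) \<and>
          ((\<exists>(vt :: 'k alg_closure \<Rightarrow> 'h::linordered_ab_group_add with_inf) a \<gamma>.
              extends to_ac v vt \<and> equivalent w (monomial_val vt a \<gamma>) \<and>
              \<gamma> \<notin> carrier (value_group vt))
            \<longrightarrow> value_transcendental (ratfun_const \<circ> to_ac) w) \<and>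
          ((\<exists>(vt :: 'k alg_closure \<Rightarrow> 'g with_inf) a \<gamma>.
              extends to_ac v vt \<and> equivalent w (monomial_val vt a \<gamma>) \<and>
              \<gamma> \<in> carrier (value_group vt))
            \<longleftrightarrow> residue_transcendental (ratfun_const \<circ> to_ac) w) \<and>
          ((\<exists>(vt :: 'k alg_closure \<Rightarrow> 'h with_inf) a \<gamma>.
              extends to_ac v vt \<and> equivalent w (monomial_val vt a \<gamma>) \<and>
              \<gamma> \<in> carrier (value_group vt))
            \<longrightarrow> residue_transcendental (ratfun_const \<circ> to_ac) w) \<and>
          ((\<exists>(vt :: 'k alg_closure \<Rightarrow> 'g with_inf) (r :: 'k alg_closure rel) A.
              extends to_ac v vt \<and> transcendental_type vt r A \<and> equivalent w (limit_val vt r A))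
            \<longleftrightarrow> valuation_algebraic (ratfun_const \<circ> to_ac) w) \<and>
          ((\<exists>(vt :: 'k alg_closure \<Rightarrow> 'h with_inf) (r :: 'i rel) A.
              extends to_ac v vt \<and> transcendental_type vt r A \<and> equivalent w (limit_val vt r A))
            \<longrightarrow> valuation_algebraic (ratfun_const \<circ> to_ac) w)) \<and>
     (\<forall>w :: 'k poly fract \<Rightarrow> 'g with_inf.
        extends ratfun_const v w \<longrightarrow>
          ((\<exists>(vt :: 'k alg_closure \<Rightarrow> 'g div_hull with_inf) a \<gamma>.
              extends to_ac v vt \<and>
              equivalent w (monomial_val vt a \<gamma> \<circ> ratfun_to_ac)) \<or>
           (\<exists>(vt :: 'k alg_closure \<Rightarrow> 'g div_hull with_inf) (r :: 'k alg_closure rel) A.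
              extends to_ac v vt \<and> transcendental_type vt r A \<and>
              equivalent w (limit_val vt r A \<circ> ratfun_to_ac))) \<and>
          (\<forall>vt\<^sub>0 :: 'k alg_closure \<Rightarrow> 'u::linordered_ab_group_add with_inf.
             extends to_ac v vt\<^sub>0 \<longrightarrow>
               (\<exists>(vt :: 'k alg_closure \<Rightarrow> 'g div_hull with_inf) a \<gamma>.
                  valuation vt \<and> equivalent vt\<^sub>0 vt \<and>
                  equivalent w (monomial_val vt a \<gamma> \<circ> ratfun_to_ac)) \<or>
               (\<exists>(r :: 'k alg_closure rel) A.
                  transcendental_type vt\<^sub>0 r A \<and>
                  equivalent w (limit_val vt\<^sub>0 r A \<circ> ratfun_to_ac))))"
proof (intro conjI allI impI)
  fix w :: "'k alg_closure poly fract \<Rightarrow> 'g with_inf"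
  assume ext: "extends (ratfun_const \<circ> to_ac) v w"
  interpret ratfun_valuation w
    using ext by unfold_locales (simp add: extends_def)
  let ?M = "\<lambda>P. \<exists>(vt :: 'k alg_closure \<Rightarrow> 'g with_inf) a \<gamma>.
    extends to_ac v vt \<and> equivalent w (monomial_val vt a \<gamma>) \<and> P (\<gamma> \<in> carrier (value_group vt))"
  let ?L = "\<exists>(vt :: 'k alg_closure \<Rightarrow> 'g with_inf) (r :: 'k alg_closure rel) A.
    extends to_ac v vt \<and> transcendental_type vt r A \<and> equivalent w (limit_val vt r A)"
  have ext': "extends to_ac v (w \<circ> ratfun_const)"
    by (rule extends_restrict[OF ext])
  have cases: "(\<exists>(vt :: 'k alg_closure \<Rightarrow> 'g with_inf) a \<gamma>.
      extends to_ac v vt \<and> equivalent w (monomial_val vt a \<gamma>)) \<or> ?L"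
    using monomial_val_or_limit_val[of "w \<circ> ratfun_const"] ext' by (auto simp: extends_def)
  then show "(\<exists>(vt :: 'k alg_closure \<Rightarrow> 'g with_inf) a \<gamma>.
      extends to_ac v vt \<and> equivalent w (monomial_val vt a \<gamma>)) \<or> ?L" .
  \<comment> \<open>Each form implies its kind and the kinds exclude each other, so the occurrence
    of some form yields all three equivalences.\<close>
  have trichotomy: "?M Not \<or> ?M (\<lambda>b. b) \<or> ?L"
    using cases by blast
  have val_tr: "?M Not \<Longrightarrow> value_transcendental (ratfun_const \<circ> to_ac) w"
    using monomial_val_imp_value_transcendental by (auto simp: extends_def)
  have res_tr: "?M (\<lambda>b. b) \<Longrightarrow> residue_transcendental (ratfun_const \<circ> to_ac) w"
    using monomial_val_imp_residue_transcendental by (auto simp: extends_def)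
  have val_alg: "?L \<Longrightarrow> valuation_algebraic (ratfun_const \<circ> to_ac) w"
    using limit_val_imp_valuation_algebraic by (auto simp: extends_def)
  note exclusive = not_value_transcendental_if not_residue_transcendental_if
  show "?M Not \<longleftrightarrow> value_transcendental (ratfun_const \<circ> to_ac) w"
    using trichotomy val_tr res_tr val_alg exclusive by blast
  show "?M (\<lambda>b. b) \<longleftrightarrow> residue_transcendental (ratfun_const \<circ> to_ac) w"
    using trichotomy val_tr res_tr val_alg exclusive by blast
  show "?L \<longleftrightarrow> valuation_algebraic (ratfun_const \<circ> to_ac) w"
    using trichotomy val_tr res_tr val_alg exclusive by blast
  show "value_transcendental (ratfun_const \<circ> to_ac) w"
    if "\<exists>(vt :: 'k alg_closure \<Rightarrow> 'h with_inf) a \<gamma>. extends to_ac v vt \<and>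
      equivalent w (monomial_val vt a \<gamma>) \<and> \<gamma> \<notin> carrier (value_group vt)"
    using that monomial_val_imp_value_transcendental by (auto simp: extends_def)
  show "residue_transcendental (ratfun_const \<circ> to_ac) w"
    if "\<exists>(vt :: 'k alg_closure \<Rightarrow> 'h with_inf) a \<gamma>. extends to_ac v vt \<and>
      equivalent w (monomial_val vt a \<gamma>) \<and> \<gamma> \<in> carrier (value_group vt)"
    using that monomial_val_imp_residue_transcendental by (auto simp: extends_def)
  show "valuation_algebraic (ratfun_const \<circ> to_ac) w"
    if "\<exists>(vt :: 'k alg_closure \<Rightarrow> 'h with_inf) (r :: 'i rel) A.
      extends to_ac v vt \<and> transcendental_type vt r A \<and> equivalent w (limit_val vt r A)"
    using that limit_val_imp_valuation_algebraic by (auto simp: extends_def)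
next
  fix w :: "'k poly fract \<Rightarrow> 'g with_inf"
  assume ext: "extends ratfun_const v w"
  have w: "valuation w"
    using ext by (simp add: extends_def)
  obtain w' :: "'k alg_closure poly fract \<Rightarrow> 'g div_hull with_inf"
    where w': "valuation w'" "equivalent w (w' \<circ> ratfun_to_ac)"
    using valuation_extends_to_ac[OF w] by blast
  interpret ratfun_valuation w'
    by unfold_locales (rule w')
  \<comment> \<open>Both ways of embedding K into L(x) agree, so the restriction of
    \<open>w'\<close> to the closure extends \<open>v\<close>.\<close>
  have "equivalent (w \<circ> ratfun_const) (w' \<circ> ratfun_to_ac \<circ> ratfun_const)"
    by (rule equivalent_comp[OF w'(2)])
  also have "w' \<circ> ratfun_to_ac \<circ> ratfun_const = w' \<circ> ratfun_const \<circ> to_ac"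
    by (simp add: fun_eq_iff ratfun_to_ac_const)
  finally have eq: "equivalent (w \<circ> ratfun_const) (w' \<circ> ratfun_const \<circ> to_ac)" .
  have "equivalent v (w \<circ> ratfun_const)"
    using ext unfolding extends_def by blast
  then have "extends to_ac v (w' \<circ> ratfun_const)"
    unfolding extends_def using j.valuation_comp[OF w'(1)] equivalent_trans[OF _ eq] by blast
  moreover have "equivalent w (z \<circ> ratfun_to_ac)" if "equivalent w' z"
    for z :: "'k alg_closure poly fract \<Rightarrow> 'g div_hull with_inf"
    by (rule equivalent_trans[OF w'(2) equivalent_comp[OF that]])
  ultimately show "(\<exists>(vt :: 'k alg_closure \<Rightarrow> 'g div_hull with_inf) a \<gamma>.
        extends to_ac v vt \<and> equivalent w (monomial_val vt a \<gamma> \<circ> ratfun_to_ac)) \<or>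
      (\<exists>(vt :: 'k alg_closure \<Rightarrow> 'g div_hull with_inf) (r :: 'k alg_closure rel) A.
        extends to_ac v vt \<and> transcendental_type vt r A \<and>
        equivalent w (limit_val vt r A \<circ> ratfun_to_ac))"
    using monomial_val_or_limit_val[OF j.valuation_comp[OF w'(1)] equivalent_refl] by blast
next
  fix w :: "'k poly fract \<Rightarrow> 'g with_inf" and u :: "'k alg_closure \<Rightarrow> 'u with_inf"
  assume ext: "extends ratfun_const v w" and u: "extends to_ac v u"
  have "equivalent (u \<circ> to_ac) (w \<circ> ratfun_const)"
    using ext u by (auto simp: extends_def intro: equivalent_trans equivalent_sym)
  then interpret c: ratfun_compatible u w
    using ext u by unfold_locales (auto simp: extends_def)
  obtain w' :: "'k alg_closure poly fract \<Rightarrow> 'g div_hull with_inf"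
    where w': "valuation w'" "equivalent u (w' \<circ> ratfun_const)" "equivalent w (w' \<circ> ratfun_to_ac)"
    using c.joint_extension by blast
  interpret ratfun_valuation w'
    by unfold_locales (rule w')
  \<comment> \<open>The restriction of \<open>w'\<close> to the closure is equivalent to
    \<open>u\<close>: a sequence can be taken with respect to \<open>u\<close> itself, while the
    monomial form uses the restriction.\<close>
  from monomial_val_or_limit_val[OF c.u.valuation w'(2)]
  show "(\<exists>(vt :: 'k alg_closure \<Rightarrow> 'g div_hull with_inf) a \<gamma>. valuation vt \<and> equivalent u vt \<and>
        equivalent w (monomial_val vt a \<gamma> \<circ> ratfun_to_ac)) \<or>
      (\<exists>(r :: 'k alg_closure rel) A. transcendental_type u r A \<and>
        equivalent w (limit_val u r A \<circ> ratfun_to_ac))"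
  proof (elim disjE exE conjE)
    fix a \<gamma>
    assume "equivalent w' (monomial_val (w' \<circ> ratfun_const) a \<gamma>)"
    then show ?thesis
      using w'(2) c.j.valuation_comp[OF w'(1)] equivalent_trans[OF w'(3) equivalent_comp] by blast
  next
    fix r :: "'k alg_closure rel" and A
    assume "transcendental_type u r A" "equivalent w' (limit_val u r A)"
    then show ?thesis
      using equivalent_trans[OF w'(3) equivalent_comp] by blast
  qed
qed

end
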